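(* Fix an integer $d\ge 2$. For $n\ge1$ let $T_n$ be a uniformly random $d$-ary increasing tree with $n$ vertices. Let $f$ be a real-valued toll function on $d$-ary increasing trees and let $F$ be the associated additive functional. Assume (C1) $f$ is bounded, and (C2) $\sum_{k\ge1}\frac{\mathbb{E}|f(T_k)|}{k}<\infty$ and $\mathbb{E}|f(T_n)|\to0$ as $n\to\infty$. Then there exist constants $\mu$ and $\sigma$ such that, as $n\to\infty$, $$\mathbb{E}(F(T_n))=\mu n+\frac{\mu}{d-1}+o(1),\qquad \mathrm{Var}(F(T_n))=\sigma^2 n+o(n).$$ The constants can be represented as $$\mu=(d-1)\sum_{T} f(T)\prod_{j=1}^{|T|}\frac{1}{(d-1)j+d}$$ and $$\sigma^2=-\frac{\mu^2}{d-1}-(d-1)\sum_{T}\frac{f(T)^2-2f(T)\big(F(T)-\mu|T|\big)}{\prod_{j=1}^{|T|}((d-1)j+d)}+d\sum_{T_1}\sum_{T_2}\frac{(d-1)^{1-|T_1|-|T_2|}f(T_1)f(T_2)}{(|T_1|-1)!\,(|T_2|-1)!}\int_0^1\phi_{|T_1|}(x)\phi_{|T_2|}(x)\,dx,$$ where $\phi_k(x)=(1-x)^{-1}\int_x^1(1-w)^{d/(d-1)}w^{k-1}\,dw$, and all sums are over all $d$-ary increasing trees $T$ (with labels $1,\dots,|T|$). If $\sigma\neq0$, then $(F(T_n)-\mu n)/\sqrt{\sigma^2 n}$ converges weakly to a standard normal distribution.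
   Context: A $d$-ary increasing tree with $n$ vertices is a rooted tree in which every vertex has $d$ distinguishable positions (slots) where a child may be attached (so each vertex has at most $d$ children, each occupying a distinct slot), and whose vertices carry the distinct labels $1,\dots,n$ such that labels increase along every path starting at the root. $|T|$ denotes the number of vertices of $T$. The branches $B_1,\dots,B_k$ of $T$ are the subtrees rooted at the children of the root (with labels relabelled order-preservingly to $1,\dots,|B_j|$). A toll function $f$ assigns a real number to each $d$-ary increasing tree, depending only on the relative order of the labels. The additive functional $F$ associated with $f$ is defined recursively by $F(T)=\sum_{j=1}^k F(B_j)+f(T)$ (so $F$ of a single vertex equals $f$ of it); equivalently $F(T)=\sum_{S}f(S)$ over all fringe subtrees $S$ of $T$ (subtrees consisting of a vertex and all its descendants, relabelled order-preservingly). *)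

theory Defs
  imports "HOL-Probability.Probability" "HOL-Library.Landau_Symbols"
begin

text \<open>
  A labelled tree whose vertices have an ordered list of slots; a slot is either empty or
  holds a (nonempty) subtree.
\<close>

datatype 'a dary_tree = Empty | Node 'a "'a dary_tree list"

fun nverts :: "'a dary_tree \<Rightarrow> nat" where
  "nverts Empty = 0"
| "nverts (Node a ts) = Suc (\<Sum>t\<leftarrow>ts. nverts t)"

fun labels :: "'a dary_tree \<Rightarrow> 'a list" where
  "labels Empty = []"
| "labels (Node a ts) = a # concat (map labels ts)"

fun dary :: "nat \<Rightarrow> 'a dary_tree \<Rightarrow> bool" where
  "dary d Empty \<longleftrightarrow> True"
| "dary d (Node a ts) \<longleftrightarrow> length ts = d \<and> (\<forall>t\<in>set ts. dary d t)"

text \<open>Label sequences along the paths that start at the root and go down to some vertex.\<close>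

fun root_paths :: "'a dary_tree \<Rightarrow> 'a list set" where
  "root_paths Empty = {}"
| "root_paths (Node a ts) = insert [a] {a # p | p. \<exists>t\<in>set ts. p \<in> root_paths t}"

definition inc_trees :: "nat \<Rightarrow> nat dary_tree set" where
  "inc_trees d = {T. T \<noteq> Empty \<and> dary d T
     \<and> distinct (labels T) \<and> set (labels T) = {1..nverts T}
     \<and> (\<forall>p\<in>root_paths T. sorted_wrt (<) p)}"

definition inc_trees_of_size :: "nat \<Rightarrow> nat \<Rightarrow> nat dary_tree set" where
  "inc_trees_of_size d n = {T \<in> inc_trees d. nverts T = n}"

definition random_inc_tree :: "nat \<Rightarrow> nat \<Rightarrow> nat dary_tree pmf" where
  "random_inc_tree d n = pmf_of_set (inc_trees_of_size d n)"

text \<open>Order-preserving relabelling: each label is replaced by its rank among the labels.\<close>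

definition relabel :: "nat dary_tree \<Rightarrow> nat dary_tree" where
  "relabel t = map_dary_tree (\<lambda>x. card {y \<in> set (labels t). y \<le> x}) t"

fun branches :: "nat dary_tree \<Rightarrow> nat dary_tree list" where
  "branches Empty = []"
| "branches (Node a ts) = map relabel (filter (\<lambda>t. t \<noteq> Empty) ts)"

lemma nverts_map_dary_tree [simp]: "nverts (map_dary_tree g t) = nverts t"
  by (induction t) (simp_all cong: map_cong add: o_def)

lemma nverts_relabel [simp]: "nverts (relabel t) = nverts t"
  by (simp add: relabel_def)

lemma nverts_branch_less: "b \<in> set (branches T) \<Longrightarrow> nverts b < nverts T"
  by (cases T) (auto simp: less_Suc_eq_le intro!: member_le_sum_list)

text \<open>
  The toll function is only ever evaluated on trees carrying the labels \<open>1..n\<close>, so its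
  invariance under order-preserving relabelling is built in.
\<close>

function additive_functional :: "(nat dary_tree \<Rightarrow> real) \<Rightarrow> nat dary_tree \<Rightarrow> real" where
  "additive_functional f Empty = 0"
| "additive_functional f (Node a ts) = (\<Sum>b\<leftarrow>branches (Node a ts). additive_functional f b) + f (Node a ts)"
  by pat_completeness auto
termination
  by (relation "Wellfounded.measure (\<lambda>(f, T). nverts T)") (auto dest: nverts_branch_less simp del: branches.simps)

definition phi :: "nat \<Rightarrow> nat \<Rightarrow> real \<Rightarrow> real" where
  "phi d k x = inverse (1 - x) *
     integral {x..1} (\<lambda>w. (1 - w) powr (real d / (real d - 1)) * w ^ (k - 1))"

lemma length_labels: "length (labels t) = nverts t"
  by (induction t) (simp_all add: length_concat o_def cong: map_cong)

lemma set_labels: "set (labels t) = set_dary_tree t"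
  by (induction t) auto

lemma labels_map_dary_tree: "labels (map_dary_tree g t) = map g (labels t)"
  by (induction t) (simp_all add: map_concat o_def cong: map_cong)

lemma dary_map_dary_tree [simp]: "dary d (map_dary_tree g t) = dary d t"
  by (induction t) auto

lemma root_paths_map_dary_tree: "root_paths (map_dary_tree g t) = map g ` root_paths t"
proof (induction t)
  case (Node a ts)
  have *: "{c # p | p. \<exists>t\<in>set us. p \<in> h t} = (\<Union>t\<in>set us. (#) c ` h t)"
    for c and us :: "'c dary_tree list" and h :: "'c dary_tree \<Rightarrow> 'd list set"
    by auto
  have "(\<Union>t\<in>set ts. (#) (g a) ` root_paths (map_dary_tree g t))
      = (\<Union>t\<in>set ts. (#) (g a) ` map g ` root_paths t)"
    using Node by (intro SUP_cong) auto
  also have "\<dots> = map g ` (\<Union>t\<in>set ts. (#) a ` root_paths t)"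
    by (simp add: image_UN image_image)
  finally show ?case by (simp add: *)
qed simp

lemma root_paths_subset: "p \<in> root_paths t \<Longrightarrow> set p \<subseteq> set (labels t)"
  by (induction t arbitrary: p) fastforce+

lemma finite_inc_trees_of_size: "finite (inc_trees_of_size d n)"
proof -
  define S where "S m = {T. dary d T \<and> nverts T = m \<and> set (labels T) \<subseteq> {1..n}}" for m
  have "finite (S m)" for m
  proof (induction m rule: less_induct)
    case (less m)
    let ?L = "{ts. set ts \<subseteq> (\<Union>k<m. S k) \<and> length ts = d}"
    have "S m \<subseteq> insert Empty ((\<lambda>(a, ts). Node a ts) ` ({1..n} \<times> ?L))"
    proof
      fix T assume T: "T \<in> S m"
      show "T \<in> insert Empty ((\<lambda>(a, ts). Node a ts) ` ({1..n} \<times> ?L))"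
      proof (cases T)
        case (Node a ts)
        have "t \<in> S (nverts t) \<and> nverts t < m" if "t \<in> set ts" for t
        proof -
          have "nverts t \<le> (\<Sum>t\<leftarrow>ts. nverts t)" using that by (intro member_le_sum_list) auto
          with T Node that show ?thesis by (auto simp: S_def)
        qed
        with T Node show ?thesis by (auto simp: S_def image_iff)
      qed simp
    qed
    moreover have "finite ?L" using less by (intro finite_lists_length_eq) auto
    ultimately show ?case by (meson finite_SigmaI finite_atLeastAtMost finite_imageI finite_insert finite_subset)
  qed
  moreover have "inc_trees_of_size d n \<subseteq> S n"
    by (auto simp: inc_trees_of_size_def inc_trees_def S_def)
  ultimately show ?thesis by (meson finite_subset)
qed

lemma inc_trees_of_size_nonempty:
  assumes "d \<ge> 1" "n \<ge> 1"
  shows "inc_trees_of_size d n \<noteq> {}"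
proof -
  have "\<exists>T :: nat dary_tree. T \<noteq> Empty \<and> dary d T \<and> nverts T = Suc m \<and> labels T = [i..<i + Suc m]
          \<and> (\<forall>p\<in>root_paths T. sorted_wrt (<) p)" for m i
  proof (induction m arbitrary: i)
    case 0
    have "dary d (Node i (replicate d Empty)) \<and> labels (Node i (replicate d Empty)) = [i]
       \<and> nverts (Node i (replicate d Empty)) = 1 \<and> root_paths (Node i (replicate d Empty)) = {[i]}"
      by (auto simp: sum_list_replicate)
    then show ?case by (intro exI[of _ "Node i (replicate d Empty)"]) auto
  next
    case (Suc m)
    from Suc[of "Suc i"] obtain T where T: "T \<noteq> Empty" "dary d T" "nverts T = Suc m"
      "labels T = [Suc i..<Suc i + Suc m]" "\<forall>p\<in>root_paths T. sorted_wrt (<) p" by blast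
    let ?T = "Node i (T # replicate (d - 1) Empty)"
    have "labels ?T = i # [Suc i..<Suc i + Suc m]" using T by simp
    also have "\<dots> = [i..<i + Suc (Suc m)]" by (subst (2) upt_conv_Cons) auto
    finally have l: "labels ?T = [i..<i + Suc (Suc m)]" .
    have "sorted_wrt (<) p" if "p \<in> root_paths ?T" for p
      using that T root_paths_subset[of _ T] by fastforce
    with l T assms show ?case
      by (intro exI[of _ ?T]) (auto simp: sum_list_replicate)
  qed
  from this[of "n - 1" 1] assms obtain T :: "nat dary_tree" where "T \<noteq> Empty" "dary d T" "nverts T = n"
    "labels T = [1..<1 + n]" "\<forall>p\<in>root_paths T. sorted_wrt (<) p" by auto
  then have "T \<in> inc_trees_of_size d n"
    by (auto simp: inc_trees_of_size_def inc_trees_def)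
  then show ?thesis by blast
qed

lemma rank_strict_mono:
  assumes "finite (A :: nat set)" "x \<in> A" "y \<in> A" "x < y"
  shows "card {z \<in> A. z \<le> x} < card {z \<in> A. z \<le> y}"
  using assms by (intro psubset_card_mono) (auto, force)

lemma branches_inc_trees:
  assumes "T \<in> inc_trees d" "b \<in> set (branches T)"
  shows "b \<in> inc_trees d"
proof -
  from assms obtain a ts t where T: "T = Node a ts" "t \<in> set ts" "t \<noteq> Empty" "b = relabel t"
    by (cases T) auto
  define A where "A = set (labels t)"
  define r where "r x = card {y \<in> A. y \<le> x}" for x
  have fin: "finite A" by (simp add: A_def)
  have b: "b = map_dary_tree r t" by (simp add: T(4) relabel_def r_def[abs_def] A_def)
  have mono: "r x < r y" if "x \<in> A" "y \<in> A" "x < y" for x y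
    unfolding r_def by (rule rank_strict_mono[OF fin that])
  then have inj: "inj_on r A" by (intro linorder_inj_onI') fastforce
  have dist: "distinct (labels t)"
    using assms(1) T by (auto simp: inc_trees_def distinct_concat_iff)
  then have cA: "card A = nverts t" by (simp add: A_def distinct_card length_labels)
  have "r ` A \<subseteq> {1..nverts t}"
    unfolding r_def cA[symmetric] using fin by (auto simp: Suc_le_eq card_gt_0_iff intro!: card_mono)
  then have im: "r ` A = {1..nverts t}"
    using inj cA by (intro card_subset_eq) (auto simp: card_image)
  have sorted: "sorted_wrt (<) p" if "p \<in> root_paths b" for p
  proof -
    from that obtain q where q: "q \<in> root_paths t" "p = map r q"
      by (auto simp: b root_paths_map_dary_tree)
    then have "a # q \<in> root_paths T" using T by auto
    then have "sorted_wrt (<) q" using assms(1) by (fastforce simp: inc_trees_def)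
    moreover have "set q \<subseteq> A" using root_paths_subset[OF q(1)] by (simp add: A_def)
    ultimately show ?thesis unfolding q(2) sorted_wrt_map
      using mono by (intro sorted_wrt_mono_rel[of q "(<)" "\<lambda>x y. r x < r y"]) auto
  qed
  have "dary d t" using assms(1) T by (auto simp: inc_trees_def)
  moreover have "b \<noteq> Empty" using T(3) by (cases t) (auto simp: b)
  ultimately show ?thesis
    using sorted dist inj im by (auto simp: inc_trees_def b labels_map_dary_tree distinct_map A_def)
qed

end

theory Submission
  imports Defs
begin

text \<open>
  Write \<open>a = d - 1\<close> and \<open>X\<^sub>n = a n + 1\<close>. Given their sizes, the \<open>d\<close> (possibly empty) branches of a
  uniformly random increasing tree are independent and uniform, so averages \<open>b\<^sub>n\<close> of additive
  quantities with toll \<open>r\<close> satisfy a linear recurrence over branch sizes, whose solution is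
  \<open>b\<^sub>n = X\<^sub>n b\<^sub>0 + r\<^sub>n + X\<^sub>n \<Sum>\<^sub>1\<^sub>\<le>\<^sub>k\<^sub><\<^sub>n d r\<^sub>k / (X\<^sub>k X\<^sub>k\<^sub>+\<^sub>1)\<close>.
  The centred functional \<open>Y(T) = F(T) - \<mu> |T| - \<mu>/a\<close>, with \<open>Y(\<emptyset>) = - \<mu>/a\<close>, is again additive
  with toll \<open>f\<close>. Its mean therefore tends to \<open>0\<close>, and its second moment obeys the same recurrence
  with a toll of order \<open>o(n)\<close>, which gives the variance. The double integral arises by evaluating
  the contribution of pairs of distinct branches through the generating function of \<open>E Y\<close>, which
  solves a first-order linear differential equation.

  For the central limit theorem, the distance between the characteristic function of \<open>Y(T\<^sub>n)\<close> at
  \<open>t = s/\<surd>n\<close> and the one of a centred Gaussian with variance proportional to \<open>X\<^sub>n\<close> is subadditive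
  along the branch decomposition, up to an error \<open>|t| E|f(T\<^sub>n)|\<close>. Following the recursion down to
  subtrees of size at most \<open>\<epsilon> \<surd>n\<close> and using a Taylor expansion there shows that it tends to \<open>0\<close>.
\<close>

subsection \<open>Branch decomposition of increasing trees\<close>

text \<open>Free slots, counted by \<open>X\<close>, set the scale throughout. With an empty slot
  taken as a tree of size 0 that has one free slot, they are exactly additive over the branches, so
  multiples of \<open>X n\<close>, unlike multiples of \<open>n\<close>, pass through every
  recursion without loss.

  The obstacle in the central limit theorem is that the hypotheses bound the centred functional only
  by a multiple of \<open>n\<close> and control no moment above the second. At
  \<open>t = s / sqrt n\<close>, a Taylor expansion for the whole tree leaves a cubic error bounded
  only by order \<open>sqrt n\<close>, and unrolling the recursion down to single vertices
  accumulates toll errors bounded only by the same order. Stopping at size \<open>M\<close> changes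
  the two bounds to \<open>M / sqrt n\<close> and to \<open>sqrt n / M\<close> times a quantity that
  vanishes as \<open>M\<close> grows. Only a cutoff close to \<open>sqrt n\<close> makes both
  small.\<close>

definition heap_ordered :: "nat dary_tree \<Rightarrow> bool" where
  "heap_ordered T \<longleftrightarrow> (\<forall>p\<in>root_paths T. sorted_wrt (<) p)"

lemma root_paths_cover: "x \<in> set (labels T) \<Longrightarrow> \<exists>p\<in>root_paths T. x \<in> set p"
proof (induction T)
  case (Node a ts)
  show ?case
  proof (cases "x = a")
    case False
    with Node.prems obtain t where t: "t \<in> set ts" "x \<in> set (labels t)" by auto
    from Node.IH[OF t] obtain p where "p \<in> root_paths t" "x \<in> set p" by blast
    with t show ?thesis by (intro bexI[of _ "a # p"]) auto
  qed auto
qed simp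

lemma heap_ordered_Empty [simp]: "heap_ordered Empty"
  by (simp add: heap_ordered_def)

text \<open>Trades the condition on paths for one that recurses into the slots. That the root label
  lies below all others uses \<open>root_paths_cover\<close>: every label of a slot lies on some
  path from the root of that slot.\<close>

lemma heap_ordered_Node:
  "heap_ordered (Node a ts) \<longleftrightarrow> (\<forall>t\<in>set ts. heap_ordered t \<and> (\<forall>x\<in>set (labels t). a < x))"
proof
  assume *: "heap_ordered (Node a ts)"
  have "sorted_wrt (<) (a # p)" if "t \<in> set ts" "p \<in> root_paths t" for t p
  proof -
    have "a # p \<in> root_paths (Node a ts)" using that by auto
    then show ?thesis using * unfolding heap_ordered_def by blast
  qed
  then show "\<forall>t\<in>set ts. heap_ordered t \<and> (\<forall>x\<in>set (labels t). a < x)"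
    using root_paths_cover by (fastforce simp: heap_ordered_def)
next
  assume *: "\<forall>t\<in>set ts. heap_ordered t \<and> (\<forall>x\<in>set (labels t). a < x)"
  show "heap_ordered (Node a ts)"
    unfolding heap_ordered_def
  proof
    fix p assume "p \<in> root_paths (Node a ts)"
    then consider "p = [a]" | q t where "t \<in> set ts" "q \<in> root_paths t" "p = a # q"
      by auto
    then show "sorted_wrt (<) p"
    proof cases
      case 2
      with * root_paths_subset[of q t] show ?thesis
        by (auto simp: heap_ordered_def)
    qed simp
  qed
qed

lemma heap_ordered_map_dary_tree:
  assumes "heap_ordered t" "\<And>x y. x \<in> set (labels t) \<Longrightarrow> y \<in> set (labels t) \<Longrightarrow> x < y \<Longrightarrow> g x < g y"
  shows "heap_ordered (map_dary_tree g t)"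
  unfolding heap_ordered_def root_paths_map_dary_tree
proof safe
  fix q assume q: "q \<in> root_paths t"
  then have "sorted_wrt (<) q" using assms(1) by (auto simp: heap_ordered_def)
  then show "sorted_wrt (<) (map g q)"
    unfolding sorted_wrt_map using assms(2) root_paths_subset[OF q]
    by (intro sorted_wrt_mono_rel[of q "(<)" "\<lambda>x y. g x < g y"]) auto
qed

text \<open>The label set is arbitrary and may be empty, in which case \<open>Empty\<close> is the
  only tree. An empty slot is then a tree like any other, and all \<open>d\<close> slots are treated
  alike.\<close>

definition trees_on :: "nat \<Rightarrow> nat set \<Rightarrow> nat dary_tree set" where
  "trees_on d A = {T. dary d T \<and> heap_ordered T \<and> distinct (labels T) \<and> set (labels T) = A}"

definition forests_on :: "nat \<Rightarrow> nat \<Rightarrow> nat set \<Rightarrow> nat dary_tree list set" where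
  "forests_on d l A = {ts. length ts = l \<and> (\<forall>t\<in>set ts. dary d t \<and> heap_ordered t) \<and>
     distinct (concat (map labels ts)) \<and> set (concat (map labels ts)) = A}"

lemma labels_eq_Nil_iff [simp]: "labels t = [] \<longleftrightarrow> t = Empty"
  by (cases t) auto

lemma trees_on_empty [simp]: "trees_on d {} = {Empty}"
  by (auto simp: trees_on_def)

lemma nverts_trees_on: "T \<in> trees_on d A \<Longrightarrow> nverts T = card A"
  unfolding trees_on_def using distinct_card[of "labels T"] by (auto simp: length_labels)

lemma inc_trees_of_size_eq:
  assumes "n \<ge> 1"
  shows "inc_trees_of_size d n = trees_on d {1..n}"
proof
  show "inc_trees_of_size d n \<subseteq> trees_on d {1..n}"
    by (auto simp: inc_trees_of_size_def inc_trees_def trees_on_def heap_ordered_def)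
  show "trees_on d {1..n} \<subseteq> inc_trees_of_size d n"
  proof
    fix T assume T: "T \<in> trees_on d {1..n}"
    then have "nverts T = n" using nverts_trees_on by fastforce
    moreover from this assms have "T \<noteq> Empty" by auto
    ultimately show "T \<in> inc_trees_of_size d n" using T
      by (auto simp: inc_trees_of_size_def inc_trees_def trees_on_def heap_ordered_def)
  qed
qed

lemma map_dary_tree_trees_on:
  assumes "strict_mono_on A g" "T \<in> trees_on d A"
  shows "map_dary_tree g T \<in> trees_on d (g ` A)"
proof -
  have "inj_on g A" using assms(1) by (rule strict_mono_on_imp_inj_on)
  then show ?thesis
    using assms heap_ordered_map_dary_tree[of T g]
    by (auto simp: trees_on_def labels_map_dary_tree distinct_map strict_mono_on_def)
qed

lemma bij_betw_map_dary_tree: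
  assumes "strict_mono_on A g"
  shows "bij_betw (map_dary_tree g) (trees_on d A) (trees_on d (g ` A))"
proof (rule bij_betwI[where g = "map_dary_tree (inv_into A g)"])
  have inj: "inj_on g A" using assms(1) by (rule strict_mono_on_imp_inj_on)
  have mono: "strict_mono_on (g ` A) (inv_into A g)"
    using assms inj by (auto simp: strict_mono_on_def)
      (metis (full_types) assms inj inv_into_f_f linorder_neqE_nat order_less_asym strict_mono_on_def)
  have id: "inv_into A g ` g ` A = A" using inj by force
  show "map_dary_tree g \<in> trees_on d A \<rightarrow> trees_on d (g ` A)"
    using map_dary_tree_trees_on[OF assms] by auto
  show "map_dary_tree (inv_into A g) \<in> trees_on d (g ` A) \<rightarrow> trees_on d A"
    using map_dary_tree_trees_on[OF mono, of _ d] id by auto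
  fix T
  show "map_dary_tree (inv_into A g) (map_dary_tree g T) = T" if "T \<in> trees_on d A"
  proof -
    have "map_dary_tree (inv_into A g \<circ> g) T = map_dary_tree id T"
      using that inj by (intro dary_tree.map_cong) (auto simp: trees_on_def set_labels)
    then show ?thesis by (simp add: dary_tree.map_comp dary_tree.map_id)
  qed
  show "map_dary_tree g (map_dary_tree (inv_into A g) T) = T" if "T \<in> trees_on d (g ` A)"
  proof -
    have "map_dary_tree (g \<circ> inv_into A g) T = map_dary_tree id T"
      using that by (intro dary_tree.map_cong) (auto simp: trees_on_def set_labels f_inv_into_f)
    then show ?thesis by (simp add: dary_tree.map_comp dary_tree.map_id)
  qed
qed

lemma bij_betw_relabel:
  assumes "finite A"
  shows "bij_betw relabel (trees_on d A) (trees_on d {1..card A})"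
proof -
  define r where "r x = card {y \<in> A. y \<le> x}" for x
  have mono: "strict_mono_on A r"
    using rank_strict_mono[OF assms] by (auto simp: strict_mono_on_def r_def)
  have "r ` A \<subseteq> {1..card A}"
    unfolding r_def using assms by (auto simp: Suc_le_eq card_gt_0_iff intro!: card_mono)
  then have im: "r ` A = {1..card A}"
    using strict_mono_on_imp_inj_on[OF mono] by (intro card_subset_eq) (auto simp: card_image)
  have "bij_betw (map_dary_tree r) (trees_on d A) (trees_on d {1..card A})"
    using bij_betw_map_dary_tree[OF mono, of d] im by simp
  moreover have "map_dary_tree r T = relabel T" if "T \<in> trees_on d A" for T
    using that by (auto simp: relabel_def trees_on_def r_def[abs_def])
  ultimately show ?thesis by (simp cong: bij_betw_cong)
qed

lemma finite_trees_on:
  assumes "finite A"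
  shows "finite (trees_on d A)"
proof (cases "A = {}")
  case False
  then have "finite (trees_on d {1..card A})"
    using inc_trees_of_size_eq[of "card A" d] finite_inc_trees_of_size[of d "card A"] assms
    by (metis One_nat_def Suc_leI card_gt_0_iff)
  then show ?thesis using bij_betw_relabel[OF assms] bij_betw_finite by blast
qed simp

lemma forests_on_0: "forests_on d 0 A = (if A = {} then {[]} else {})"
  by (auto simp: forests_on_def)

lemma forests_on_Suc:
  "forests_on d (Suc l) A =
     (\<lambda>(B, t, ts). t # ts) ` (SIGMA B:Pow A. trees_on d B \<times> forests_on d l (A - B))"
proof
  show "forests_on d (Suc l) A \<subseteq>
     (\<lambda>(B, t, ts). t # ts) ` (SIGMA B:Pow A. trees_on d B \<times> forests_on d l (A - B))"
  proof
    fix us assume us: "us \<in> forests_on d (Suc l) A"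
    then obtain t ts where [simp]: "us = t # ts" by (cases us) (auto simp: forests_on_def)
    have "t \<in> trees_on d (set (labels t))" "ts \<in> forests_on d l (A - set (labels t))"
         "set (labels t) \<subseteq> A"
      using us by (auto simp: forests_on_def trees_on_def)
    then show "us \<in> (\<lambda>(B, t, ts). t # ts) ` (SIGMA B:Pow A. trees_on d B \<times> forests_on d l (A - B))"
      by (intro image_eqI[of _ _ "(set (labels t), t, ts)"]) auto
  qed
  show "(\<lambda>(B, t, ts). t # ts) ` (SIGMA B:Pow A. trees_on d B \<times> forests_on d l (A - B))
      \<subseteq> forests_on d (Suc l) A"
    unfolding forests_on_def trees_on_def by (auto simp: subset_iff) blast
qed

text \<open>\<open>B\<close> can be read off from the labels of \<open>t\<close>, so the list alone
  determines the triple.\<close>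

lemma inj_on_forests_on_Suc:
  "inj_on (\<lambda>(B, t, ts). t # ts) (SIGMA B:Pow A. trees_on d B \<times> forests_on d l (A - B))"
  by (auto simp: inj_on_def trees_on_def)

lemma finite_forests_on: "finite A \<Longrightarrow> finite (forests_on d l A)"
proof (induction l arbitrary: A)
  case (Suc l)
  then show ?case unfolding forests_on_Suc
    by (intro finite_imageI finite_SigmaI finite_cartesian_product finite_trees_on)
       (auto intro: finite_subset)
qed (simp add: forests_on_0)

text \<open>Heap order forces the smallest label into the root, so only the forest in its slots is
  free.\<close>

lemma bij_betw_Node:
  assumes "finite A" "A \<noteq> {}"
  shows "bij_betw (Node (Min A)) (forests_on d d (A - {Min A})) (trees_on d A)"
  unfolding bij_betw_def
proof
  show "inj_on (Node (Min A)) (forests_on d d (A - {Min A}))" by (auto simp: inj_on_def)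
  show "Node (Min A) ` forests_on d d (A - {Min A}) = trees_on d A"
  proof
    show "Node (Min A) ` forests_on d d (A - {Min A}) \<subseteq> trees_on d A"
    proof
      fix T assume "T \<in> Node (Min A) ` forests_on d d (A - {Min A})"
      then obtain ts where ts: "ts \<in> forests_on d d (A - {Min A})" "T = Node (Min A) ts" by blast
      have "Min A < x" if "t \<in> set ts" "x \<in> set (labels t)" for t x
      proof -
        have "x \<in> A - {Min A}" using ts that unfolding forests_on_def by auto
        then show ?thesis using assms by (metis Diff_iff Min_le insertI1 le_neq_implies_less)
      qed
      then show "T \<in> trees_on d A"
        using ts Min_in[OF assms] by (auto simp: forests_on_def trees_on_def heap_ordered_Node)
    qed
    show "trees_on d A \<subseteq> Node (Min A) ` forests_on d d (A - {Min A})"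
    proof
      fix T assume T: "T \<in> trees_on d A"
      with assms obtain a ts where [simp]: "T = Node a ts" by (cases T) (auto simp: trees_on_def)
      have "Min A = a"
        using T assms by (intro Min_eqI) (auto simp: trees_on_def heap_ordered_Node less_imp_le)
      moreover have "ts \<in> forests_on d d (A - {a})"
        using T by (auto simp: trees_on_def heap_ordered_Node forests_on_def)
      ultimately show "T \<in> Node (Min A) ` forests_on d d (A - {Min A})" by auto
    qed
  qed
qed

definition tree_sum :: "nat \<Rightarrow> (nat dary_tree \<Rightarrow> 'a::field_char_0) \<Rightarrow> nat \<Rightarrow> 'a" where
  "tree_sum d g n = (\<Sum>T\<in>trees_on d {1..n}. g T)"

text \<open>The exponential normalisation absorbs the binomial coefficients that arise when labels
  are distributed over slots; forests then correspond to products of series.\<close>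

definition tree_egf :: "nat \<Rightarrow> (nat dary_tree \<Rightarrow> 'a::field_char_0) \<Rightarrow> 'a fps" where
  "tree_egf d g = Abs_fps (\<lambda>n. tree_sum d g n / fact n)"

lemma tree_egf_nth [simp]: "fps_nth (tree_egf d g) n = tree_sum d g n / fact n"
  by (simp add: tree_egf_def)

lemma sum_trees_on_relabel:
  "finite A \<Longrightarrow> (\<Sum>T\<in>trees_on d A. g (relabel T)) = tree_sum d g (card A)"
  unfolding tree_sum_def by (rule sum.reindex_bij_betw[OF bij_betw_relabel])

text \<open>Each slot has its own weight \<open>g i\<close>, so that one or two slots can be singled
  out later. The weights see only relabelled trees, hence only the cardinality of the label set
  given to a slot matters.\<close>

lemma sum_forests_on:
  fixes g :: "nat \<Rightarrow> nat dary_tree \<Rightarrow> 'a::field_char_0"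
  assumes "finite A"
  shows "(\<Sum>ts\<in>forests_on d l A. \<Prod>i<l. g i (relabel (ts ! i)))
       = fact (card A) * fps_nth (\<Prod>i<l. tree_egf d (g i)) (card A)"
  using assms
proof (induction l arbitrary: A g)
  case 0
  then show ?case by (auto simp: forests_on_0)
next
  case (Suc l)
  define n where "n = card A"
  let ?H = "\<Prod>i<l. tree_egf d (g (Suc i))"
  have "(\<Sum>ts\<in>forests_on d (Suc l) A. \<Prod>i<Suc l. g i (relabel (ts ! i)))
      = (\<Sum>(B, t, ts)\<in>(SIGMA B:Pow A. trees_on d B \<times> forests_on d l (A - B)).
           \<Prod>i<Suc l. g i (relabel ((t # ts) ! i)))"
    unfolding forests_on_Suc
    by (subst sum.reindex[OF inj_on_forests_on_Suc]) (simp add: o_def case_prod_unfold)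
  also have "\<dots> = (\<Sum>B\<in>Pow A. \<Sum>(t, ts)\<in>trees_on d B \<times> forests_on d l (A - B).
           g 0 (relabel t) * (\<Prod>i<l. g (Suc i) (relabel (ts ! i))))"
    using Suc.prems
    by (subst sum.Sigma[symmetric])
       (auto intro!: finite_trees_on finite_forests_on finite_cartesian_product
             intro: finite_subset simp: prod.lessThan_Suc_shift simp del: prod.lessThan_Suc)
  also have "\<dots> = (\<Sum>B\<in>Pow A. tree_sum d (g 0) (card B) * (fact (n - card B) * fps_nth ?H (n - card B)))"
  proof (intro sum.cong refl)
    fix B assume B: "B \<in> Pow A"
    then have fin: "finite B" "finite (A - B)" using Suc.prems by (auto intro: finite_subset)
    have "card (A - B) = n - card B"
      using B fin Suc.prems by (auto simp: n_def card_Diff_subset)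
    then show "(\<Sum>(t, ts)\<in>trees_on d B \<times> forests_on d l (A - B).
           g 0 (relabel t) * (\<Prod>i<l. g (Suc i) (relabel (ts ! i))))
         = tree_sum d (g 0) (card B) * (fact (n - card B) * fps_nth ?H (n - card B))"
      using Suc.IH[OF fin(2), of "\<lambda>i. g (Suc i)"]
      by (simp add: sum.cartesian_product[symmetric] sum_product[symmetric] sum_trees_on_relabel[OF fin(1)])
  qed
  also have "\<dots> = (\<Sum>k\<le>n. of_nat (n choose k) * (tree_sum d (g 0) k * (fact (n - k) * fps_nth ?H (n - k))))"
  proof -
    have "(\<Sum>B\<in>Pow A. h (card B)) = (\<Sum>k\<le>n. of_nat (n choose k) * h k)" for h :: "nat \<Rightarrow> 'a"
    proof -
      have "(\<Sum>B\<in>Pow A. h (card B)) = (\<Sum>k\<le>n. \<Sum>B\<in>{B\<in>Pow A. card B = k}. h (card B))"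
        using Suc.prems by (intro sum.group[symmetric]) (auto simp: n_def card_mono)
      also have "\<dots> = (\<Sum>k\<le>n. of_nat (n choose k) * h k)"
        using Suc.prems by (intro sum.cong) (auto simp: n_def n_subsets)
      finally show ?thesis .
    qed
    from this[of "\<lambda>k. tree_sum d (g 0) k * (fact (n - k) * fps_nth ?H (n - k))"] show ?thesis .
  qed
  also have "\<dots> = (\<Sum>k\<le>n. fact n * (fps_nth (tree_egf d (g 0)) k * fps_nth ?H (n - k)))"
    by (intro sum.cong refl) (simp add: binomial_fact)
  also have "\<dots> = fact n * fps_nth (tree_egf d (g 0) * ?H) n"
    by (simp add: fps_mult_nth sum_distrib_left atMost_atLeast0)
  finally show ?case by (simp add: n_def prod.lessThan_Suc_shift del: prod.lessThan_Suc)
qed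

fun slots :: "'a dary_tree \<Rightarrow> 'a dary_tree list" where
  "slots Empty = []"
| "slots (Node a ts) = ts"

text \<open>Every moment and characteristic function recursion is an instance of this identity:
  given their sizes, the branches are independent uniform heap_ordered trees.\<close>

lemma sum_prod_slots:
  fixes g :: "nat \<Rightarrow> nat dary_tree \<Rightarrow> 'a::field_char_0"
  shows "tree_sum d (\<lambda>T. \<Prod>i<d. g i (relabel (slots T ! i))) (Suc n)
       = fact n * fps_nth (\<Prod>i<d. tree_egf d (g i)) n"
proof -
  let ?A = "{1..Suc n}"
  have Min: "Min ?A = 1" by (intro Min_eqI) auto
  have "tree_sum d (\<lambda>T. \<Prod>i<d. g i (relabel (slots T ! i))) (Suc n)
      = (\<Sum>ts\<in>forests_on d d (?A - {Min ?A}). \<Prod>i<d. g i (relabel (slots (Node (Min ?A) ts) ! i)))"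
    unfolding tree_sum_def by (rule sum.reindex_bij_betw[OF bij_betw_Node, symmetric]) auto
  also have "\<dots> = fact n * fps_nth (\<Prod>i<d. tree_egf d (g i)) n"
    by (simp add: sum_forests_on Min)
  finally show ?thesis .
qed

subsection \<open>The recurrence over branch sizes\<close>

lemma tree_sum_0 [simp]: "tree_sum d g 0 = g Empty"
  by (simp add: tree_sum_def)

lemma tree_sum_add: "tree_sum d (\<lambda>T. g T + h T) n = tree_sum d g n + tree_sum d h n"
  by (simp add: tree_sum_def sum.distrib)

lemma tree_sum_cmult: "tree_sum d (\<lambda>T. c * g T) n = c * tree_sum d g n"
  by (simp add: tree_sum_def sum_distrib_left)

lemma tree_sum_sum: "tree_sum d (\<lambda>T. \<Sum>i\<in>I. g i T) n = (\<Sum>i\<in>I. tree_sum d (g i) n)"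
  unfolding tree_sum_def by (rule sum.swap)

section \<open>Counting increasing trees: the series \<open>P\<close> and its coefficients\<close>

locale dary_trees =
  fixes d :: nat
  assumes d_ge_2: "d \<ge> 2"
begin

definition a :: real where "a = real d - 1"

text \<open>The number of free slots: \<open>n\<close> vertices have \<open>d * n\<close> slots, of
  which \<open>n - 1\<close> are occupied, and the empty tree counts as one free slot. These are the
  places where a vertex with label \<open>n + 1\<close> can be attached.\<close>

definition X :: "nat \<Rightarrow> real" where "X n = a * real n + 1"

definition num_trees :: "nat \<Rightarrow> nat" where
  "num_trees n = card (trees_on d {1..n})"

definition p :: "nat \<Rightarrow> real" where "p n = real (num_trees n) / fact n"

definition P :: "real fps" where "P = tree_egf d (\<lambda>_. 1)"

lemma a_ge_1: "a \<ge> 1" and a_pos: "a > 0" and d_eq: "real d = a + 1" and a_nat: "real (d - Suc 0) = a"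
  using d_ge_2 by (auto simp: a_def of_nat_diff)

lemma X_pos [simp]: "X n > 0"
  using a_pos unfolding X_def by (intro add_nonneg_pos mult_nonneg_nonneg) auto

lemma X_0 [simp]: "X 0 = 1" and X_1: "X (Suc 0) = real d" and X_Suc: "X (Suc n) = X n + a"
  by (auto simp: X_def a_def algebra_simps)

lemma X_nonzero [simp]: "X n \<noteq> 0"
  by (metis X_pos less_irrefl)

lemma num_trees_pos: "num_trees n > 0"
proof (cases n)
  case (Suc m)
  then show ?thesis
    using inc_trees_of_size_nonempty[of d n] d_ge_2 inc_trees_of_size_eq[of n d]
    by (auto simp: num_trees_def card_gt_0_iff finite_trees_on)
qed (simp add: num_trees_def)

lemma p_pos [simp]: "p n > 0"
  using num_trees_pos by (simp add: p_def)

lemma p_nonzero [simp]: "p n \<noteq> 0"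
  by (metis p_pos less_irrefl)

lemma P_nth: "fps_nth P n = p n"
  by (simp add: P_def p_def tree_sum_def num_trees_def)

lemma p_0 [simp]: "p 0 = 1"
  by (simp add: p_def num_trees_def)

lemma deriv_P: "fps_deriv P = P ^ d"
proof (rule fps_ext)
  fix n
  have "tree_sum d (\<lambda>T. 1 :: real) (Suc n) = fact n * fps_nth (P ^ d) n"
    using sum_prod_slots[of d "\<lambda>_ _. 1 :: real" n] by (simp add: P_def)
  then show "fps_nth (fps_deriv P) n = fps_nth (P ^ d) n"
    by (simp add: P_def field_simps del: of_nat_Suc)
qed

text \<open>Separation of variables for the equation \<open>deriv_P\<close>: the reciprocal of
  \<open>P ^ (d - 1)\<close> has the constant derivative \<open>- a\<close>. Working with this power
  avoids fractional powers of formal series, and its coefficients are the geometric kernel of the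
  recurrence.\<close>

lemma P_power_mult: "P ^ (d - 1) * (1 - fps_const a * fps_X) = 1"
proof -
  define Q where "Q = P ^ (d - 1)"
  have Q0: "fps_nth Q 0 = 1" by (simp add: Q_def fps_power_zeroth P_nth)
  have "fps_deriv Q = fps_const a * (P ^ (d - 1 - 1) * P ^ d)"
    by (simp add: Q_def fps_deriv_power deriv_P a_nat mult_ac flip: fps_of_nat)
  also have "P ^ (d - 1 - 1) * P ^ d = Q ^ 2"
    using d_ge_2 unfolding Q_def power_mult[symmetric] power_add[symmetric]
    by (intro arg_cong[where f = "power P"]) auto
  finally have Q': "fps_deriv Q = fps_const a * Q ^ 2" .
  have inv: "inverse Q * Q = 1" by (intro inverse_mult_eq_1) (simp add: Q0)
  have "fps_deriv (inverse Q) = - fps_const a * (inverse Q * Q) ^ 2"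
    by (subst fps_inverse_deriv) (simp_all add: Q0 Q' power_mult_distrib mult_ac flip: fps_const_neg)
  also have "\<dots> = fps_deriv (1 - fps_const a * fps_X)"
    by (simp add: inv)
  finally have "inverse Q = 1 - fps_const a * fps_X"
    by (subst (asm) fps_deriv_eq_iff) (simp add: Q0)
  with inv show ?thesis by (simp add: Q_def mult.commute)
qed

lemma P_power_nth: "fps_nth (P ^ (d - 1)) n = a ^ n"
proof (induction n)
  case 0
  then show ?case by (simp add: fps_power_zeroth P_nth)
next
  case (Suc n)
  have "fps_nth (P ^ (d - 1) * (1 - fps_const a * fps_X)) (Suc n) = 0"
    unfolding P_power_mult by simp
  then have "fps_nth (P ^ (d - 1)) (Suc n) - a * fps_nth (P ^ (d - 1)) n = 0"
    by (simp add: right_diff_distrib mult.left_commute[of _ "fps_const a"])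
  with Suc show ?case by simp
qed

lemma P_power_d: "P ^ d = P * P ^ (d - 1)"
  using d_ge_2 by (cases d) auto

lemma p_convolution: "(\<Sum>k\<le>n. p k * a ^ (n - k)) = real (Suc n) * p (Suc n)"
proof -
  have "real (Suc n) * p (Suc n) = fps_nth (fps_deriv P) n" by (simp add: P_nth)
  also have "\<dots> = (\<Sum>k\<le>n. p k * a ^ (n - k))"
    unfolding deriv_P P_power_d fps_mult_nth P_power_nth by (simp add: P_nth atMost_atLeast0)
  finally show ?thesis by simp
qed

text \<open>Combinatorially, the label \<open>n + 1\<close> occupies one of the \<open>X n\<close>
  free slots of a tree with \<open>n\<close> vertices. Here this is read off from the differential
  equation after \<open>1 - a x\<close> has cleared the power \<open>P ^ (d - 1)\<close>.\<close>

lemma p_Suc: "real (Suc n) * p (Suc n) = X n * p n"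
proof -
  have "fps_deriv P * (1 - fps_const a * fps_X) = P"
    unfolding deriv_P P_power_d mult.assoc P_power_mult by simp
  then have "fps_nth (fps_deriv P * (1 - fps_const a * fps_X)) n = p n" by (simp add: P_nth)
  then have "real (Suc n) * p (Suc n) - a * (real n * p n) = p n"
    by (cases n) (simp_all add: right_diff_distrib mult.left_commute[of _ "fps_const a"] P_nth)
  then show ?thesis by (simp add: X_def algebra_simps)
qed

text \<open>\<open>w n k\<close> is the expected number of branches of size \<open>k\<close>, including empty ones,
  in a uniformly random tree of size \<open>n\<close>.\<close>

definition w :: "nat \<Rightarrow> nat \<Rightarrow> real" where
  "w n k = real d * p k * a ^ (n - 1 - k) / (real n * p n)"

lemma w_nonneg: "w n k \<ge> 0"
  using a_pos by (simp add: w_def less_imp_le)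

definition rec_sol :: "real \<Rightarrow> (nat \<Rightarrow> real) \<Rightarrow> nat \<Rightarrow> real" where
  "rec_sol b0 r n = (if n = 0 then b0 else
     r n + X n * (b0 + (\<Sum>k=1..<n. real d * r k / (X k * X (Suc k)))))"

text \<open>The kernel \<open>a ^ (n - k)\<close> is geometric: the sum over all sizes up to
  \<open>n\<close>, multiplied by \<open>a\<close>, becomes the sum for the next size except for a
  single new term. The full-history recurrence thus reduces to one of first order, which
  \<open>G\<close> solves by summation.\<close>

lemma rec_sol_recurrence:
  assumes "n \<ge> 1"
  shows "rec_sol b0 r n = (\<Sum>k<n. w n k * rec_sol b0 r k) + r n"
proof -
  define G where "G n = b0 + (\<Sum>k=1..<n. real d * r k / (X k * X (Suc k)))" for n
  have main: "real d * (\<Sum>k\<le>n. p k * a ^ (n - k) * rec_sol b0 r k)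
       = real (Suc n) * p (Suc n) * X (Suc n) * G (Suc n)" for n
  proof (induction n)
    case 0
    then show ?case using p_Suc[of 0] by (simp add: rec_sol_def G_def X_1)
  next
    case (Suc n)
    have step: "(\<Sum>k\<le>Suc n. p k * a ^ (Suc n - k) * rec_sol b0 r k)
       = a * (\<Sum>k\<le>n. p k * a ^ (n - k) * rec_sol b0 r k) + p (Suc n) * rec_sol b0 r (Suc n)"
      by (simp add: sum_distrib_left Suc_diff_le mult_ac)
    have "real d * (\<Sum>k\<le>Suc n. p k * a ^ (Suc n - k) * rec_sol b0 r k)
       = a * (real (Suc n) * p (Suc n) * X (Suc n) * G (Suc n))
         + real d * p (Suc n) * (r (Suc n) + X (Suc n) * G (Suc n))"
    proof -
      have "rec_sol b0 r (Suc n) = r (Suc n) + X (Suc n) * G (Suc n)"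
        by (simp add: rec_sol_def G_def)
      then show ?thesis
        unfolding step Suc[symmetric] by (simp only: distrib_left mult_ac)
    qed
    also have "\<dots> = p (Suc n) * X (Suc n) * ((a * real (Suc n) + real d) * G (Suc n)
         + real d * r (Suc n) / X (Suc n))"
      by (simp add: distrib_left) (simp add: algebra_simps)
    also have "a * real (Suc n) + real d = X (Suc (Suc n))"
      by (simp add: X_def d_eq algebra_simps)
    also have "X (Suc (Suc n)) * G (Suc n) + real d * r (Suc n) / X (Suc n)
        = X (Suc (Suc n)) * G (Suc (Suc n))"
      by (simp add: G_def distrib_left)
    finally show ?case by (simp only: p_Suc mult_ac)
  qed
  obtain m where [simp]: "n = Suc m" using assms by (cases n) auto
  have "(\<Sum>k<n. w n k * rec_sol b0 r k)
      = real d * (\<Sum>k\<le>m. p k * a ^ (m - k) * rec_sol b0 r k) / (real n * p n)"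
    by (simp add: w_def sum_distrib_left sum_divide_distrib lessThan_Suc_atMost mult_ac
        del: of_nat_Suc)
  also have "\<dots> = X n * G n"
    unfolding main by (simp del: of_nat_Suc)
  finally show ?thesis by (simp add: rec_sol_def G_def)
qed

lemma rec_sol_unique:
  assumes "\<And>n. n \<ge> 1 \<Longrightarrow> b n = (\<Sum>k<n. w n k * b k) + r n"
  shows "b n = rec_sol (b 0) r n"
proof (induction n rule: less_induct)
  case (less n)
  show ?case
  proof (cases "n = 0")
    case False
    then have "b n = (\<Sum>k<n. w n k * rec_sol (b 0) r k) + r n"
      using assms[of n] by (simp add: less[symmetric])
    with False show ?thesis using rec_sol_recurrence[of n "b 0" r] by simp
  qed (simp add: rec_sol_def)
qed

text \<open>Zero toll and initial value 1 turn \<open>rec_sol\<close> into \<open>X\<close>. Since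
  \<open>X\<close> is harmonic for the weights, multiples of it can be subtracted from error bounds
  without creating a new toll.\<close>

lemma sum_w_X: "n \<ge> 1 \<Longrightarrow> (\<Sum>k<n. w n k * X k) = X n"
proof -
  have "rec_sol 1 (\<lambda>_. 0) n = X n" for n by (simp add: rec_sol_def)
  then show "n \<ge> 1 \<Longrightarrow> (\<Sum>k<n. w n k * X k) = X n"
    using rec_sol_recurrence[of n 1 "\<lambda>_. 0"] by simp
qed

lemma sum_w: "n \<ge> 1 \<Longrightarrow> (\<Sum>k<n. w n k) = real d"
proof -
  assume "n \<ge> 1"
  then obtain m where [simp]: "n = Suc m" by (cases n) auto
  have "(\<Sum>k<n. w n k) = real d * (\<Sum>k\<le>m. p k * a ^ (m - k)) / (real n * p n)"
    by (simp add: w_def sum_distrib_left sum_divide_distrib lessThan_Suc_atMost mult_ac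
        del: of_nat_Suc)
  also have "\<dots> = real d" unfolding p_convolution by (simp del: of_nat_Suc)
  finally show ?thesis .
qed

section \<open>Growth of \<open>p\<close> and decay of the branch weights\<close>

lemma p_le: "p n \<le> a ^ n"
proof (induction n)
  case (Suc n)
  have "real (Suc n) * p (Suc n) = X n * p n" by (rule p_Suc)
  also have "\<dots> \<le> (a * real (Suc n)) * a ^ n"
    using Suc a_ge_1 by (intro mult_mono) (auto simp: X_def algebra_simps less_imp_le)
  finally have "real (Suc n) * p (Suc n) \<le> real (Suc n) * a ^ Suc n"
    by (simp add: mult_ac)
  then show ?case by (simp only: mult_le_cancel_left_pos of_nat_0_less_iff zero_less_Suc)
qed simp

text \<open>The left-hand side is the product of the factors \<open>1 + 1/(a j)\<close> for \<open>j \<le> n\<close>.\<close>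

lemma p_lower: "real (Suc n) * p (Suc n) / a ^ n \<ge> 1 + (\<Sum>j=1..n. 1 / real j) / a"
proof (induction n)
  case 0
  then show ?case using p_Suc[of 0] by simp
next
  case (Suc n)
  define y where "y = real (Suc n) * p (Suc n) / a ^ n"
  have "y \<ge> 1" using Suc a_pos unfolding y_def
    by (smt (verit, best) divide_nonneg_nonneg of_nat_0_le_iff sum_nonneg)
  have "real (Suc (Suc n)) * p (Suc (Suc n)) / a ^ Suc n = X (Suc n) * p (Suc n) / a ^ Suc n"
    by (simp only: p_Suc)
  also have "\<dots> = y * (1 + 1 / (a * real (Suc n)))"
    using a_pos by (simp add: y_def X_def field_simps del: of_nat_Suc)
  also have "\<dots> = y + y * (1 / (a * real (Suc n)))" by (simp add: algebra_simps)
  also have "\<dots> \<ge> (1 + (\<Sum>j=1..n. 1 / real j) / a) + 1 * (1 / (a * real (Suc n)))"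
    using Suc \<open>y \<ge> 1\<close> a_pos unfolding y_def[symmetric] by (intro add_mono mult_right_mono) auto
  finally show ?case by (simp add: add_divide_distrib mult.commute add.assoc)
qed

text \<open>For fixed \<open>k\<close> the weight is a constant divided by
  \<open>n * p n / a ^ (n - 1)\<close>. The lower bound \<open>p_lower\<close> for this quantity is
  only logarithmic, against the true order \<open>n powr (1 / a)\<close>, but divergence of the
  harmonic series suffices.\<close>

lemma w_tendsto_0: "(\<lambda>n. w n k) \<longlonglongrightarrow> 0"
proof -
  have "(\<lambda>n. w (Suc n) k) \<longlonglongrightarrow> 0"
  proof -
    define H where "H n = 1 + (\<Sum>j=1..n. 1 / real j) / a" for n
    have "filterlim (\<lambda>n. \<Sum>j=1..n. 1 / real j) at_top sequentially"
      using harm_at_top unfolding harm_def[abs_def] inverse_eq_divide .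
    then have H: "filterlim H at_top sequentially"
      unfolding H_def divide_inverse using a_pos
      by (intro filterlim_tendsto_add_at_top[OF tendsto_const] filterlim_at_top_mult_tendsto_pos[OF tendsto_const]) auto
    have "(\<lambda>n. real d * p k / a ^ k / H n) \<longlonglongrightarrow> 0"
      by (intro tendsto_divide_0[OF tendsto_const] filterlim_at_top_imp_at_infinity H)
    moreover have "\<forall>\<^sub>F n in sequentially. norm (w (Suc n) k) \<le> real d * p k / a ^ k / H n"
      using eventually_ge_at_top[of k]
    proof eventually_elim
      case (elim n)
      have H0: "H n > 0" using a_pos unfolding H_def
        by (intro add_pos_nonneg divide_nonneg_pos sum_nonneg) auto
      have "w (Suc n) k = real d * p k / a ^ k / (real (Suc n) * p (Suc n) / a ^ n)"
        using elim a_pos by (simp add: w_def power_diff field_simps del: of_nat_Suc)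
      also have "\<dots> \<le> real d * p k / a ^ k / H n"
        using H0 p_lower[of n] a_pos p_pos[of k]
        by (intro divide_left_mono mult_pos_pos) (auto simp: H_def less_imp_le simp del: p_pos)
      finally show ?case using w_nonneg by simp
    qed
    ultimately show ?thesis by (rule Lim_null_comparison[rotated])
  qed
  then show ?thesis by (rule LIMSEQ_imp_Suc)
qed

text \<open>A Toeplitz argument: the weights are nonnegative, every row sums to \<open>d\<close>,
  and every column tends to 0. The first \<open>K\<close> terms vanish in the limit, and the rest is
  at most \<open>d\<close> times a bound for the tail of \<open>b\<close>.\<close>

lemma sum_w_tendsto_0:
  assumes "b \<longlonglongrightarrow> (0::real)"
  shows "(\<lambda>n. \<Sum>k<n. w n k * b k) \<longlonglongrightarrow> 0"
proof (rule LIMSEQ_I)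
  fix e :: real assume e: "e > 0"
  define e' where "e' = e / (2 * real d)"
  have e': "e' > 0" using e d_ge_2 by (simp add: e'_def)
  from LIMSEQ_D[OF assms e'] obtain K where K: "\<And>k. k \<ge> K \<Longrightarrow> \<bar>b k\<bar> < e'" by auto
  have "(\<lambda>n. \<Sum>k<K. w n k * \<bar>b k\<bar>) \<longlonglongrightarrow> (\<Sum>k<K. 0 * \<bar>b k\<bar>)"
    by (intro tendsto_sum tendsto_mult w_tendsto_0 tendsto_const)
  then have "(\<lambda>n. \<Sum>k<K. w n k * \<bar>b k\<bar>) \<longlonglongrightarrow> 0" by simp
  from LIMSEQ_D[OF this, of "e/2"] e obtain N
    where N: "\<And>n. n \<ge> N \<Longrightarrow> \<bar>\<Sum>k<K. w n k * \<bar>b k\<bar>\<bar> < e / 2" by auto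
  show "\<exists>no. \<forall>n\<ge>no. norm ((\<Sum>k<n. w n k * b k) - 0) < e"
  proof (intro exI[of _ "max N (max K 1)"] allI impI)
    fix n assume n: "n \<ge> max N (max K 1)"
    have "\<bar>\<Sum>k<n. w n k * b k\<bar> \<le> (\<Sum>k<n. w n k * \<bar>b k\<bar>)"
      by (rule order_trans[OF sum_abs]) (simp add: abs_mult w_nonneg)
    also have "\<dots> \<le> (\<Sum>k<n. (if k < K then w n k * \<bar>b k\<bar> else 0) + w n k * e')"
      using K w_nonneg e' by (intro sum_mono) (auto simp: not_less intro!: mult_left_mono intro: less_imp_le)
    also have "\<dots> = (\<Sum>k<K. w n k * \<bar>b k\<bar>) + (\<Sum>k<n. w n k) * e'"
    proof -
      have "(\<Sum>k<n. (if k < K then w n k * \<bar>b k\<bar> else 0)) = (\<Sum>k<K. w n k * \<bar>b k\<bar>)"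
        using n by (intro sum.mono_neutral_cong_right) auto
      then show ?thesis by (simp add: sum.distrib sum_distrib_right)
    qed
    also have "(\<Sum>k<n. w n k) * e' = e / 2"
      using n d_ge_2 by (simp add: sum_w e'_def)
    also have "(\<Sum>k<K. w n k * \<bar>b k\<bar>) < e / 2" using N[of n] n by auto
    finally show "norm ((\<Sum>k<n. w n k * b k) - 0) < e" by simp
  qed
qed

lemma sum_inverse_X: "m \<le> n \<Longrightarrow> (\<Sum>k=m..<n. 1 / (X k * X (Suc k))) = (1 / X m - 1 / X n) / a"
proof -
  have "1 / (X k * X (Suc k)) = (1 / X k - 1 / X (Suc k)) / a" for k
  proof -
    have "1 / X k - 1 / X (Suc k) = (X (Suc k) - X k) / (X k * X (Suc k))" by (simp add: field_simps)
    then show ?thesis using a_pos by (simp add: X_Suc)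
  qed
  then have "(\<Sum>k=m..<n. 1 / (X k * X (Suc k))) = (\<Sum>k=m..<n. 1 / X k - 1 / X (Suc k)) / a"
    by (simp add: sum_divide_distrib)
  also assume "m \<le> n"
  then have "(\<Sum>k=m..<n. 1 / X k - 1 / X (Suc k)) = 1 / X m - 1 / X n"
    using sum_Suc_diff'[of m n "\<lambda>k. - (1 / X k)"] by (simp add: algebra_simps)
  finally show ?thesis .
qed

text \<open>The second factor of the bound dominates the expected number of vertices whose fringe subtree
  has more than \<open>M\<close> vertices.\<close>

lemma cutoff_bound:
  assumes rec: "\<And>n. n \<ge> 1 \<Longrightarrow> u n \<le> (\<Sum>k<n. w n k * u k) + r n"
    and init: "\<And>k. k \<le> M \<Longrightarrow> u k \<le> e k"
    and e: "\<And>k. e k \<ge> 0"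
    and R: "\<And>n. n > M \<Longrightarrow> r n + (\<Sum>k<n. w n k * e k) \<le> R" "R \<ge> 0"
    and n: "n > M"
  shows "u n \<le> R * (1 + real d / a * (X n / X (Suc M)))"
proof -
  \<comment> \<open>A supersolution with the constant toll \<open>R\<close> above the cutoff and
    none below. Sizes up to \<open>M\<close> are carried by \<open>e\<close>, whose effect on larger
    sizes is already contained in \<open>R\<close>.\<close>
  define b where "b = rec_sol 0 (\<lambda>n. if n > M then R else 0)"
  have b_nonneg: "b n \<ge> 0" for n
    using R(2) unfolding b_def rec_sol_def
    by (auto intro!: add_nonneg_nonneg mult_nonneg_nonneg sum_nonneg divide_nonneg_nonneg less_imp_le[OF X_pos])
  have le: "u n \<le> b n + (if n \<le> M then e n else 0)" for n
  proof (induction n rule: less_induct)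
    case (less n)
    show ?case
    proof (cases "n \<le> M")
      case True
      then show ?thesis using init[of n] b_nonneg[of n] by simp
    next
      case False
      then have n1: "n \<ge> 1" by auto
      have "u n \<le> (\<Sum>k<n. w n k * u k) + r n" using rec n1 by blast
      also have "(\<Sum>k<n. w n k * u k) \<le> (\<Sum>k<n. w n k * (b k + e k))"
      proof (intro sum_mono mult_left_mono w_nonneg)
        fix k assume "k \<in> {..<n}"
        then have "u k \<le> b k + (if k \<le> M then e k else 0)" using less by blast
        also have "\<dots> \<le> b k + e k" using e[of k] by simp
        finally show "u k \<le> b k + e k" .
      qed
      also have "\<dots> = (\<Sum>k<n. w n k * b k) + (\<Sum>k<n. w n k * e k)"
        by (simp add: algebra_simps sum.distrib)
      also have "\<dots> + r n \<le> (\<Sum>k<n. w n k * b k) + R" using R(1)[of n] False by simp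
      also have "\<dots> = b n"
        using rec_sol_recurrence[OF n1, of 0 "\<lambda>n. if n > M then R else 0"] False
        by (simp add: b_def)
      finally show ?thesis using False by simp
    qed
  qed
  have "(\<Sum>k=1..<n. real d * (if k > M then R else 0) / (X k * X (Suc k)))
      = (\<Sum>k=Suc M..<n. real d * R * (1 / (X k * X (Suc k))))"
    by (intro sum.mono_neutral_cong_right) auto
  also have "\<dots> = real d * R * ((1 / X (Suc M) - 1 / X n) / a)"
    using n by (subst sum_distrib_left[symmetric], subst sum_inverse_X) auto
  also have "\<dots> \<le> real d * R * (1 / X (Suc M) / a)"
    using R(2) a_pos by (intro mult_left_mono divide_right_mono) (auto simp: less_imp_le)
  finally have "b n \<le> R + X n * (real d * R * (1 / X (Suc M) / a))"
    using n unfolding b_def rec_sol_def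
    by (simp add: mult_left_mono[OF _ less_imp_le[OF X_pos]] del: times_divide_eq_right)
  also have "\<dots> = R * (1 + real d / a * (X n / X (Suc M)))" by (simp add: field_simps)
  finally show ?thesis using le[of n] n by simp
qed

end

subsection \<open>Averages over random trees\<close>

definition branch :: "nat dary_tree \<Rightarrow> nat \<Rightarrow> nat dary_tree" where
  "branch T i = relabel (slots T ! i)"

text \<open>The majorant relation between power series. Through it, estimates of averages at single
  sizes carry over to \<open>d\<close>-fold products without expanding the convolutions.\<close>

definition fps_dominated :: "'a::real_normed_field fps \<Rightarrow> real fps \<Rightarrow> bool" where
  "fps_dominated A B \<longleftrightarrow> (\<forall>n. norm (fps_nth A n) \<le> fps_nth B n)"

lemma fps_dominated_mult:
  assumes "fps_dominated A B" "fps_dominated A' B'"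
  shows "fps_dominated (A * A') (B * B')"
  unfolding fps_dominated_def
proof
  fix n
  have "norm (fps_nth (A * A') n) \<le> (\<Sum>i=0..n. norm (fps_nth A i * fps_nth A' (n - i)))"
    unfolding fps_mult_nth by (rule norm_sum)
  also have "\<dots> \<le> (\<Sum>i=0..n. fps_nth B i * fps_nth B' (n - i))"
    using assms unfolding norm_mult fps_dominated_def
    by (intro sum_mono mult_mono) (auto intro: order_trans[OF norm_ge_zero])
  finally show "norm (fps_nth (A * A') n) \<le> fps_nth (B * B') n" by (simp add: fps_mult_nth)
qed

lemma fps_dominated_power:
  "fps_dominated A B \<Longrightarrow> fps_dominated (A ^ l) (B ^ l)"
proof (induction l)
  case 0
  then show ?case by (auto simp: fps_dominated_def fps_one_def)
qed (simp add: fps_dominated_mult)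

lemma fps_dominated_add:
  assumes "fps_dominated A B" "fps_dominated A' B'"
  shows "fps_dominated (A + A') (B + B')"
  using assms unfolding fps_dominated_def
  by (auto intro!: norm_triangle_le add_mono)

text \<open>For numbers of modulus at most 1, a difference of products is at most the sum of the
  differences of the factors. This is the counterpart for series, with \<open>P\<close> in the place
  of 1, by the same telescoping.\<close>

lemma fps_dominated_power_diff:
  assumes "fps_dominated A P" "fps_dominated B P" "fps_dominated (A - B) D"
  shows "fps_dominated (A ^ Suc l - B ^ Suc l) (of_nat (Suc l) * (D * P ^ l))"
proof (induction l)
  case 0
  then show ?case using assms by simp
next
  case (Suc l)
  have "A ^ Suc (Suc l) - B ^ Suc (Suc l) = (A - B) * A ^ Suc l + B * (A ^ Suc l - B ^ Suc l)"
    by (simp add: algebra_simps)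
  moreover have "fps_dominated \<dots> (D * P ^ Suc l + P * (of_nat (Suc l) * (D * P ^ l)))"
    by (intro fps_dominated_add fps_dominated_mult Suc assms fps_dominated_power)
  moreover have "D * P ^ Suc l + P * (of_nat (Suc l) * (D * P ^ l))
      = of_nat (Suc (Suc l)) * (D * P ^ Suc l)"
    by (simp add: algebra_simps)
  ultimately show ?case by simp
qed

lemma relabel_Empty [simp]: "relabel Empty = Empty"
  by (simp add: relabel_def)

text \<open>\<open>branches\<close> leaves out the empty slots while \<open>branch\<close> runs over
  all of them; the sums agree because the functional vanishes on \<open>Empty\<close>.\<close>

lemma additive_functional_branch:
  assumes "dary d T" "T \<noteq> Empty"
  shows "additive_functional f T = (\<Sum>i<d. additive_functional f (branch T i)) + f T"
proof -
  obtain a ts where [simp]: "T = Node a ts" and len: "length ts = d"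
    using assms by (cases T) auto
  have "(\<Sum>b\<leftarrow>branches (Node a ts). additive_functional f b)
      = (\<Sum>t\<leftarrow>ts. additive_functional f (relabel t))"
    by (induction ts) auto
  also have "\<dots> = (\<Sum>i<d. additive_functional f (branch T i))"
    by (simp add: sum_list_sum_nth len branch_def atLeast0LessThan)
  finally show ?thesis by simp
qed

lemma nverts_branch:
  assumes "dary d T" "T \<noteq> Empty"
  shows "real (nverts T) = (\<Sum>i<d. real (nverts (branch T i))) + 1"
proof -
  obtain a ts where [simp]: "T = Node a ts" and len: "length ts = d"
    using assms by (cases T) auto
  have "(\<Sum>t\<leftarrow>ts. nverts t) = (\<Sum>i<d. nverts (branch T i))"
    by (simp add: sum_list_sum_nth len branch_def atLeast0LessThan)
  then show ?thesis by simp
qed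

lemma abs_additive_functional_le:
  assumes "\<And>T. T \<in> inc_trees d \<Longrightarrow> \<bar>f T\<bar> \<le> B" "T \<in> inc_trees d"
  shows "\<bar>additive_functional f T\<bar> \<le> B * real (nverts T)"
  using assms(2)
proof (induction "nverts T" arbitrary: T rule: less_induct)
  case less
  have T: "dary d T" "T \<noteq> Empty" using less.prems by (auto simp: inc_trees_def)
  have branch: "\<bar>additive_functional f (branch T i)\<bar> \<le> B * real (nverts (branch T i))" if i: "i < d" for i
  proof (cases "branch T i = Empty")
    case False
    then have ne: "slots T ! i \<noteq> Empty" by (auto simp: branch_def)
    have "branch T i \<in> set (branches T)"
      using T i ne by (cases T) (auto simp: branch_def)
    with less.prems less.hyps show ?thesis
      using branches_inc_trees nverts_branch_less by blast
  qed simp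
  have "\<bar>additive_functional f T\<bar> \<le> (\<Sum>i<d. \<bar>additive_functional f (branch T i)\<bar>) + \<bar>f T\<bar>"
    unfolding additive_functional_branch[OF T] by (intro order_trans[OF abs_triangle_ineq] add_mono sum_abs) simp
  also have "\<dots> \<le> (\<Sum>i<d. B * real (nverts (branch T i))) + B * 1"
    using branch assms(1)[OF less.prems] by (intro add_mono sum_mono) auto
  also have "\<dots> = B * real (nverts T)"
    unfolding nverts_branch[OF T] by (simp add: sum_distrib_left distrib_left)
  finally show ?case .
qed

context dary_trees
begin

text \<open>Stands for the expectation but is meaningful at size 0 as well, where there is no
  increasing tree to draw: it is then the value at \<open>Empty\<close>, as recurrences that include
  empty slots require. The type covers real moments and complex characteristic functions.\<close>

definition avg :: "(nat dary_tree \<Rightarrow> 'a::real_normed_field) \<Rightarrow> nat \<Rightarrow> 'a" where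
  "avg g n = tree_sum d g n / of_nat (num_trees n)"

lemma num_trees_nonzero [simp]: "num_trees n \<noteq> 0"
  by (metis num_trees_pos less_irrefl)

lemma avg_0 [simp]: "avg g 0 = g Empty"
  by (simp add: avg_def num_trees_def)

lemma avg_add: "avg (\<lambda>T. g T + h T) n = avg g n + avg h n"
  by (simp add: avg_def tree_sum_add add_divide_distrib)

lemma avg_cmult: "avg (\<lambda>T. c * g T) n = c * avg g n"
  by (simp add: avg_def tree_sum_cmult)

lemma avg_diff: "avg (\<lambda>T. g T - h T) n = avg g n - avg h n"
  using avg_add[of g "\<lambda>T. (-1) * h T" n] by (simp only: avg_cmult) simp

lemma avg_sum: "avg (\<lambda>T. \<Sum>i\<in>I. g i T) n = (\<Sum>i\<in>I. avg (g i) n)"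
  by (simp add: avg_def tree_sum_sum sum_divide_distrib)

lemma avg_const [simp]: "avg (\<lambda>T. c) n = c"
  using num_trees_nonzero[of n] by (simp add: avg_def tree_sum_def num_trees_def)

lemma avg_cong:
  assumes "\<And>T. T \<in> trees_on d {1..n} \<Longrightarrow> g T = h T"
  shows "avg g n = avg h n"
  unfolding avg_def tree_sum_def using assms by (simp cong: sum.cong)

lemma avg_mono:
  fixes g h :: "nat dary_tree \<Rightarrow> real"
  assumes "\<And>T. T \<in> trees_on d {1..n} \<Longrightarrow> g T \<le> h T"
  shows "avg g n \<le> avg h n"
  unfolding avg_def tree_sum_def using assms by (intro divide_right_mono sum_mono) auto

lemma norm_avg_le: "norm (avg g n) \<le> avg (\<lambda>T. norm (g T)) n"
  unfolding avg_def tree_sum_def norm_divide by (auto intro!: divide_right_mono norm_sum)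

lemma tree_egf_nth_avg:
  "fps_nth (tree_egf d g) n = avg g n * of_real (p n)"
  by (simp add: avg_def p_def)

lemma avg_prod_branch:
  fixes g :: "nat \<Rightarrow> nat dary_tree \<Rightarrow> 'a::real_normed_field"
  assumes "n \<ge> 1"
  shows "avg (\<lambda>T. \<Prod>i<d. g i (branch T i)) n
       = fps_nth (\<Prod>i<d. tree_egf d (g i)) (n - 1) / of_real (real n * p n)"
proof -
  obtain m where [simp]: "n = Suc m" using assms by (cases n) auto
  have "real n * p n * fact m = real (num_trees n)"
    by (simp add: p_def field_simps del: of_nat_Suc)
  then have "of_real (real n * p n * fact m) = (of_real (real (num_trees n)) :: 'a)" by (rule arg_cong)
  then have "of_real (real n * p n) * fact m = (of_nat (num_trees n) :: 'a)" by simp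
  moreover have "avg (\<lambda>T. \<Prod>i<d. g i (branch T i)) n
      = fact m * fps_nth (\<Prod>i<d. tree_egf d (g i)) m / of_nat (num_trees n)"
    by (simp add: avg_def branch_def sum_prod_slots)
  ultimately have "avg (\<lambda>T. \<Prod>i<d. g i (branch T i)) n
      = fact m * fps_nth (\<Prod>i<d. tree_egf d (g i)) m / (of_real (real n * p n) * fact m)" by metis
  then show ?thesis by simp
qed

lemma avg_branch:
  fixes g :: "nat dary_tree \<Rightarrow> real"
  assumes "n \<ge> 1" "i < d"
  shows "avg (\<lambda>T. g (branch T i)) n = (\<Sum>k<n. w n k * avg g k) / real d"
proof -
  obtain m where [simp]: "n = Suc m" using assms by (cases n) auto
  \<comment> \<open>Weight 1 on all other slots leaves the factor \<open>P ^ (d - 1)\<close>, whose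
    coefficients are the powers of \<open>a\<close> in \<open>w\<close>.\<close>
  define h where "h j = (if j = i then g else (\<lambda>_. 1))" for j
  have prod1: "(\<Prod>j<d. h j (branch T j)) = g (branch T i)" for T
    using assms by (subst prod.remove[of _ i]) (auto simp: h_def)
  have prod2: "(\<Prod>j<d. tree_egf d (h j)) = tree_egf d g * P ^ (d - 1)"
    using assms by (subst prod.remove[of _ i]) (auto simp: h_def P_def)
  have "avg (\<lambda>T. g (branch T i)) n = fps_nth (tree_egf d g * P ^ (d - 1)) m / (real n * p n)"
    using avg_prod_branch[OF assms(1), of h] by (simp add: prod1 prod2 del: of_nat_Suc)
  also have "fps_nth (tree_egf d g * P ^ (d - 1)) m = (\<Sum>k\<le>m. avg g k * p k * a ^ (m - k))"
    unfolding fps_mult_nth tree_egf_nth_avg P_power_nth by (simp add: atMost_atLeast0)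
  also have "\<dots> / (real n * p n) = (\<Sum>k<n. w n k * avg g k) / real d"
    using d_ge_2 by (simp add: w_def sum_divide_distrib lessThan_Suc_atMost field_simps
        del: of_nat_Suc)
  finally show ?thesis .
qed

lemma avg_sum_branch:
  fixes g :: "nat dary_tree \<Rightarrow> real"
  assumes "n \<ge> 1"
  shows "avg (\<lambda>T. \<Sum>i<d. g (branch T i)) n = (\<Sum>k<n. w n k * avg g k)"
  using d_ge_2 by (simp add: avg_sum avg_branch[OF assms])

lemma avg_branch_pair:
  fixes g :: "nat dary_tree \<Rightarrow> real"
  assumes "n \<ge> 1" "i < d" "j < d" "i \<noteq> j"
  shows "avg (\<lambda>T. g (branch T i) * g (branch T j)) n
       = fps_nth (tree_egf d g ^ 2 * P ^ (d - 2)) (n - 1) / (real n * p n)"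
proof -
  define h where "h l = (if l = i \<or> l = j then g else (\<lambda>_. 1))" for l
  have split: "{..<d} = insert i (insert j ({..<d} - {i, j}))" and "card ({..<d} - {i, j}) = d - 2"
    using assms by (auto simp: card_Diff_subset)
  have prod1: "(\<Prod>l<d. h l (branch T l)) = g (branch T i) * g (branch T j)" for T
    using assms by (subst split) (simp add: h_def)
  have prod2: "(\<Prod>l<d. tree_egf d (h l)) = tree_egf d g ^ 2 * P ^ (d - 2)"
    using assms \<open>card _ = _\<close>
    by (subst split) (simp add: h_def P_def power2_eq_square mult_ac)
  show ?thesis
    using avg_prod_branch[OF assms(1), of h] by (simp add: prod1 prod2)
qed

text \<open>The diagonal terms of the square reproduce the recurrence; distinct slots form
  \<open>d * a\<close> ordered pairs with equal averages.\<close>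

lemma avg_branch_off_diagonal:
  fixes g :: "nat dary_tree \<Rightarrow> real"
  assumes "n \<ge> 1"
  shows "avg (\<lambda>T. (\<Sum>i<d. g (branch T i))\<^sup>2) n = (\<Sum>k<n. w n k * avg (\<lambda>T. (g T)\<^sup>2) k)
       + real d * a * fps_nth (tree_egf d g ^ 2 * P ^ (d - 2)) (n - 1) / (real n * p n)"
proof -
  have "(\<Sum>i<d. g (branch T i))\<^sup>2 = (\<Sum>i<d. (g (branch T i))\<^sup>2) +
       (\<Sum>i<d. \<Sum>j\<in>{..<d} - {i}. g (branch T i) * g (branch T j))" for T
  proof -
    have "(\<Sum>i<d. g (branch T i))\<^sup>2 = (\<Sum>i<d. \<Sum>j<d. g (branch T i) * g (branch T j))"
      by (simp add: power2_eq_square sum_product)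
    also have "\<dots> = (\<Sum>i<d. (g (branch T i))\<^sup>2 + (\<Sum>j\<in>{..<d} - {i}. g (branch T i) * g (branch T j)))"
      by (intro sum.cong refl) (subst sum.remove, auto simp: power2_eq_square)
    finally show ?thesis by (simp add: sum.distrib)
  qed
  then have "avg (\<lambda>T. (\<Sum>i<d. g (branch T i))\<^sup>2) n = (\<Sum>k<n. w n k * avg (\<lambda>T. (g T)\<^sup>2) k) +
      (\<Sum>i<d. \<Sum>j\<in>{..<d} - {i}. avg (\<lambda>T. g (branch T i) * g (branch T j)) n)"
    by (simp add: avg_add avg_sum_branch[OF assms, of "\<lambda>T. (g T)\<^sup>2"])
       (simp add: avg_sum)
  also have "(\<Sum>i<d. \<Sum>j\<in>{..<d} - {i}. avg (\<lambda>T. g (branch T i) * g (branch T j)) n)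
     = (\<Sum>i<d. \<Sum>j\<in>{..<d} - {i}. fps_nth (tree_egf d g ^ 2 * P ^ (d - 2)) (n - 1) / (real n * p n))"
    using assms by (intro sum.cong refl avg_branch_pair) auto
  also have "\<dots> = real d * a * fps_nth (tree_egf d g ^ 2 * P ^ (d - 2)) (n - 1) / (real n * p n)"
    by (simp add: card_Diff_subset a_nat)
  finally show ?thesis .
qed

lemma expectation_random_inc_tree:
  fixes g :: "nat dary_tree \<Rightarrow> real"
  assumes "n \<ge> 1"
  shows "measure_pmf.expectation (random_inc_tree d n) g = avg g n"
proof -
  have "trees_on d {1..n} \<noteq> {}" using num_trees_pos[of n] by (auto simp: num_trees_def)
  then show ?thesis
    unfolding random_inc_tree_def inc_trees_of_size_eq[OF assms] avg_def tree_sum_def num_trees_def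
    by (subst integral_pmf_of_set) (auto simp: finite_trees_on)
qed

lemma expectation_random_inc_tree_complex:
  fixes g :: "nat dary_tree \<Rightarrow> complex"
  assumes "n \<ge> 1"
  shows "measure_pmf.expectation (random_inc_tree d n) g = avg g n"
proof -
  let ?S = "trees_on d {1..n}"
  have ne: "?S \<noteq> {}" using num_trees_pos[of n] by (auto simp: num_trees_def)
  have "measure_pmf.expectation (random_inc_tree d n) g = (\<Sum>T\<in>?S. pmf (pmf_of_set ?S) T *\<^sub>R g T)"
    unfolding random_inc_tree_def inc_trees_of_size_eq[OF assms]
    using ne by (intro integral_measure_pmf) (auto simp: finite_trees_on)
  also have "\<dots> = avg g n"
    unfolding avg_def tree_sum_def num_trees_def sum_divide_distrib
  proof (intro sum.cong refl)
    fix T assume "T \<in> ?S"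
    then have "pmf (pmf_of_set ?S) T = 1 / real (card ?S)"
      using ne finite_trees_on[of "{1..n}" d] by (subst pmf_of_set) auto
    then show "pmf (pmf_of_set ?S) T *\<^sub>R g T = g T / of_nat (card ?S)"
      by (simp only: scaleR_conv_of_real) simp
  qed
  finally show ?thesis .
qed

lemma trees_on_inc_trees: "n \<ge> 1 \<Longrightarrow> T \<in> trees_on d {1..n} \<Longrightarrow> T \<in> inc_trees d"
  unfolding inc_trees_of_size_eq[of n d, symmetric] by (simp add: inc_trees_of_size_def)

lemma trees_onD:
  assumes "n \<ge> 1" "T \<in> trees_on d {1..n}"
  shows "dary d T" "T \<noteq> Empty" "nverts T = n"
proof -
  show "dary d T" using assms by (simp add: trees_on_def)
  show n: "nverts T = n" using nverts_trees_on[OF assms(2)] by simp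
  show "T \<noteq> Empty" using n assms(1) by auto
qed

end

subsection \<open>Mean and second moment\<close>

context dary_trees
begin

text \<open>For \<open>k\<close> between 1 and \<open>n - 1\<close>, the expected number of fringe
  subtrees of size \<open>k\<close> in a random tree of size \<open>n\<close> is
  \<open>X n * wt k\<close>: take the indicator of \<open>k\<close> as toll and 0 as initial value
  in \<open>rec_sol\<close>.\<close>

definition wt :: "nat \<Rightarrow> real" where "wt k = real d / (X k * X (Suc k))"

lemma wt_nonneg: "wt k \<ge> 0"
  by (simp add: wt_def less_imp_le)

lemma X_ge: "X n \<ge> real n + 1" and X_ge_1: "X n \<ge> 1"
  using a_ge_1 mult_right_mono[of 1 a "real n"] by (simp_all add: X_def)

lemma X_at_top: "filterlim X at_top sequentially"
  by (rule filterlim_at_top_mono[OF filterlim_real_sequentially])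
     (use X_ge in \<open>auto intro!: always_eventually intro: order_trans[OF _ X_ge]\<close>)

lemma inverse_X_tendsto_0: "(\<lambda>n. c / X n) \<longlonglongrightarrow> 0"
  by (intro tendsto_divide_0[OF tendsto_const] filterlim_at_top_imp_at_infinity X_at_top)

lemma wt_tail_sums: "(\<lambda>k. wt (k + n)) sums (real d / (a * X n))"
proof -
  have "(\<lambda>k. real d / a * (1 / X (k + n))) \<longlonglongrightarrow> 0"
    using LIMSEQ_ignore_initial_segment[OF inverse_X_tendsto_0[of "real d / a"], of n] by simp
  from telescope_sums'[OF this]
  have "(\<lambda>k. real d / a * (1 / X (k + n)) - real d / a * (1 / X (Suc k + n))) sums (real d / a * (1 / X n))"
    by simp
  moreover have "real d / a * (1 / X (k + n)) - real d / a * (1 / X (Suc k + n)) = wt (k + n)" for k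
  proof -
    have "1 / X (k + n) - 1 / X (Suc (k + n)) = (X (Suc (k + n)) - X (k + n)) / (X (k + n) * X (Suc (k + n)))"
      by (simp add: field_simps)
    then have eq: "1 / X (k + n) - 1 / X (Suc (k + n)) = a / (X (k + n) * X (Suc (k + n)))"
      by (simp add: X_Suc)
    show ?thesis using a_pos
      unfolding right_diff_distrib[symmetric] add_Suc eq by (simp add: wt_def)
  qed
  ultimately show ?thesis by simp
qed

lemma rec_sol_eq:
  "rec_sol b0 r (Suc n) = r (Suc n) + X (Suc n) * (b0 + (\<Sum>k<n. wt (Suc k) * r (Suc k)))"
proof -
  have "(\<Sum>k=1..<Suc n. real d * r k / (X k * X (Suc k))) = (\<Sum>k<n. wt (Suc k) * r (Suc k))"
    unfolding wt_def by (simp add: sum.atLeast1_atMost_eq atLeastLessThanSuc_atLeastAtMost)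
  then show ?thesis by (simp add: rec_sol_def)
qed

lemma rec_sol_div_tendsto:
  assumes "summable (\<lambda>k. wt (Suc k) * r (Suc k))" "(\<lambda>n. r n / X n) \<longlonglongrightarrow> 0"
  shows "(\<lambda>n. rec_sol b0 r n / X n) \<longlonglongrightarrow> b0 + (\<Sum>k. wt (Suc k) * r (Suc k))"
proof -
  have "(\<lambda>n. r (Suc n) / X (Suc n) + (b0 + (\<Sum>k<n. wt (Suc k) * r (Suc k))))
      \<longlonglongrightarrow> 0 + (b0 + (\<Sum>k. wt (Suc k) * r (Suc k)))"
    by (intro tendsto_add tendsto_const summable_LIMSEQ assms(1) LIMSEQ_Suc[OF assms(2)])
  moreover have "rec_sol b0 r (Suc n) / X (Suc n)
      = r (Suc n) / X (Suc n) + (b0 + (\<Sum>k<n. wt (Suc k) * r (Suc k)))" for n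
    unfolding rec_sol_eq by (simp add: add_divide_distrib)
  ultimately have "(\<lambda>n. rec_sol b0 r (Suc n) / X (Suc n)) \<longlonglongrightarrow> b0 + (\<Sum>k. wt (Suc k) * r (Suc k))"
    by simp
  then show ?thesis by (rule LIMSEQ_imp_Suc)
qed

lemma summable_wt_bounded:
  assumes "\<And>k. \<bar>r (Suc k)\<bar> \<le> C"
  shows "summable (\<lambda>k. wt (Suc k) * r (Suc k))"
proof (rule summable_comparison_test)
  show "\<exists>N. \<forall>n\<ge>N. norm (wt (Suc n) * r (Suc n)) \<le> wt (n + 1) * C"
    using assms wt_nonneg by (auto simp: abs_mult intro!: mult_left_mono)
  show "summable (\<lambda>n. wt (n + 1) * C)"
    by (intro summable_mult2 sums_summable[OF wt_tail_sums])
qed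

text \<open>The initial value cancels the whole series, so that \<open>r n\<close> minus
  \<open>X n\<close> times a tail of the series remains. By \<open>wt_tail_sums\<close> the tail is
  at most a multiple of \<open>1 / X n\<close> times a bound for the later tolls, and the factor
  \<open>X n\<close> drops out.\<close>

lemma rec_sol_tendsto_0:
  assumes "r \<longlonglongrightarrow> 0" "summable (\<lambda>k. wt (Suc k) * r (Suc k))"
  shows "rec_sol (- (\<Sum>k. wt (Suc k) * r (Suc k))) r \<longlonglongrightarrow> 0"
proof -
  define S where "S = (\<Sum>k. wt (Suc k) * r (Suc k))"
  have "(\<lambda>n. rec_sol (- S) r (Suc n)) \<longlonglongrightarrow> 0"
  proof (rule LIMSEQ_I)
    fix e :: real assume e: "e > 0"
    define e' where "e' = e / (2 * (1 + real d / a))"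
    have pos: "1 + real d / a > 0" using a_pos by (intro add_pos_nonneg) auto
    have e': "e' > 0" using e pos by (simp add: e'_def)
    from LIMSEQ_D[OF assms(1) e'] obtain N where N: "\<And>n. n \<ge> N \<Longrightarrow> \<bar>r n\<bar> < e'" by auto
    show "\<exists>no. \<forall>n\<ge>no. norm (rec_sol (- S) r (Suc n) - 0) < e"
    proof (intro exI[of _ N] allI impI)
      fix n assume n: "n \<ge> N"
      have tail: "S - (\<Sum>k<n. wt (Suc k) * r (Suc k)) = (\<Sum>k. wt (k + Suc n) * r (k + Suc n))"
        unfolding S_def using suminf_minus_initial_segment[OF assms(2), of n] by simp
      have "\<bar>\<Sum>k. wt (k + Suc n) * r (k + Suc n)\<bar> \<le> (\<Sum>k. wt (k + Suc n) * e')"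
        unfolding real_norm_def[symmetric]
      proof (rule norm_suminf_le)
        show "norm (wt (k + Suc n) * r (k + Suc n)) \<le> wt (k + Suc n) * e'" for k
          using N[of "k + Suc n"] n wt_nonneg by (auto simp: abs_mult intro!: mult_left_mono)
        show "summable (\<lambda>k. wt (k + Suc n) * e')"
          by (intro summable_mult2 sums_summable[OF wt_tail_sums])
      qed
      also have "\<dots> = real d / (a * X (Suc n)) * e'"
        using sums_mult2[OF wt_tail_sums[of "Suc n"], of e'] by (simp add: sums_iff)
      finally have "\<bar>S - (\<Sum>k<n. wt (Suc k) * r (Suc k))\<bar> \<le> real d / (a * X (Suc n)) * e'"
        unfolding tail .
      then have "X (Suc n) * \<bar>- S + (\<Sum>k<n. wt (Suc k) * r (Suc k))\<bar>
          \<le> X (Suc n) * (real d / (a * X (Suc n)) * e')"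
        by (intro mult_left_mono) (auto simp: less_imp_le)
      also have "\<dots> = real d / a * e'" by simp
      finally have "\<bar>X (Suc n) * (- S + (\<Sum>k<n. wt (Suc k) * r (Suc k)))\<bar> \<le> real d / a * e'"
        by (simp add: abs_mult less_imp_le)
      then have "\<bar>rec_sol (- S) r (Suc n)\<bar> \<le> e' + real d / a * e'"
        using N[of "Suc n"] n unfolding rec_sol_eq by (intro order_trans[OF abs_triangle_ineq] add_mono) auto
      also have "\<dots> = (1 + real d / a) * e'" by (simp add: algebra_simps)
      also have "\<dots> = e / 2"
      proof -
        define c where "c = 1 + real d / a"
        show ?thesis using pos unfolding e'_def c_def[symmetric] by simp
      qed
      finally show "norm (rec_sol (- S) r (Suc n) - 0) < e" using e by simp
    qed
  qed
  then show ?thesis unfolding S_def[symmetric] by (rule LIMSEQ_imp_Suc)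
qed

end

locale toll = dary_trees +
  fixes f :: "nat dary_tree \<Rightarrow> real"
  assumes bounded_toll: "bounded (f ` inc_trees d)"
    and summable_toll: "summable (\<lambda>k. avg (\<lambda>T. \<bar>f T\<bar>) (Suc k) / real (Suc k))"
    and toll_tendsto_0: "(\<lambda>n. avg (\<lambda>T. \<bar>f T\<bar>) n) \<longlonglongrightarrow> 0"
begin

definition B :: real where "B = (SOME B. B \<ge> 0 \<and> (\<forall>T\<in>inc_trees d. \<bar>f T\<bar> \<le> B))"

lemma B_nonneg: "B \<ge> 0" and abs_toll_le: "T \<in> inc_trees d \<Longrightarrow> \<bar>f T\<bar> \<le> B"
proof -
  obtain b where "b > 0" "\<forall>x\<in>f ` inc_trees d. norm x \<le> b"
    using bounded_toll bounded_pos by blast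
  then have "\<exists>B. B \<ge> 0 \<and> (\<forall>T\<in>inc_trees d. \<bar>f T\<bar> \<le> B)" by (intro exI[of _ b]) auto
  from someI_ex[OF this] show "B \<ge> 0" "T \<in> inc_trees d \<Longrightarrow> \<bar>f T\<bar> \<le> B"
    unfolding B_def by blast+
qed

definition tau :: "nat \<Rightarrow> real" where "tau n = avg f n"

definition atau :: "nat \<Rightarrow> real" where "atau n = avg (\<lambda>T. \<bar>f T\<bar>) n"

lemma abs_tau_le: "\<bar>tau n\<bar> \<le> atau n"
  using norm_avg_le[of f n] by (simp add: tau_def atau_def)

lemma atau_nonneg: "atau n \<ge> 0"
  using abs_tau_le[of n] by simp

lemma atau_le_B: "n \<ge> 1 \<Longrightarrow> atau n \<le> B"
  unfolding atau_def using avg_mono[of n "\<lambda>T. \<bar>f T\<bar>" "\<lambda>_. B"] abs_toll_le trees_on_inc_trees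
  by simp

lemma atau_tendsto_0: "atau \<longlonglongrightarrow> 0"
  using toll_tendsto_0 by (simp add: atau_def[abs_def])

lemma tau_tendsto_0: "tau \<longlonglongrightarrow> 0"
  by (rule Lim_null_comparison[OF _ atau_tendsto_0]) (simp add: abs_tau_le)

lemma abs_tau_le_B: "n \<ge> 1 \<Longrightarrow> \<bar>tau n\<bar> \<le> B"
  using abs_tau_le[of n] atau_le_B[of n] by simp

lemma summable_wt_tau: "summable (\<lambda>k. wt (Suc k) * tau (Suc k))"
  by (rule summable_wt_bounded[where C = B]) (simp add: abs_tau_le_B)

text \<open>By the meaning of \<open>wt\<close>, the tolls of all fringe subtrees contribute this
  much per vertex; the factor \<open>a\<close> is the slope of \<open>X\<close>. With this value,
  \<open>- mu / a\<close> is the initial value that \<open>rec_sol_tendsto_0\<close> asks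
  for.\<close>

definition mu :: real where "mu = a * (\<Sum>k. wt (Suc k) * tau (Suc k))"

text \<open>Centring by \<open>\<mu> n + \<mu>/(d - 1)\<close>, with empty slots counted as trees of size \<open>0\<close>, makes the
  additive recursion hold with the same toll function.\<close>

definition Y :: "nat dary_tree \<Rightarrow> real" where
  "Y T = additive_functional f T - mu * real (nverts T) - mu / a"

lemma Y_Empty [simp]: "Y Empty = - mu / a"
  by (simp add: Y_def)

lemma Y_branch:
  assumes "n \<ge> 1" "T \<in> trees_on d {1..n}"
  shows "Y T = (\<Sum>i<d. Y (branch T i)) + f T"
proof -
  note T = trees_onD(1,2)[OF assms]
  have "(\<Sum>i<d. Y (branch T i)) = (\<Sum>i<d. additive_functional f (branch T i))
      - mu * (\<Sum>i<d. real (nverts (branch T i))) - real d * (mu / a)"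
    by (simp add: Y_def sum_subtractf sum_distrib_left)
  \<comment> \<open>This determines the constant in the centring: \<open>d\<close> copies of it must
    exceed one copy by \<open>mu\<close>, so \<open>a\<close> times the constant equals
    \<open>mu\<close>.\<close>
  also have "real d * (mu / a) = mu + mu / a"
    using a_pos unfolding d_eq by (simp add: field_simps)
  finally show ?thesis
    unfolding Y_def additive_functional_branch[OF T] nverts_branch[OF T] by (simp add: algebra_simps)
qed

definition m :: "nat \<Rightarrow> real" where "m n = avg Y n"

lemma m_0: "m 0 = - mu / a"
  by (simp add: m_def)

lemma m_recurrence: "n \<ge> 1 \<Longrightarrow> m n = (\<Sum>k<n. w n k * m k) + tau n"
proof -
  assume n: "n \<ge> 1"
  have "m n = avg (\<lambda>T. (\<Sum>i<d. Y (branch T i)) + f T) n"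
    unfolding m_def by (rule avg_cong) (rule Y_branch[OF n])
  then show ?thesis by (simp add: avg_add avg_sum_branch[OF n] tau_def m_def)
qed

lemma m_tendsto_0: "m \<longlonglongrightarrow> 0"
proof -
  have "m n = rec_sol (- mu / a) tau n" for n
    using rec_sol_unique[of m tau n] m_recurrence by (simp add: m_0)
  moreover have "rec_sol (- mu / a) tau \<longlonglongrightarrow> 0"
    using rec_sol_tendsto_0[OF tau_tendsto_0 summable_wt_tau] a_pos by (simp add: mu_def)
  ultimately show ?thesis by presburger
qed

definition Cm :: real where "Cm = (SOME C. \<forall>n. \<bar>m n\<bar> \<le> C)"

lemma abs_m_le: "\<bar>m n\<bar> \<le> Cm"
proof -
  have "\<exists>C. \<forall>n. \<bar>m n\<bar> \<le> C"
    using convergent_imp_Bseq[OF convergentI[OF m_tendsto_0]] by (auto simp: Bseq_def)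
  from someI_ex[OF this] show ?thesis unfolding Cm_def by blast
qed

text \<open>The contribution of pairs of distinct branches to the second moment.\<close>

definition q :: "nat \<Rightarrow> real" where
  "q n = real d * a * fps_nth (tree_egf d Y ^ 2 * P ^ (d - 2)) (n - 1) / (real n * p n)"

text \<open>Given their sizes two branches are independent, so a pair contributes a product of the
  means \<open>m\<close>, which are bounded. Pairs therefore add only a bounded toll, although the
  available bound on \<open>Y\<close> itself is of order \<open>n\<close>.\<close>

lemma abs_q_le: "n \<ge> 1 \<Longrightarrow> \<bar>q n\<bar> \<le> real d * a * Cm\<^sup>2"
proof -
  assume n: "n \<ge> 1"
  then obtain n' where n': "n = Suc n'" by (cases n) auto
  have "fps_dominated (tree_egf d Y) (fps_const Cm * P)"
    unfolding fps_dominated_def tree_egf_nth_avg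
    using abs_m_le by (auto simp: P_nth abs_mult m_def less_imp_le intro!: mult_right_mono)
  moreover have "fps_dominated P P"
    by (auto simp: fps_dominated_def P_nth less_imp_le)
  ultimately have "fps_dominated (tree_egf d Y ^ 2 * P ^ (d - 2)) ((fps_const Cm * P) ^ 2 * P ^ (d - 2))"
    by (intro fps_dominated_mult fps_dominated_power)
  also have "(fps_const Cm * P) ^ 2 * P ^ (d - 2) = fps_const (Cm\<^sup>2) * P ^ d"
  proof -
    have "P ^ 2 * P ^ (d - 2) = P ^ d"
      using d_ge_2 unfolding power_add[symmetric] by (intro arg_cong[where f = "power P"]) simp
    then show ?thesis by (simp only: power_mult_distrib mult.assoc fps_const_power)
  qed
  finally have "\<bar>fps_nth (tree_egf d Y ^ 2 * P ^ (d - 2)) n'\<bar> \<le> Cm\<^sup>2 * fps_nth (P ^ d) n'"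
    by (auto simp: fps_dominated_def)
  also have "fps_nth (P ^ d) n' = real n * p n"
    unfolding deriv_P[symmetric] by (simp add: P_nth n')
  finally have le: "\<bar>fps_nth (tree_egf d Y ^ 2 * P ^ (d - 2)) n'\<bar> \<le> Cm\<^sup>2 * (real n * p n)" .
  have np: "real n * p n > 0" using n by simp
  have "\<bar>q n\<bar> = real d * a * (\<bar>fps_nth (tree_egf d Y ^ 2 * P ^ (d - 2)) n'\<bar> / (real n * p n))"
    using np a_pos by (simp add: q_def n' abs_mult abs_of_pos[OF p_pos])
  also have "\<dots> \<le> real d * a * (Cm\<^sup>2 * (real n * p n) / (real n * p n))"
    using np a_pos le by (intro mult_left_mono divide_right_mono) auto
  also have "\<dots> = real d * a * Cm\<^sup>2" using n by simp
  finally show ?thesis .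
qed

definition V :: "nat \<Rightarrow> real" where "V n = avg (\<lambda>T. (Y T)\<^sup>2) n"

text \<open>If \<open>S\<close> is the sum of \<open>Y\<close> over the branches, then
  \<open>Y T = S + f T\<close> gives \<open>(Y T)^2 = S^2 + 2 * f T * Y T - (f T)^2\<close>. The
  squares of single branches in \<open>S^2\<close> feed the recurrence; everything else is collected
  here.\<close>

definition toll2 :: "nat \<Rightarrow> real" where
  "toll2 n = q n + avg (\<lambda>T. 2 * f T * Y T - (f T)\<^sup>2) n"

lemma V_0: "V 0 = mu\<^sup>2 / a\<^sup>2"
  by (simp add: V_def power_divide)

lemma V_recurrence: "n \<ge> 1 \<Longrightarrow> V n = (\<Sum>k<n. w n k * V k) + toll2 n"
proof -
  assume n: "n \<ge> 1"
  have "V n = avg (\<lambda>T. (\<Sum>i<d. Y (branch T i))\<^sup>2 + (2 * f T * Y T - (f T)\<^sup>2)) n"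
    unfolding V_def using Y_branch[OF n]
    by (intro avg_cong) (simp add: power2_eq_square algebra_simps)
  then show ?thesis
    by (simp only: avg_add avg_branch_off_diagonal[OF n]) (simp add: toll2_def V_def q_def)
qed

definition K :: real where "K = B + \<bar>mu\<bar>"

lemma K_nonneg: "K \<ge> 0"
  using B_nonneg by (simp add: K_def)

lemma abs_Y_le: "T \<in> trees_on d {1..n} \<Longrightarrow> \<bar>Y T\<bar> \<le> K * X n"
proof -
  assume T: "T \<in> trees_on d {1..n}"
  have mua: "\<bar>mu / a\<bar> \<le> \<bar>mu\<bar>" using a_ge_1 mult_right_mono[of 1 a "\<bar>mu\<bar>"] by (simp add: field_simps)
  show ?thesis
  proof (cases "n = 0")
    case True
    with T show ?thesis using mua B_nonneg by (simp add: K_def)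
  next
    case False
    then have n: "n \<ge> 1" by simp
    have "\<bar>additive_functional f T\<bar> \<le> B * real n"
      using abs_additive_functional_le[OF abs_toll_le trees_on_inc_trees[OF n T]] trees_onD(3)[OF n T]
      by simp
    then have "\<bar>Y T\<bar> \<le> B * real n + \<bar>mu\<bar> * real n + \<bar>mu\<bar>"
    proof -
      have "\<bar>Y T\<bar> \<le> \<bar>additive_functional f T\<bar> + \<bar>mu * real n\<bar> + \<bar>mu / a\<bar>"
        unfolding Y_def trees_onD(3)[OF n T] by linarith
      with mua \<open>\<bar>additive_functional f T\<bar> \<le> _\<close> show ?thesis by (simp only: abs_mult abs_of_nat)
    qed
    also have "\<dots> \<le> K * (real n + 1)" using B_nonneg by (simp add: K_def algebra_simps)
    also have "\<dots> \<le> K * X n" using X_ge K_nonneg by (intro mult_left_mono) auto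
    finally show ?thesis .
  qed
qed

lemma abs_fY_le: "n \<ge> 1 \<Longrightarrow> avg (\<lambda>T. \<bar>f T * Y T\<bar>) n \<le> K * X n * atau n"
proof -
  assume n: "n \<ge> 1"
  have "avg (\<lambda>T. \<bar>f T * Y T\<bar>) n \<le> avg (\<lambda>T. K * X n * \<bar>f T\<bar>) n"
  proof (rule avg_mono)
    fix T assume "T \<in> trees_on d {1..n}"
    from mult_right_mono[OF abs_Y_le[OF this], of "\<bar>f T\<bar>"]
    show "\<bar>f T * Y T\<bar> \<le> K * X n * \<bar>f T\<bar>" by (simp add: abs_mult mult.commute)
  qed
  then show ?thesis by (simp add: avg_cmult atau_def)
qed

lemma avg_f_squared_le: "n \<ge> 1 \<Longrightarrow> avg (\<lambda>T. (f T)\<^sup>2) n \<le> B * atau n"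
proof -
  assume n: "n \<ge> 1"
  have "avg (\<lambda>T. (f T)\<^sup>2) n \<le> avg (\<lambda>T. B * \<bar>f T\<bar>) n"
  proof (rule avg_mono)
    fix T assume "T \<in> trees_on d {1..n}"
    then have "\<bar>f T\<bar> \<le> B" using abs_toll_le trees_on_inc_trees[OF n] by blast
    then have "\<bar>f T\<bar> * \<bar>f T\<bar> \<le> B * \<bar>f T\<bar>" by (intro mult_right_mono) auto
    then show "(f T)\<^sup>2 \<le> B * \<bar>f T\<bar>" by (simp add: power2_eq_square flip: abs_mult)
  qed
  then show ?thesis by (simp add: avg_cmult atau_def)
qed

lemma abs_toll2_le: "n \<ge> 1 \<Longrightarrow> \<bar>toll2 n\<bar> \<le> real d * a * Cm\<^sup>2 + (2 * K + B) * X n * atau n"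
proof -
  assume n: "n \<ge> 1"
  have "\<bar>avg (\<lambda>T. 2 * f T * Y T - (f T)\<^sup>2) n\<bar> \<le> avg (\<lambda>T. 2 * \<bar>f T * Y T\<bar> + (f T)\<^sup>2) n"
  proof (rule order_trans[OF norm_avg_le[of "\<lambda>T. 2 * f T * Y T - (f T)\<^sup>2", unfolded real_norm_def] avg_mono])
    fix T
    show "\<bar>2 * f T * Y T - (f T)\<^sup>2\<bar> \<le> 2 * \<bar>f T * Y T\<bar> + (f T)\<^sup>2"
      using abs_triangle_ineq4[of "2 * f T * Y T" "(f T)\<^sup>2"] by (simp add: abs_mult)
  qed
  also have "\<dots> \<le> 2 * (K * X n * atau n) + B * atau n"
    using abs_fY_le[OF n] avg_f_squared_le[OF n] by (simp add: avg_add avg_cmult)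
  also have "\<dots> \<le> 2 * (K * X n * atau n) + B * X n * atau n"
    using B_nonneg atau_nonneg[of n] X_ge_1[of n] mult_left_mono[of 1 "X n" B]
    by (intro add_left_mono mult_right_mono) auto
  finally show ?thesis using abs_q_le[OF n] by (simp add: toll2_def algebra_simps)
qed

lemma toll2_div_tendsto_0: "(\<lambda>n. toll2 n / X n) \<longlonglongrightarrow> 0"
proof (rule Lim_null_comparison)
  show "\<forall>\<^sub>F n in sequentially. norm (toll2 n / X n) \<le> real d * a * Cm\<^sup>2 / X n + (2 * K + B) * atau n"
    using eventually_ge_at_top[of 1]
  proof eventually_elim
    case (elim n)
    have "\<bar>toll2 n\<bar> / X n \<le> (real d * a * Cm\<^sup>2 + (2 * K + B) * X n * atau n) / X n"
      using abs_toll2_le[OF elim] by (intro divide_right_mono) (auto simp: less_imp_le)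
    then show ?case by (simp add: add_divide_distrib less_imp_le)
  qed
  show "(\<lambda>n. real d * a * Cm\<^sup>2 / X n + (2 * K + B) * atau n) \<longlonglongrightarrow> 0"
    using tendsto_add[OF inverse_X_tendsto_0 tendsto_mult[OF tendsto_const atau_tendsto_0]]
    by simp
qed

lemma wt_X_le: "wt (Suc k) * X (Suc k) \<le> real d / real (Suc k)"
proof -
  have "wt (Suc k) * X (Suc k) = real d / X (Suc (Suc k))" by (simp add: wt_def)
  also have "\<dots> \<le> real d / real (Suc k)"
    using X_ge[of "Suc (Suc k)"] by (intro divide_left_mono) (auto simp del: of_nat_Suc)
  finally show ?thesis .
qed

text \<open>The summability in (C2) enters here: \<open>wt k * X k\<close> is of order
  \<open>1 / k\<close>, the weight in that hypothesis. The factor \<open>X k\<close> stems from the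
  crude bound \<open>abs_Y_le\<close> applied to products of \<open>f\<close> and
  \<open>Y\<close>.\<close>

lemma summable_wt_X_atau: "summable (\<lambda>k. wt (Suc k) * (X (Suc k) * atau (Suc k)))"
proof (rule summable_comparison_test)
  show "summable (\<lambda>k. real d * (atau (Suc k) / real (Suc k)))"
    using summable_toll by (intro summable_mult) (simp add: atau_def)
  show "\<exists>N. \<forall>n\<ge>N. norm (wt (Suc n) * (X (Suc n) * atau (Suc n))) \<le> real d * (atau (Suc n) / real (Suc n))"
  proof (intro exI[of _ 0] allI impI)
    fix n
    have "wt (Suc n) * X (Suc n) * atau (Suc n) \<le> real d / real (Suc n) * atau (Suc n)"
      by (intro mult_right_mono wt_X_le atau_nonneg)
    then show "norm (wt (Suc n) * (X (Suc n) * atau (Suc n))) \<le> real d * (atau (Suc n) / real (Suc n))"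
      using wt_nonneg[of "Suc n"] atau_nonneg[of "Suc n"] by (simp add: abs_mult less_imp_le mult.assoc)
  qed
qed

lemma summable_wt_toll2: "summable (\<lambda>k. wt (Suc k) * toll2 (Suc k))"
proof (rule summable_comparison_test)
  show "summable (\<lambda>k. wt (k + 1) * (real d * a * Cm\<^sup>2) + (2 * K + B) * (wt (Suc k) * (X (Suc k) * atau (Suc k))))"
    by (intro summable_add summable_mult2 summable_mult summable_wt_X_atau sums_summable[OF wt_tail_sums])
  show "\<exists>N. \<forall>n\<ge>N. norm (wt (Suc n) * toll2 (Suc n))
     \<le> wt (n + 1) * (real d * a * Cm\<^sup>2) + (2 * K + B) * (wt (Suc n) * (X (Suc n) * atau (Suc n)))"
  proof (intro exI[of _ 0] allI impI)
    fix n
    have "wt (Suc n) * \<bar>toll2 (Suc n)\<bar> \<le> wt (Suc n) * (real d * a * Cm\<^sup>2 + (2 * K + B) * X (Suc n) * atau (Suc n))"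
      by (intro mult_left_mono wt_nonneg abs_toll2_le) simp
    then show "norm (wt (Suc n) * toll2 (Suc n))
     \<le> wt (n + 1) * (real d * a * Cm\<^sup>2) + (2 * K + B) * (wt (Suc n) * (X (Suc n) * atau (Suc n)))"
      by (simp add: abs_mult wt_nonneg algebra_simps)
  qed
qed

text \<open>In the notation of the theorem, \<open>\<sigma>\<^sup>2 = a sig\<close>.\<close>

definition sig :: real where "sig = mu\<^sup>2 / a\<^sup>2 + (\<Sum>k. wt (Suc k) * toll2 (Suc k))"

lemma V_div_tendsto: "(\<lambda>n. V n / X n) \<longlonglongrightarrow> sig"
proof -
  have "V n = rec_sol (mu\<^sup>2 / a\<^sup>2) toll2 n" for n
    using rec_sol_unique[of V toll2 n] V_recurrence by (simp add: V_0)
  then show ?thesis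
    using rec_sol_div_tendsto[OF summable_wt_toll2 toll2_div_tendsto_0, of "mu\<^sup>2 / a\<^sup>2"]
    by (simp add: sig_def)
qed

lemma V_nonneg: "V n \<ge> 0"
  unfolding V_def using avg_mono[of n "\<lambda>_. 0" "\<lambda>T. (Y T)\<^sup>2"] by simp

lemma sig_nonneg: "sig \<ge> 0"
  by (rule LIMSEQ_le_const[OF V_div_tendsto]) (auto simp: V_nonneg less_imp_le)

end

subsection \<open>Characteristic functions and the central limit theorem\<close>

context toll
begin

definition psi :: "real \<Rightarrow> nat \<Rightarrow> complex" where
  "psi t n = avg (\<lambda>T. iexp (t * Y T)) n"

text \<open>As \<open>X\<close> is additive over the slots, empty ones included, the product of
  these Gaussian factors over the branches is \<open>gam t n\<close> whatever the branch sizes are.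
  The Gaussian family thus obeys the branch recursion with no error at all.\<close>

definition gam :: "real \<Rightarrow> nat \<Rightarrow> real" where
  "gam t n = exp (- (sig * X n * t\<^sup>2 / 2))"

definition Delta :: "real \<Rightarrow> nat \<Rightarrow> real" where
  "Delta t n = norm (psi t n - of_real (gam t n))"

lemma gam_power: "gam t n = exp (- (sig * t\<^sup>2 / 2)) * exp (- (sig * a * t\<^sup>2 / 2)) ^ n"
  by (simp add: gam_def X_def exp_of_nat_mult[symmetric] exp_add[symmetric] algebra_simps add_divide_distrib)

lemma gam_le_1: "gam t n \<le> 1"
  using sig_nonneg by (simp add: gam_def less_imp_le)

lemma norm_psi_le_1: "norm (psi t n) \<le> 1"
  using norm_avg_le[of "\<lambda>T. iexp (t * Y T)" n] by (simp add: psi_def)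

text \<open>A geometric factor passes through convolutions, since it amounts to substituting
  \<open>z * x\<close> for the variable. It is meant for \<open>gam\<close>, which is geometric in
  \<open>n\<close> by \<open>gam_power\<close>.\<close>

lemma scaled_power_nth:
  fixes c z :: real
  assumes "\<And>k. fps_nth G k = of_real (c * z ^ k * p k)"
  shows "fps_nth (G ^ l) n = (of_real (c ^ l * z ^ n * fps_nth (P ^ l) n) :: complex)"
proof (induction l arbitrary: n)
  case 0
  then show ?case by (simp add: fps_one_def)
next
  case (Suc l)
  have "fps_nth (G ^ Suc l) n = (\<Sum>i=0..n. of_real (c * z ^ i * p i) * of_real (c ^ l * z ^ (n - i) * fps_nth (P ^ l) (n - i)))"
    by (simp add: fps_mult_nth Suc assms)
  also have "\<dots> = (\<Sum>i=0..n. of_real (c ^ Suc l * z ^ n * (p i * fps_nth (P ^ l) (n - i))))"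
  proof (intro sum.cong refl)
    fix i assume "i \<in> {0..n}"
    then have "z ^ n = z ^ i * z ^ (n - i)" by (simp flip: power_add)
    then show "(of_real (c * z ^ i * p i) * of_real (c ^ l * z ^ (n - i) * fps_nth (P ^ l) (n - i)) :: complex)
        = of_real (c ^ Suc l * z ^ n * (p i * fps_nth (P ^ l) (n - i)))"
      by (simp add: mult_ac)
  qed
  also have "\<dots> = of_real (c ^ Suc l * z ^ n * fps_nth (P ^ Suc l) n)"
    by (simp only: of_real_sum[symmetric] sum_distrib_left[symmetric] power_Suc fps_mult_nth P_nth)
  finally show ?case .
qed

lemma Delta_recurrence:
  assumes "n \<ge> 1"
  shows "Delta t n \<le> (\<Sum>k<n. w n k * Delta t k) + \<bar>t\<bar> * atau n"
proof -
  obtain n' where n': "n = Suc n'" using assms by (cases n) auto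
  define N where "N = real n * p n"
  have N: "N > 0" using assms by (simp add: N_def)
  define C where "C = tree_egf d (\<lambda>T. iexp (t * Y T))"
  define G :: "complex fps" where "G = Abs_fps (\<lambda>k. of_real (gam t k * p k))"
  define D where "D = Abs_fps (\<lambda>k. Delta t k * p k)"
  have C_nth: "fps_nth C k = psi t k * of_real (p k)" for k
    by (simp only: C_def tree_egf_nth_avg psi_def)
  have domC: "fps_dominated C P"
    unfolding fps_dominated_def C_nth P_nth norm_mult
    using norm_psi_le_1 by (simp add: mult_left_le_one_le abs_of_pos[OF p_pos] less_imp_le)
  have domG: "fps_dominated G P"
    using gam_le_1 by (simp add: fps_dominated_def G_def P_nth norm_mult abs_of_pos[OF p_pos] gam_def
        mult_left_le_one_le less_imp_le)
  have domD: "fps_dominated (C - G) D"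
    by (simp add: fps_dominated_def C_nth G_def D_def Delta_def abs_of_pos[OF p_pos]
        flip: left_diff_distrib add: norm_mult)
  \<comment> \<open>One factor is the difference, the other \<open>d - 1\<close> are dominated by
    \<open>P\<close>; the coefficients of \<open>P ^ (d - 1)\<close> then rebuild the weights
    \<open>w\<close>.\<close>
  have "fps_dominated (C ^ d - G ^ d) (of_nat d * (D * P ^ (d - 1)))"
    using fps_dominated_power_diff[OF domC domG domD, of "d - 1"] d_ge_2 by simp
  then have "norm (fps_nth (C ^ d) n' - fps_nth (G ^ d) n') \<le> fps_nth (of_nat d * (D * P ^ (d - 1))) n'"
    unfolding fps_dominated_def by (metis fps_sub_nth)
  also have "\<dots> = real d * (\<Sum>k\<le>n'. Delta t k * p k * a ^ (n' - k))"
  proof -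
    have "fps_nth (of_nat d * (D * P ^ (d - 1))) n' = real d * fps_nth (D * P ^ (d - 1)) n'"
      by (simp flip: fps_of_nat)
    also have "fps_nth (D * P ^ (d - 1)) n' = (\<Sum>k\<le>n'. Delta t k * p k * a ^ (n' - k))"
      unfolding fps_mult_nth P_power_nth by (simp add: D_def atMost_atLeast0)
    finally show ?thesis .
  qed
  finally have "norm (fps_nth (C ^ d) n' - fps_nth (G ^ d) n') / N
      \<le> real d * (\<Sum>k\<le>n'. Delta t k * p k * a ^ (n' - k)) / N"
    using N by (intro divide_right_mono) auto
  also have "\<dots> = (\<Sum>k<n. w n k * Delta t k)"
    by (simp add: w_def N_def n' sum_distrib_left sum_divide_distrib lessThan_Suc_atMost mult_ac del: of_nat_Suc)
  finally have le1: "norm (fps_nth (C ^ d) n' - fps_nth (G ^ d) n') / N \<le> (\<Sum>k<n. w n k * Delta t k)" .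

  have "fps_nth (G ^ d) n' = of_real (exp (- (sig * t\<^sup>2 / 2)) ^ d * exp (- (sig * a * t\<^sup>2 / 2)) ^ n' * fps_nth (P ^ d) n')"
    by (rule scaled_power_nth) (simp add: G_def gam_power)
  also have "fps_nth (P ^ d) n' = N"
    unfolding deriv_P[symmetric] by (simp add: P_nth N_def n')
  \<comment> \<open>The exponents add up because
    \<open>d + a * n' = a * Suc n' + 1 = X n\<close>.\<close>
  also have "exp (- (sig * t\<^sup>2 / 2)) ^ d * exp (- (sig * a * t\<^sup>2 / 2)) ^ n' = gam t n"
    unfolding exp_of_nat_mult[symmetric] exp_add[symmetric] gam_def
    by (simp add: d_eq n' X_def algebra_simps add_divide_distrib)
  finally have G: "fps_nth (G ^ d) n' = of_real (gam t n * N)" .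

  have "avg (\<lambda>T. \<Prod>i<d. iexp (t * Y (branch T i))) n = fps_nth (C ^ d) n' / of_real N"
    using avg_prod_branch[OF assms, of "\<lambda>_ T. iexp (t * Y T)"] by (simp add: C_def N_def n')
  then have "norm (avg (\<lambda>T. \<Prod>i<d. iexp (t * Y (branch T i))) n - of_real (gam t n))
      = norm (fps_nth (C ^ d) n' / of_real N - fps_nth (G ^ d) n' / of_real N)"
    unfolding G using N by simp
  also have "\<dots> = norm (fps_nth (C ^ d) n' - fps_nth (G ^ d) n') / N"
    using N by (simp add: norm_divide flip: diff_divide_distrib)
  finally have le2: "norm (avg (\<lambda>T. \<Prod>i<d. iexp (t * Y (branch T i))) n - of_real (gam t n))
      \<le> (\<Sum>k<n. w n k * Delta t k)" using le1 by simp

  have "psi t n - avg (\<lambda>T. \<Prod>i<d. iexp (t * Y (branch T i))) n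
      = avg (\<lambda>T. iexp (t * Y T) - (\<Prod>i<d. iexp (t * Y (branch T i)))) n"
    by (simp only: psi_def avg_diff)
  also have "norm \<dots> \<le> avg (\<lambda>T. norm (iexp (t * Y T) - (\<Prod>i<d. iexp (t * Y (branch T i))))) n"
    by (rule norm_avg_le)
  also have "\<dots> \<le> avg (\<lambda>T. \<bar>t\<bar> * \<bar>f T\<bar>) n"
  proof (rule avg_mono)
    fix T assume T: "T \<in> trees_on d {1..n}"
    let ?E = "\<Prod>i<d. iexp (t * Y (branch T i))"
    have E: "?E = iexp (t * (\<Sum>i<d. Y (branch T i)))"
      by (simp add: exp_sum[symmetric] sum_distrib_left)
    have "iexp (t * Y T) = ?E * iexp (t * f T)"
      unfolding E Y_branch[OF assms T] by (simp add: distrib_left exp_add)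
    then have "iexp (t * Y T) - ?E = ?E * (iexp (t * f T) - 1)"
      by (simp add: algebra_simps)
    then have "norm (iexp (t * Y T) - ?E) = norm (iexp (t * f T) - 1)"
      unfolding E by (simp add: norm_mult)
    also have "\<dots> \<le> \<bar>t * f T\<bar>" using iexp_approx1[of "t * f T" 0] by simp
    finally show "norm (iexp (t * Y T) - ?E) \<le> \<bar>t\<bar> * \<bar>f T\<bar>" by (simp add: abs_mult)
  qed
  also have "\<dots> = \<bar>t\<bar> * atau n" by (simp add: avg_cmult atau_def)
  finally have le3: "norm (psi t n - avg (\<lambda>T. \<Prod>i<d. iexp (t * Y (branch T i))) n) \<le> \<bar>t\<bar> * atau n" .
  show ?thesis
    unfolding Delta_def[of t n]
    using norm_triangle_le[OF add_mono[OF le3 le2]] by simp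
qed

lemma exp_minus_taylor: "(u::real) \<ge> 0 \<Longrightarrow> \<bar>exp (- u) - (1 - u)\<bar> \<le> u\<^sup>2 / 2"
proof -
  assume u: "u \<ge> 0"
  have lo: "exp (- u) \<ge> 1 - u" using exp_ge_add_one_self[of "- u"] by simp
  have "1 - u + u\<^sup>2 / 2 - exp (- u) \<ge> 1 - 0 + 0\<^sup>2 / 2 - exp (- 0)"
  proof (rule DERIV_nonneg_imp_nondecreasing[OF u])
    fix x :: real assume "0 \<le> x" "x \<le> u"
    have "((\<lambda>u. 1 - u + u\<^sup>2 / 2 - exp (- u)) has_real_derivative (- 1 + x + exp (- x))) (at x)"
      by (auto intro!: derivative_eq_intros)
    moreover have "- 1 + x + exp (- x) \<ge> 0" using exp_ge_add_one_self[of "- x"] by simp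
    ultimately show "\<exists>y. ((\<lambda>u. 1 - u + u\<^sup>2 / 2 - exp (- u)) has_real_derivative y) (at x) \<and> 0 \<le> y"
      by blast
  qed
  with lo show ?thesis by simp
qed

text \<open>Both functions are expanded to second order. The third absolute moment is reduced to the
  second by the pointwise bound \<open>|Y|^3 \<le> K * X k * Y^2\<close>, so \<open>V\<close>
  controls the cubic error too.\<close>

lemma Delta_taylor:
  "Delta t k \<le> \<bar>t\<bar> * \<bar>m k\<bar> + t\<^sup>2 / 2 * \<bar>V k - sig * X k\<bar> + \<bar>t\<bar> ^ 3 * (K * X k * V k) / 6
     + (sig * X k * t\<^sup>2)\<^sup>2 / 8"
proof -
  let ?T2 = "\<lambda>T. 1 + \<i> * of_real (t * Y T) - of_real (t\<^sup>2 / 2 * (Y T)\<^sup>2) :: complex"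
  have mean: "avg ?T2 k = 1 + \<i> * of_real t * of_real (m k) - of_real (t\<^sup>2 / 2) * of_real (V k)"
  proof -
    have re: "avg (\<lambda>T. of_real (g T)) k = (of_real (avg g k) :: complex)" for g
      by (simp add: avg_def tree_sum_def)
    have "avg ?T2 k = avg (\<lambda>T. 1 + (\<i> * of_real t) * of_real (Y T) - of_real (t\<^sup>2 / 2) * of_real ((Y T)\<^sup>2)) k"
      by (rule avg_cong) (simp add: mult.assoc)
    then show ?thesis by (simp only: avg_diff avg_add avg_cmult re avg_const m_def V_def)
  qed
  have "norm (psi t k - avg ?T2 k) \<le> avg (\<lambda>T. norm (iexp (t * Y T) - ?T2 T)) k"
    unfolding psi_def avg_diff[symmetric] by (rule norm_avg_le)
  also have "\<dots> \<le> avg (\<lambda>T. \<bar>t\<bar> ^ 3 * (K * X k) / 6 * (Y T)\<^sup>2) k"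
  proof (rule avg_mono)
    fix T assume T: "T \<in> trees_on d {1..k}"
    have "(\<Sum>j\<le>2. (\<i> * of_real (t * Y T)) ^ j / fact j) = ?T2 T"
      by (simp add: numeral_2_eq_2 power2_eq_square field_simps)
    then have "norm (iexp (t * Y T) - ?T2 T) \<le> \<bar>t * Y T\<bar> ^ 3 / 6"
      using iexp_approx1[of "t * Y T" 2] by (simp add: fact_numeral)
    also have "\<dots> = \<bar>t\<bar> ^ 3 / 6 * (\<bar>Y T\<bar> * (Y T)\<^sup>2)"
    proof -
      have "\<bar>Y T\<bar> ^ 3 = \<bar>Y T\<bar> * (Y T)\<^sup>2" by (simp add: power3_eq_cube power2_eq_square mult.assoc)
      then show ?thesis by (simp add: abs_mult power_mult_distrib)
    qed
    also have "\<dots> \<le> \<bar>t\<bar> ^ 3 / 6 * (K * X k * (Y T)\<^sup>2)"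
      using abs_Y_le[OF T] by (intro mult_left_mono mult_right_mono) auto
    finally show "norm (iexp (t * Y T) - ?T2 T) \<le> \<bar>t\<bar> ^ 3 * (K * X k) / 6 * (Y T)\<^sup>2" by simp
  qed
  also have "\<dots> = \<bar>t\<bar> ^ 3 * (K * X k * V k) / 6" by (simp only: avg_cmult V_def) simp
  finally have 1: "norm (psi t k - avg ?T2 k) \<le> \<bar>t\<bar> ^ 3 * (K * X k * V k) / 6" .
  define u where "u = sig * X k * t\<^sup>2 / 2"
  have "u \<ge> 0" using sig_nonneg by (simp add: u_def less_imp_le)
  from exp_minus_taylor[OF this] have 2: "\<bar>gam t k - (1 - u)\<bar> \<le> (sig * X k * t\<^sup>2)\<^sup>2 / 8"
    by (simp add: gam_def u_def power_divide)
  have "avg ?T2 k - of_real (1 - u) = \<i> * of_real (t * m k) - of_real (t\<^sup>2 / 2 * (V k - sig * X k))"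
    unfolding mean by (simp add: u_def algebra_simps)
  also have "norm \<dots> \<le> \<bar>t\<bar> * \<bar>m k\<bar> + t\<^sup>2 / 2 * \<bar>V k - sig * X k\<bar>"
    by (rule order_trans[OF norm_triangle_ineq4]) (simp only: norm_mult norm_of_real abs_mult norm_ii, simp)
  finally have 3: "norm (avg ?T2 k - of_real (1 - u)) \<le> \<bar>t\<bar> * \<bar>m k\<bar> + t\<^sup>2 / 2 * \<bar>V k - sig * X k\<bar>" .
  have "psi t k - of_real (gam t k) = (psi t k - avg ?T2 k) + (avg ?T2 k - of_real (1 - u))
      - of_real (gam t k - (1 - u))"
    by simp
  then have "Delta t k \<le> norm (psi t k - avg ?T2 k) + norm (avg ?T2 k - of_real (1 - u)) + \<bar>gam t k - (1 - u)\<bar>"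
    using norm_triangle_ineq4[of "(psi t k - avg ?T2 k) + (avg ?T2 k - of_real (1 - u))" "of_real (gam t k - (1 - u))"]
      norm_triangle_ineq[of "psi t k - avg ?T2 k" "avg ?T2 k - of_real (1 - u)"]
    unfolding Delta_def by (simp only: norm_of_real)
  with 1 2 3 show ?thesis by linarith
qed

lemma V_bound: "\<exists>C\<ge>0. \<forall>k. V k \<le> C * X k"
proof -
  obtain C where C: "\<And>n. \<bar>V n / X n\<bar> \<le> C"
    using convergent_imp_Bseq[OF convergentI[OF V_div_tendsto]] by (auto simp: Bseq_def)
  have "V k \<le> C * X k" for k using C[of k] by (simp add: field_simps abs_le_iff abs_of_pos[OF X_pos])
  moreover have "C \<ge> 0" using C[of 0] by linarith
  ultimately show ?thesis by blast
qed

text \<open>The constant \<open>C\<close> pays for the finitely many sizes at which the limit says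
  nothing, so that one estimate covers every \<open>k\<close>.\<close>

lemma V_close:
  assumes "\<eta> > 0"
  shows "\<exists>C\<ge>0. \<forall>k. \<bar>V k - sig * X k\<bar> \<le> \<eta> * X k + C"
proof -
  from LIMSEQ_D[OF V_div_tendsto assms] obtain N where N: "\<And>n. n \<ge> N \<Longrightarrow> \<bar>V n / X n - sig\<bar> < \<eta>" by auto
  define C where "C = (\<Sum>k<N. \<bar>V k - sig * X k\<bar>)"
  have C: "C \<ge> 0" by (simp add: C_def sum_nonneg)
  have "\<bar>V k - sig * X k\<bar> \<le> \<eta> * X k + C" for k
  proof (cases "k < N")
    case True
    then have "\<bar>V k - sig * X k\<bar> \<le> C" unfolding C_def by (intro member_le_sum) auto
    moreover have "\<eta> * X k \<ge> 0" using assms by (simp add: less_imp_le)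
    ultimately show ?thesis by linarith
  next
    case False
    have "\<bar>V k - sig * X k\<bar> = \<bar>V k / X k - sig\<bar> * X k"
    proof -
      have "V k - sig * X k = (V k / X k - sig) * X k" by (simp add: left_diff_distrib)
      then show ?thesis by (simp add: abs_mult abs_of_pos[OF X_pos])
    qed
    also have "\<dots> \<le> \<eta> * X k" using N[of k] False by (intro mult_right_mono) (auto simp: less_imp_le)
    finally show ?thesis using C by simp
  qed
  with C show ?thesis by blast
qed

text \<open>The part of the Taylor bound proportional to \<open>X k\<close> is taken off as
  \<open>b * X k\<close>, which the recursion preserves by \<open>sum_w_X\<close>. Only the rest
  \<open>e k\<close>, made of \<open>|t| * |m k|\<close> and a constant of order \<open>t^2\<close>,
  goes into \<open>cutoff_bound\<close>.\<close>

lemma Delta_cutoff: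
  assumes C: "\<And>k. V k \<le> C * X k" "C \<ge> 0"
    and C': "\<And>k. \<bar>V k - sig * X k\<bar> \<le> \<eta> * X k + C'" "C' \<ge> 0" "\<eta> \<ge> 0"
    and delta: "\<And>n. n > M \<Longrightarrow> atau n + (\<Sum>k<n. w n k * \<bar>m k\<bar>) \<le> \<delta>" "\<delta> \<ge> 0"
    and n: "n > M"
  shows "Delta t n \<le> (t\<^sup>2 / 2 * \<eta> + \<bar>t\<bar> ^ 3 * (K * C * X M) / 6 + sig\<^sup>2 * t ^ 4 * X M / 8) * X n
      + (\<bar>t\<bar> * \<delta> + real d * (t\<^sup>2 / 2 * C')) * (1 + real d / a * (X n / X (Suc M)))"
proof -
  define b where "b = t\<^sup>2 / 2 * \<eta> + \<bar>t\<bar> ^ 3 * (K * C * X M) / 6 + sig\<^sup>2 * t ^ 4 * X M / 8"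
  define e where "e k = \<bar>t\<bar> * \<bar>m k\<bar> + t\<^sup>2 / 2 * C'" for k
  have "Delta t n - b * X n \<le> (\<bar>t\<bar> * \<delta> + real d * (t\<^sup>2 / 2 * C')) * (1 + real d / a * (X n / X (Suc M)))"
  proof (rule cutoff_bound[where u = "\<lambda>n. Delta t n - b * X n" and r = "\<lambda>n. \<bar>t\<bar> * atau n" and e = e])
    fix n :: nat assume n: "n \<ge> 1"
    have "(\<Sum>k<n. w n k * (Delta t k - b * X k)) = (\<Sum>k<n. w n k * Delta t k) - b * (\<Sum>k<n. w n k * X k)"
      by (simp add: right_diff_distrib sum_subtractf sum_distrib_left mult_ac)
    then show "Delta t n - b * X n \<le> (\<Sum>k<n. w n k * (Delta t k - b * X k)) + \<bar>t\<bar> * atau n"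
      using Delta_recurrence[OF n, of t] by (simp add: sum_w_X[OF n])
  next
    fix k assume k: "k \<le> M"
    have XkM: "X k \<le> X M" using k a_pos by (simp add: X_def)
    have Xk: "X k \<ge> 0" by (simp add: less_imp_le)
    have "Delta t k \<le> \<bar>t\<bar> * \<bar>m k\<bar> + t\<^sup>2 / 2 * \<bar>V k - sig * X k\<bar> + \<bar>t\<bar> ^ 3 * (K * X k * V k) / 6
        + (sig * X k * t\<^sup>2)\<^sup>2 / 8" by (rule Delta_taylor)
    also have "\<dots> \<le> \<bar>t\<bar> * \<bar>m k\<bar> + t\<^sup>2 / 2 * (\<eta> * X k + C') + \<bar>t\<bar> ^ 3 * (K * X M * (C * X k)) / 6
        + (sig\<^sup>2 * t ^ 4 * (X M * X k)) / 8"
    proof (intro add_mono order_refl divide_right_mono mult_left_mono C'(1))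
      show "K * X k * V k \<le> K * X M * (C * X k)"
        using XkM Xk K_nonneg C V_nonneg by (intro mult_mono) auto
      have "(sig * X k * t\<^sup>2)\<^sup>2 = sig\<^sup>2 * t ^ 4 * (X k * X k)"
        by (simp add: power2_eq_square power4_eq_xxxx mult_ac)
      also have "\<dots> \<le> sig\<^sup>2 * t ^ 4 * (X M * X k)"
        using XkM Xk by (intro mult_left_mono mult_right_mono) auto
      finally show "(sig * X k * t\<^sup>2)\<^sup>2 \<le> sig\<^sup>2 * t ^ 4 * (X M * X k)" .
    qed auto
    also have "\<dots> = e k + b * X k"
      by (simp add: e_def b_def algebra_simps)
    finally show "Delta t k - b * X k \<le> e k" by simp
  next
    show "e k \<ge> 0" for k using C'(2) by (simp add: e_def)
    show "0 \<le> \<bar>t\<bar> * \<delta> + real d * (t\<^sup>2 / 2 * C')" using C'(2) delta(2) by simp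
    show "M < n" by fact
    fix n assume n: "n > M"
    then have n1: "n \<ge> 1" by simp
    have "(\<Sum>k<n. w n k * e k) = \<bar>t\<bar> * (\<Sum>k<n. w n k * \<bar>m k\<bar>) + (\<Sum>k<n. w n k) * (t\<^sup>2 / 2 * C')"
      unfolding e_def by (simp add: distrib_left sum.distrib sum_distrib_left sum_distrib_right mult_ac)
    then have "\<bar>t\<bar> * atau n + (\<Sum>k<n. w n k * e k)
        = \<bar>t\<bar> * (atau n + (\<Sum>k<n. w n k * \<bar>m k\<bar>)) + real d * (t\<^sup>2 / 2 * C')"
      by (simp add: sum_w[OF n1] distrib_left)
    also have "\<dots> \<le> \<bar>t\<bar> * \<delta> + real d * (t\<^sup>2 / 2 * C')"
      using delta(1)[OF n] by (intro add_right_mono mult_left_mono) auto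
    finally show "\<bar>t\<bar> * atau n + (\<Sum>k<n. w n k * e k) \<le> \<bar>t\<bar> * \<delta> + real d * (t\<^sup>2 / 2 * C')" .
  qed
  then show ?thesis by (simp add: b_def)
qed

text \<open>The cutoff size is \<open>\<epsilon> \<surd>n\<close>: the cubic Taylor error of the small subtrees and the total
  toll of the \<open>O(\<surd>n / \<epsilon>)\<close> large ones are then both of order \<open>\<epsilon>\<close>.\<close>

lemma Delta_eventually_le:
  fixes s C \<epsilon> :: real
  assumes C: "\<And>k. V k \<le> C * X k" "C \<ge> 0" and eps: "0 < \<epsilon>" "\<epsilon> < 1"
  defines "L \<equiv> s\<^sup>2 * a + \<bar>s\<bar> ^ 3 * K * C * a\<^sup>2 / 3 + 2 * (real d / a) * \<bar>s\<bar>"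
  shows "\<forall>\<^sub>F n in sequentially. Delta (s / sqrt (real n)) n < L * \<epsilon> + \<epsilon>"
proof -
  obtain C' where C': "C' \<ge> 0" "\<And>k. \<bar>V k - sig * X k\<bar> \<le> \<epsilon> * X k + C'" using V_close[OF eps(1)] by blast
  \<comment> \<open>With \<open>y = 1 / sqrt n\<close> and \<open>t = s * y\<close>, this is the
    bound of \<open>Delta_cutoff\<close> after inserting \<open>X n \<le> 2 * a / y^2\<close> and a
    cutoff size of about \<open>\<epsilon> / y\<close>. All negative powers of \<open>y\<close>
    cancel, which makes it continuous at 0.\<close>
  define h where "h y = s\<^sup>2 * \<epsilon> * a + \<bar>s\<bar> ^ 3 * K * C * a * (a * \<epsilon> + y) / 3
      + sig\<^sup>2 * s ^ 4 * a * (a * \<epsilon> * y + y\<^sup>2) / 4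
      + (\<bar>s\<bar> * y * \<epsilon>\<^sup>2 + 2 * (real d / a) * \<bar>s\<bar> * \<epsilon>
      + real d * s\<^sup>2 * C' * y\<^sup>2 / 2 + (real d * s\<^sup>2 * C') * (real d / (a * \<epsilon>)) * y)" for y
  have y0: "(\<lambda>n. 1 / sqrt (real n)) \<longlonglongrightarrow> 0"
    by (intro tendsto_divide_0[OF tendsto_const] filterlim_at_top_imp_at_infinity
        filterlim_compose[OF sqrt_at_top] filterlim_real_sequentially)
  have "isCont h 0" unfolding h_def by (intro continuous_intros) auto
  then have "(\<lambda>n. h (1 / sqrt (real n))) \<longlonglongrightarrow> h 0"
    using y0 by (rule isCont_tendsto_compose)
  moreover have "h 0 = L * \<epsilon>"
    by (simp add: h_def L_def power2_eq_square algebra_simps)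
  ultimately have lim: "\<forall>\<^sub>F n in sequentially. h (1 / sqrt (real n)) < L * \<epsilon> + \<epsilon>"
    using eps(1) by (intro order_tendstoD(2)) auto
  define M where "M n = nat \<lfloor>\<epsilon> * sqrt (real n)\<rfloor>" for n
  have "(\<lambda>n. atau n + (\<Sum>k<n. w n k * \<bar>m k\<bar>)) \<longlonglongrightarrow> 0"
    using tendsto_add[OF atau_tendsto_0 sum_w_tendsto_0[OF tendsto_rabs_zero[OF m_tendsto_0]]] by simp
  \<comment> \<open>The square is needed because about \<open>sqrt n / \<epsilon>\<close> large
    subtrees each cost \<open>|t|\<close> times this quantity; a multiple of
    \<open>\<epsilon>\<close> remains.\<close>
  from order_tendstoD(2)[OF this, of "\<epsilon>\<^sup>2"] eps obtain N
    where N: "\<And>n. n \<ge> N \<Longrightarrow> atau n + (\<Sum>k<n. w n k * \<bar>m k\<bar>) < \<epsilon>\<^sup>2"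
    by (auto simp: eventually_sequentially)
  have "filterlim (\<lambda>n. \<epsilon> * sqrt (real n)) at_top sequentially"
    using eps by (intro filterlim_tendsto_pos_mult_at_top[OF tendsto_const]
        filterlim_compose[OF sqrt_at_top] filterlim_real_sequentially) auto
  then have "\<forall>\<^sub>F n in sequentially. \<epsilon> * sqrt (real n) \<ge> real N"
    by (simp add: filterlim_at_top)
  then show ?thesis using lim eventually_ge_at_top[of 1]
  proof eventually_elim
    case (elim n)
    define y where "y = 1 / sqrt (real n)"
    have y: "y > 0" "real n = 1 / y\<^sup>2" "sqrt (real n) = 1 / y"
      using elim by (auto simp: y_def power_divide)
    have M_le: "real (M n) \<le> \<epsilon> / y" and M_ge: "real (Suc (M n)) \<ge> \<epsilon> / y"
      using eps elim unfolding M_def y(3) by (auto simp: y) linarith+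
    have "N \<le> M n" using elim unfolding M_def by (simp add: le_nat_floor)
    have y1: "y \<le> 1" using elim by (simp add: y_def)
    have "\<epsilon> / y < 1 / y" using eps y by (simp add: divide_strict_right_mono)
    also have "\<dots> \<le> 1 / y\<^sup>2" using y y1 by (simp add: field_simps power2_eq_square)
    finally have Mn: "M n < n" using M_le y(2) by linarith
    have Xn: "X n \<le> 2 * a / y\<^sup>2"
    proof -
      have "1 \<le> a * real n" using a_ge_1 elim mult_mono[of 1 a 1 "real n"] by simp
      then have "X n \<le> 2 * (a * real n)" unfolding X_def by linarith
      then show ?thesis unfolding y(2) by simp
    qed
    have XM: "X (M n) \<le> a * \<epsilon> / y + 1"
      using mult_left_mono[OF M_le, of a] a_pos by (simp add: X_def)
    have XM': "X (Suc (M n)) \<ge> a * \<epsilon> / y"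
      using mult_left_mono[OF M_ge, of a] a_pos by (simp add: X_def)
    have "X n / X (Suc (M n)) \<le> (2 * a / y\<^sup>2) / (a * \<epsilon> / y)"
      using Xn XM' a_pos y eps by (intro frac_le) auto
    also have "\<dots> = 2 / (\<epsilon> * y)" using a_pos y eps by (simp add: field_simps power2_eq_square)
    finally have ratio: "X n / X (Suc (M n)) \<le> 2 / (\<epsilon> * y)" .
    let ?t = "s * y"
    have "Delta ?t n \<le> (?t\<^sup>2 / 2 * \<epsilon> + \<bar>?t\<bar> ^ 3 * (K * C * X (M n)) / 6 + sig\<^sup>2 * ?t ^ 4 * X (M n) / 8) * X n
      + (\<bar>?t\<bar> * \<epsilon>\<^sup>2 + real d * (?t\<^sup>2 / 2 * C')) * (1 + real d / a * (X n / X (Suc (M n))))"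
    proof (rule Delta_cutoff[OF C C'(2) C'(1) _ _ _ Mn])
      show "atau k + (\<Sum>j<k. w k j * \<bar>m j\<bar>) \<le> \<epsilon>\<^sup>2" if "k > M n" for k
        using N[of k] that \<open>N \<le> M n\<close> by simp
    qed (use eps in auto)
    also have "\<dots> \<le> (?t\<^sup>2 / 2 * \<epsilon> + \<bar>?t\<bar> ^ 3 * (K * C * (a * \<epsilon> / y + 1)) / 6
        + sig\<^sup>2 * ?t ^ 4 * (a * \<epsilon> / y + 1) / 8) * (2 * a / y\<^sup>2)
      + (\<bar>?t\<bar> * \<epsilon>\<^sup>2 + real d * (?t\<^sup>2 / 2 * C')) * (1 + real d / a * (2 / (\<epsilon> * y)))"
      using eps C(2) K_nonneg a_pos y XM Xn ratio C'(1)
      by (intro add_mono mult_mono divide_right_mono mult_left_mono order_refl add_nonneg_nonneg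
          mult_nonneg_nonneg divide_nonneg_nonneg) (auto simp: less_imp_le)
    also have "\<dots> = h y"
    proof -
      have t3: "\<bar>?t\<bar> ^ 3 = \<bar>s\<bar> ^ 3 * y ^ 3" and t1: "\<bar>?t\<bar> = \<bar>s\<bar> * y"
        using y by (auto simp: abs_mult power_mult_distrib)
      have e1: "?t\<^sup>2 / 2 * \<epsilon> * (2 * a / y\<^sup>2) = s\<^sup>2 * \<epsilon> * a"
        using y by (simp add: power_mult_distrib field_simps)
      have e2: "\<bar>?t\<bar> ^ 3 * (K * C * (a * \<epsilon> / y + 1)) / 6 * (2 * a / y\<^sup>2)
          = \<bar>s\<bar> ^ 3 * K * C * a * (a * \<epsilon> + y) / 3"
        unfolding t3 using y(1) by (simp add: field_simps power2_eq_square power3_eq_cube)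
      have e3: "sig\<^sup>2 * ?t ^ 4 * (a * \<epsilon> / y + 1) / 8 * (2 * a / y\<^sup>2)
          = sig\<^sup>2 * s ^ 4 * a * (a * \<epsilon> * y + y\<^sup>2) / 4"
        using y(1) by (simp add: power_mult_distrib field_simps power2_eq_square power4_eq_xxxx)
      have e4: "(\<bar>?t\<bar> * \<epsilon>\<^sup>2 + real d * (?t\<^sup>2 / 2 * C')) * (1 + real d / a * (2 / (\<epsilon> * y)))
         = \<bar>s\<bar> * y * \<epsilon>\<^sup>2 + 2 * (real d / a) * \<bar>s\<bar> * \<epsilon>
      + real d * s\<^sup>2 * C' * y\<^sup>2 / 2 + (real d * s\<^sup>2 * C') * (real d / (a * \<epsilon>)) * y"
        unfolding t1 using y(1) eps a_pos by (simp add: power_mult_distrib field_simps power2_eq_square)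
      show ?thesis unfolding h_def e4 by (simp only: distrib_right e1 e2 e3)
    qed
    also have "h y < L * \<epsilon> + \<epsilon>" using elim by (simp add: y_def)
    finally show ?case by (simp add: y_def)
  qed
qed

lemma Delta_tendsto_0: "(\<lambda>n. Delta (s / sqrt (real n)) n) \<longlonglongrightarrow> 0"
proof -
  obtain C where C: "C \<ge> 0" "\<And>k. V k \<le> C * X k" using V_bound by blast
  define L where "L = s\<^sup>2 * a + \<bar>s\<bar> ^ 3 * K * C * a\<^sup>2 / 3 + 2 * (real d / a) * \<bar>s\<bar>"
  have L: "L \<ge> 0" using a_pos K_nonneg C(1) unfolding L_def
    by (intro add_nonneg_nonneg mult_nonneg_nonneg divide_nonneg_nonneg) auto
  show ?thesis
  proof (rule order_tendstoI)
    fix e :: real assume "e < 0"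
    then show "\<forall>\<^sub>F n in sequentially. e < Delta (s / sqrt (real n)) n"
      by (intro always_eventually allI) (auto simp: Delta_def intro: less_le_trans)
  next
    fix e :: real assume e: "e > 0"
    define \<epsilon> where "\<epsilon> = min (1 / 2) (e / (L + 1))"
    have eps: "0 < \<epsilon>" "\<epsilon> < 1" using e L by (auto simp: \<epsilon>_def)
    have "L * \<epsilon> + \<epsilon> \<le> e"
    proof -
      have "(L + 1) * \<epsilon> \<le> (L + 1) * (e / (L + 1))" using L by (intro mult_left_mono) (auto simp: \<epsilon>_def)
      also have "\<dots> = e" using L by simp
      finally show ?thesis by (simp add: algebra_simps)
    qed
    then show "\<forall>\<^sub>F n in sequentially. Delta (s / sqrt (real n)) n < e"
      using Delta_eventually_le[OF C(2) C(1) eps, of s]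
      unfolding L_def[symmetric] by (elim eventually_mono) simp
  qed
qed

lemma psi_tendsto: "(\<lambda>n. psi (s / sqrt (real n)) n) \<longlonglongrightarrow> of_real (exp (- (sig * a * s\<^sup>2 / 2)))"
proof -
  have "(\<lambda>n. exp (- (sig * (a + 1 / real n) * s\<^sup>2 / 2))) \<longlonglongrightarrow> exp (- (sig * (a + 0) * s\<^sup>2 / 2))"
    by (intro tendsto_intros lim_const_over_n[of 1, simplified]) auto
  moreover have "\<forall>\<^sub>F n in sequentially.
      exp (- (sig * (a + 1 / real n) * s\<^sup>2 / 2)) = gam (s / sqrt (real n)) n"
    using eventually_ge_at_top[of 1]
  proof eventually_elim
    case (elim n)
    have "X n * (s / sqrt (real n))\<^sup>2 = (a + 1 / real n) * s\<^sup>2"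
      using elim by (simp add: X_def power_divide field_simps)
    then show ?case unfolding gam_def by (simp add: mult.assoc)
  qed
  ultimately have "(\<lambda>n. gam (s / sqrt (real n)) n) \<longlonglongrightarrow> exp (- (sig * a * s\<^sup>2 / 2))"
    by (simp add: tendsto_cong)
  then have "(\<lambda>n. of_real (gam (s / sqrt (real n)) n) :: complex) \<longlonglongrightarrow> of_real (exp (- (sig * a * s\<^sup>2 / 2)))"
    by (rule tendsto_of_real)
  moreover have "(\<lambda>n. psi (s / sqrt (real n)) n - of_real (gam (s / sqrt (real n)) n)) \<longlonglongrightarrow> 0"
    using Delta_tendsto_0[of s] unfolding Delta_def by (rule tendsto_norm_zero_cancel)
  ultimately have "(\<lambda>n. (psi (s / sqrt (real n)) n - of_real (gam (s / sqrt (real n)) n))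
      + of_real (gam (s / sqrt (real n)) n)) \<longlonglongrightarrow> 0 + of_real (exp (- (sig * a * s\<^sup>2 / 2)))"
    by (intro tendsto_add)
  then show ?thesis by simp
qed

lemma clt:
  assumes "\<sigma> \<noteq> 0" "\<sigma>\<^sup>2 = a * sig"
  shows "weak_conv_m
          (\<lambda>n. distr (measure_pmf (random_inc_tree d n)) borel
                 (\<lambda>T. (additive_functional f T - mu * real n) / sqrt (\<sigma>\<^sup>2 * real n)))
          std_normal_distribution"
proof (rule levy_continuity)
  let ?Z = "\<lambda>n T. (additive_functional f T - mu * real n) / sqrt (\<sigma>\<^sup>2 * real n)"
  show "real_distribution (distr (measure_pmf (random_inc_tree d n)) borel (?Z n))" for n
    unfolding real_distribution_def real_distribution_axioms_def
    by (auto intro!: measure_pmf.prob_space_distr)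
  show "real_distribution std_normal_distribution" by (rule real_dist_normal_dist)
  fix t :: real
  \<comment> \<open>The normalisation \<open>sqrt (\<sigma>^2 * n)\<close> is
    \<open>|\<sigma>| * sqrt n\<close>. The exponential prefactor that follows accounts for the
    shift by \<open>mu / a\<close> between \<open>Y\<close> and the functional centred at
    \<open>mu * n\<close>; it tends to 1.\<close>
  define s where "s = t / \<bar>\<sigma>\<bar>"
  have "(\<lambda>n. iexp (s * (mu / a) * (1 / sqrt (real n))) * psi (s / sqrt (real n)) n)
      \<longlonglongrightarrow> iexp (s * (mu / a) * 0) * of_real (exp (- (sig * a * s\<^sup>2 / 2)))"
  proof (intro tendsto_mult psi_tendsto tendsto_exp tendsto_of_real tendsto_const)
    show "(\<lambda>n. 1 / sqrt (real n)) \<longlonglongrightarrow> 0"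
      by (intro tendsto_divide_0[OF tendsto_const] filterlim_at_top_imp_at_infinity
        filterlim_compose[OF sqrt_at_top] filterlim_real_sequentially)
  qed
  also have "iexp (s * (mu / a) * 0) * of_real (exp (- (sig * a * s\<^sup>2 / 2))) = char std_normal_distribution t"
  proof -
    have "sig * a * s\<^sup>2 = t\<^sup>2"
      using assms unfolding s_def by (simp add: power_divide mult.commute[of sig] flip: assms(2))
    then show ?thesis by (simp add: char_std_normal_distribution)
  qed
  finally have lim: "(\<lambda>n. iexp (s * (mu / a) * (1 / sqrt (real n))) * psi (s / sqrt (real n)) n)
      \<longlonglongrightarrow> char std_normal_distribution t" .
  have "\<forall>\<^sub>F n in sequentially. iexp (s * (mu / a) * (1 / sqrt (real n))) * psi (s / sqrt (real n)) n
      = char (distr (measure_pmf (random_inc_tree d n)) borel (?Z n)) t"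
    using eventually_ge_at_top[of 1]
  proof eventually_elim
    case (elim n)
    have "char (distr (measure_pmf (random_inc_tree d n)) borel (?Z n)) t
        = measure_pmf.expectation (random_inc_tree d n) (\<lambda>T. iexp (t * ?Z n T))"
      unfolding char_def by (subst integral_distr) auto
    also have "\<dots> = avg (\<lambda>T. iexp (t * ?Z n T)) n"
      by (rule expectation_random_inc_tree_complex[OF elim])
    also have "\<dots> = avg (\<lambda>T. iexp (s * (mu / a) * (1 / sqrt (real n))) * iexp (s / sqrt (real n) * Y T)) n"
    proof (rule avg_cong)
      fix T assume "T \<in> trees_on d {1..n}"
      then have "additive_functional f T - mu * real n = Y T + mu / a"
        using trees_onD(3)[OF elim] by (simp add: Y_def)
      then have "t * ?Z n T = s * (mu / a) * (1 / sqrt (real n)) + s / sqrt (real n) * Y T"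
        by (simp add: s_def real_sqrt_mult add_divide_distrib algebra_simps)
      then show "iexp (t * ?Z n T) = iexp (s * (mu / a) * (1 / sqrt (real n))) * iexp (s / sqrt (real n) * Y T)"
        by (simp only: of_real_add distrib_left exp_add)
    qed
    also have "\<dots> = iexp (s * (mu / a) * (1 / sqrt (real n))) * psi (s / sqrt (real n)) n"
      by (simp only: avg_cmult psi_def)
    finally show ?case by simp
  qed
  with lim show "(\<lambda>n. char (distr (measure_pmf (random_inc_tree d n)) borel (?Z n)) t)
      \<longlonglongrightarrow> char std_normal_distribution t"
    by (rule Lim_transform_eventually)
qed

end

subsection \<open>The integral representation\<close>

text \<open>Aimed at products of values of \<open>phi\<close>, where the factor
  \<open>inverse (1 - x)\<close> leaves continuity only on the open interval; boundedness takes care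
  of the endpoints.\<close>

lemma integrable_continuous_bounded:
  fixes g :: "real \<Rightarrow> real"
  assumes "continuous_on {0<..<1} g" "\<And>x. x \<in> {0<..<1} \<Longrightarrow> \<bar>g x\<bar> \<le> C"
  shows "g integrable_on {0..1}"
  unfolding integrable_on_Icc_iff_Ioo
proof (rule measurable_bounded_by_integrable_imp_integrable)
  show "g \<in> borel_measurable (lebesgue_on {0<..<1})"
    by (intro continuous_imp_measurable_on_sets_lebesgue assms) auto
  show "(\<lambda>_. C) integrable_on {0<..<(1::real)}"
    unfolding integrable_on_Icc_iff_Ioo[symmetric] by (intro integrable_continuous_interval) auto
qed (use assms in auto)

section \<open>Generating functions on the unit interval and Beta integrals\<close>

context dary_trees
begin

definition beta :: real where "beta = real d / a"

text \<open>The series of \<open>bc (Suc k) * x ^ k\<close> is the derivative of \<open>P\<close> at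
  \<open>x / a\<close>, divided by \<open>a\<close>. By \<open>deriv_P\<close> it sums to
  \<open>(1 - x) powr (- beta) / a\<close>, which the factor \<open>(1 - w) powr beta\<close> in
  \<open>phi\<close> compensates.\<close>

definition bc :: "nat \<Rightarrow> real" where "bc k = real k * p k / a ^ k"

definition J :: "nat \<Rightarrow> real \<Rightarrow> real" where
  "J k x = integral {x..1} (\<lambda>w. (1 - w) powr beta * w ^ (k - 1))"

lemma beta_pos: "beta > 0" and beta_eq: "beta = 1 + 1 / a"
  using a_pos d_ge_2 by (auto simp: beta_def d_eq field_simps)

lemma bc_nonneg: "bc k \<ge> 0"
  using a_pos by (simp add: bc_def less_imp_le)

lemma phi_eq: "phi d k x = inverse (1 - x) * J k x"
  by (simp add: phi_def J_def beta_def a_def)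

lemma bc_Suc_power: "bc (Suc k) * x ^ k = real (Suc k) * p (Suc k) * (x / a) ^ k / a"
  by (simp add: bc_def power_divide)

lemma conv_radius_bounded:
  assumes "\<And>k. \<bar>c k\<bar> \<le> C * p k"
  shows "fps_conv_radius (Abs_fps c) \<ge> ereal (1 / a)"
  unfolding fps_conv_radius_def
proof (rule conv_radius_geI_ex')
  fix r :: real assume r: "0 < r" "ereal r < ereal (1 / a)"
  then have ar: "a * r < 1" using a_pos by (simp add: field_simps)
  show "summable (\<lambda>n. fps_nth (Abs_fps c) n * of_real r ^ n)"
  proof (rule summable_comparison_test)
    show "summable (\<lambda>n. C * (a * r) ^ n)"
      using ar r a_pos by (intro summable_mult summable_geometric) auto
    have C: "C \<ge> 0" using assms[of 0] by simp
    have "\<bar>c n\<bar> * r ^ n \<le> C * (a * r) ^ n" for n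
    proof -
      have "\<bar>c n\<bar> \<le> C * a ^ n"
        using assms[of n] mult_left_mono[OF p_le[of n] C] by linarith
      then have "\<bar>c n\<bar> * r ^ n \<le> C * a ^ n * r ^ n" using r by (intro mult_right_mono) auto
      then show ?thesis by (simp add: power_mult_distrib)
    qed
    then show "\<exists>N. \<forall>n\<ge>N. norm (fps_nth (Abs_fps c) n * of_real r ^ n) \<le> C * (a * r) ^ n"
      using r by (auto simp: abs_mult)
  qed
qed

lemma conv_radius_P: "fps_conv_radius P \<ge> ereal (1 / a)"
proof -
  have "P = Abs_fps p" by (simp add: fps_eq_iff P_nth)
  then show ?thesis using conv_radius_bounded[of p 1] by (simp add: abs_of_pos[OF p_pos])
qed

lemma in_conv_radius:
  assumes "0 \<le> x" "x < 1" "fps_conv_radius A \<ge> ereal (1 / a)"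
  shows "ereal (norm (x / a)) < fps_conv_radius A"
proof -
  have "ereal (norm (x / a)) < ereal (1 / a)" using assms a_pos by (simp add: divide_strict_right_mono)
  then show ?thesis using assms(3) by (rule less_le_trans)
qed

text \<open>\<open>P_power_mult\<close> determines only the power \<open>d - 1\<close> of the value;
  the nonnegative coefficients single out the positive root.\<close>

lemma eval_P:
  assumes "0 \<le> x" "x < 1"
  shows "eval_fps P (x / a) = (1 - x) powr (- 1 / a)"
proof -
  note r = in_conv_radius[OF assms conv_radius_P]
  have rad: "ereal (norm (x / a)) < fps_conv_radius (1 - fps_const a * fps_X)"
  proof -
    have "fps_conv_radius (1 - fps_const a * fps_X) \<ge> min \<infinity> \<infinity>"
      using a_pos by (intro order_trans[OF _ fps_conv_radius_diff])
        (auto simp: fps_conv_radius_cmult_left)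
    then show ?thesis by (simp add: less_le_trans)
  qed
  have "eval_fps (P ^ (d - 1) * (1 - fps_const a * fps_X)) (x / a) = 1"
    unfolding P_power_mult by simp
  moreover have "eval_fps (1 - fps_const a * fps_X) (x / a) = 1 - x"
    using a_pos by (subst eval_fps_diff) (auto simp: fps_conv_radius_cmult_left eval_fps_mult)
  ultimately have eq: "eval_fps P (x / a) ^ (d - 1) * (1 - x) = 1"
    using rad r less_le_trans[OF r fps_conv_radius_power]
    by (subst (asm) eval_fps_mult) (auto simp: eval_fps_power)
  have "eval_fps P (x / a) \<ge> 0"
    unfolding eval_fps_def using summable_fps[OF r] assms a_pos
    by (intro suminf_nonneg) (auto simp: P_nth less_imp_le)
  moreover have "eval_fps P (x / a) \<noteq> 0"
    using eq d_ge_2 by (cases "eval_fps P (x / a) = 0") (auto simp: power_0_left)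
  ultimately have pos: "eval_fps P (x / a) > 0" by simp
  have "eval_fps P (x / a) = (eval_fps P (x / a) ^ (d - 1)) powr (1 / a)"
    using pos a_pos d_ge_2 a_nat by (simp add: powr_realpow[symmetric] powr_powr)
  also have "eval_fps P (x / a) ^ (d - 1) = (1 - x) powr (- 1)"
    using eq assms by (simp add: powr_minus field_simps)
  finally show ?thesis by (simp only: powr_powr) simp
qed

lemma sums_bc:
  assumes "0 \<le> x" "x < 1"
  shows "(\<lambda>k. bc (Suc k) * x ^ k) sums ((1 - x) powr (- beta) / a)"
proof -
  note r = in_conv_radius[OF assms conv_radius_P]
  have "(\<lambda>k. fps_nth (fps_deriv P) k * (x / a) ^ k) sums eval_fps (fps_deriv P) (x / a)"
    by (intro sums_eval_fps less_le_trans[OF r fps_conv_radius_deriv])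
  also have "eval_fps (fps_deriv P) (x / a) = ((1 - x) powr (- 1 / a)) ^ d"
    unfolding deriv_P by (simp add: eval_fps_power[OF r] eval_P[OF assms])
  also have "\<dots> = (1 - x) powr (- beta)"
    using assms by (simp add: powr_realpow[symmetric] powr_powr beta_def)
  finally have "(\<lambda>k. fps_nth (fps_deriv P) k * (x / a) ^ k / a) sums ((1 - x) powr (- beta) / a)"
    by (rule sums_divide)
  then show ?thesis unfolding bc_Suc_power by (simp add: P_nth)
qed

lemma powr_cancel: "0 \<le> x \<Longrightarrow> x < 1 \<Longrightarrow> (1 - x) powr beta * ((1 - x) powr (- beta) / a) = 1 / a"
  by (simp add: powr_minus field_simps)

lemma sum_bc_le:
  assumes "0 \<le> x" "x \<le> 1"
  shows "(1 - x) powr beta * (\<Sum>k<n. bc (Suc k) * x ^ k) \<le> 1 / a"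
proof (cases "x = 1")
  case False
  then have x: "0 \<le> x" "x < 1" using assms by auto
  have "(\<Sum>k<n. bc (Suc k) * x ^ k) \<le> (1 - x) powr (- beta) / a"
    using sums_bc[OF x] x bc_nonneg by (intro sum_le_suminf[THEN order_trans])
      (auto simp: sums_iff)
  then have "(1 - x) powr beta * (\<Sum>k<n. bc (Suc k) * x ^ k) \<le> (1 - x) powr beta * ((1 - x) powr (- beta) / a)"
    by (intro mult_left_mono) auto
  then show ?thesis unfolding powr_cancel[OF x] .
qed (use a_pos in simp)

lemma continuous_on_integrand:
  "continuous_on {x..1} (\<lambda>w. (1 - w) powr beta * w ^ k)"
  using beta_pos by (intro continuous_intros continuous_on_powr') auto

lemma integrand_integrable: "(\<lambda>w. (1 - w) powr beta * w ^ k) integrable_on {x..1}"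
  by (rule integrable_continuous_interval) (rule continuous_on_integrand)

text \<open>The partial sums are dominated by a constant because
  \<open>\<Sum> b\<^sub>k w\<^sup>k\<^sup>-\<^sup>1\<close> is a multiple of \<open>(1 - w)\<^sup>-\<^sup>\<beta>\<close>.\<close>

lemma swap_integral:
  assumes x: "0 \<le> x" "x \<le> 1" and c: "\<And>k. \<bar>c (Suc k)\<bar> \<le> C"
  shows "(\<lambda>w. (1 - w) powr beta * (\<Sum>k. c (Suc k) * bc (Suc k) * w ^ k)) integrable_on {x..1}"
    and "(\<lambda>k. c (Suc k) * bc (Suc k) * J (Suc k) x) sums
      integral {x..1} (\<lambda>w. (1 - w) powr beta * (\<Sum>k. c (Suc k) * bc (Suc k) * w ^ k))"
proof -
  define g where "g n w = (1 - w) powr beta * (\<Sum>k<n. c (Suc k) * bc (Suc k) * w ^ k)" for n w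
  have C: "C \<ge> 0" using c[of 0] by linarith
  have g_sum: "g n = (\<lambda>w. \<Sum>k<n. c (Suc k) * bc (Suc k) * ((1 - w) powr beta * w ^ k))" for n
    by (simp add: g_def sum_distrib_left mult_ac fun_eq_iff)
  have int: "g n integrable_on {x..1}" for n
    unfolding g_sum by (intro integrable_sum integrable_on_mult_right integrand_integrable) auto
  have bound: "norm (g n w) \<le> C / a" if "w \<in> {x..1}" for n w
  proof -
    have w: "0 \<le> w" "w \<le> 1" using that x by auto
    have "\<bar>\<Sum>k<n. c (Suc k) * bc (Suc k) * w ^ k\<bar> \<le> (\<Sum>k<n. C * (bc (Suc k) * w ^ k))"
      using w c bc_nonneg
      by (intro order_trans[OF sum_abs] sum_mono) (auto simp: abs_mult mult.assoc intro!: mult_right_mono)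
    then have "(1 - w) powr beta * \<bar>\<Sum>k<n. c (Suc k) * bc (Suc k) * w ^ k\<bar>
        \<le> (1 - w) powr beta * (\<Sum>k<n. C * (bc (Suc k) * w ^ k))"
      by (intro mult_left_mono) auto
    also have "\<dots> = C * ((1 - w) powr beta * (\<Sum>k<n. bc (Suc k) * w ^ k))"
      by (simp add: sum_distrib_left mult_ac)
    also have "\<dots> \<le> C * (1 / a)" using sum_bc_le[OF w] C by (intro mult_left_mono) auto
    finally show ?thesis by (simp add: g_def abs_mult)
  qed
  have lim: "(\<lambda>n. g n w) \<longlonglongrightarrow> (1 - w) powr beta * (\<Sum>k. c (Suc k) * bc (Suc k) * w ^ k)"
    if "w \<in> {x..1}" for w
  proof (cases "w = 1")
    case False
    then have w: "0 \<le> w" "w < 1" using that x by auto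
    have "summable (\<lambda>k. c (Suc k) * bc (Suc k) * w ^ k)"
    proof (rule summable_comparison_test)
      show "summable (\<lambda>k. C * (bc (Suc k) * w ^ k))"
        by (intro summable_mult sums_summable[OF sums_bc[OF w]])
      show "\<exists>N. \<forall>n\<ge>N. norm (c (Suc n) * bc (Suc n) * w ^ n) \<le> C * (bc (Suc n) * w ^ n)"
        using w c bc_nonneg by (auto simp: abs_mult mult.assoc intro!: mult_right_mono)
    qed
    then show ?thesis unfolding g_def by (intro tendsto_mult tendsto_const summable_LIMSEQ)
  qed (simp add: g_def)
  have h: "(\<lambda>_. C / a) integrable_on {x..1}" by (intro integrable_continuous_interval) auto
  note dc = dominated_convergence[OF int h bound lim]
  show "(\<lambda>w. (1 - w) powr beta * (\<Sum>k. c (Suc k) * bc (Suc k) * w ^ k)) integrable_on {x..1}"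
    by (rule dc(1))
  have "integral {x..1} (g n) = (\<Sum>k<n. c (Suc k) * bc (Suc k) * J (Suc k) x)" for n
    unfolding g_sum J_def
    by (subst integral_sum) (auto intro!: integrable_on_mult_right integrand_integrable)
  then show "(\<lambda>k. c (Suc k) * bc (Suc k) * J (Suc k) x) sums
      integral {x..1} (\<lambda>w. (1 - w) powr beta * (\<Sum>k. c (Suc k) * bc (Suc k) * w ^ k))"
    using dc(2) by (simp add: sums_def)
qed

lemma J_0: "J (Suc k) 0 = Beta (real (Suc k)) (beta + 1)"
proof -
  have "((\<lambda>t. t powr (real (Suc k) - 1) * (1 - t) powr (beta + 1 - 1)) has_integral
      Beta (real (Suc k)) (beta + 1)) {0..1}"
    using beta_pos by (intro has_integral_Beta_real) auto
  then have "((\<lambda>w. (1 - w) powr beta * w ^ k) has_integral Beta (real (Suc k)) (beta + 1)) {0..1}"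
    by (rule has_integral_spike_finite[rotated 2, of _ _ _ "{0}"]) (auto simp: powr_realpow)
  then show ?thesis unfolding J_def by (simp add: integral_unique)
qed

text \<open>By \<open>J_0\<close> the integral is a Beta value, whose recursion in the first
  argument matches that of \<open>p\<close>. The identity turns series with the weights
  \<open>wt\<close> into integrals over the unit interval.\<close>

lemma bc_J_0: "bc (Suc k) * J (Suc k) 0 = wt (Suc k)"
proof (induction k)
  case 0
  have "beta + 1 > 0" using beta_pos by simp
  then have "beta + 1 \<notin> \<int>\<^sub>\<le>\<^sub>0" by (auto elim!: nonpos_Ints_cases)
  then have "Beta 1 (beta + 1) = 1 / (beta + 1)"
    using Gamma_plus1[of "beta + 1"] Gamma_real_pos[OF \<open>beta + 1 > 0\<close>]
    by (simp add: Beta_def add_ac)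
  moreover have "a * (beta + 1) = X 2" using a_pos by (simp add: beta_def X_def d_eq field_simps)
  moreover have "p (Suc 0) = 1" using p_Suc[of 0] by simp
  ultimately show ?case using d_ge_2
    by (simp add: J_0 bc_def wt_def X_1 numeral_2_eq_2)
next
  case (Suc k)
  have B: "(real (Suc k) + (beta + 1)) * J (Suc (Suc k)) 0 = real (Suc k) * J (Suc k) 0"
    unfolding J_0 using Beta_plus1_left[of "real (Suc k)" "beta + 1"]
    by (auto simp: nonpos_Ints_def add.commute)
  have a3: "a * (real (Suc k) + (beta + 1)) = X (Suc (Suc (Suc k)))"
    using a_pos by (simp add: beta_def X_def d_eq field_simps)
  have b: "bc (Suc (Suc k)) * (a * real (Suc k)) = bc (Suc k) * X (Suc k)"
    using a_pos p_Suc[of "Suc k"] by (simp add: bc_def field_simps del: of_nat_Suc)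
  have "bc (Suc (Suc k)) * J (Suc (Suc k)) 0 * X (Suc (Suc (Suc k)))
     = bc (Suc (Suc k)) * a * ((real (Suc k) + (beta + 1)) * J (Suc (Suc k)) 0)"
    unfolding a3[symmetric] by (simp only: mult_ac)
  also have "\<dots> = bc (Suc (Suc k)) * (a * real (Suc k)) * J (Suc k) 0"
    unfolding B by (simp only: mult_ac)
  also have "\<dots> = X (Suc k) * wt (Suc k)"
    unfolding b Suc[symmetric] by (simp only: mult_ac)
  also have "\<dots> = wt (Suc (Suc k)) * X (Suc (Suc (Suc k)))"
    by (simp add: wt_def)
  finally show ?case by simp
qed

lemma wt_sums_integral:
  assumes "\<And>k. \<bar>c (Suc k)\<bar> \<le> C"
  shows "(\<lambda>k. wt (Suc k) * c (Suc k)) sums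
      integral {0..1} (\<lambda>w. (1 - w) powr beta * (\<Sum>k. c (Suc k) * bc (Suc k) * w ^ k))"
proof -
  have eq: "c (Suc k) * bc (Suc k) * J (Suc k) 0 = wt (Suc k) * c (Suc k)" for k
    unfolding bc_J_0[symmetric] by (simp only: mult_ac)
  show ?thesis using swap_integral(2)[of 0 c, OF _ _ assms, unfolded eq] by simp
qed

text \<open>Note the shift: \<open>u k\<close> belongs to trees of size \<open>Suc k\<close>. The
  factor \<open>bc\<close> absorbs the number of trees and the constants that accompany
  \<open>phi\<close> in the theorem, and it makes the sum over \<open>k\<close> bounded.\<close>

definition u :: "nat \<Rightarrow> real \<Rightarrow> real" where "u k x = bc (Suc k) * phi d (Suc k) x"

lemma J_nonneg: "0 \<le> x \<Longrightarrow> J k x \<ge> 0"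
  unfolding J_def by (intro integral_nonneg integrand_integrable) auto

lemma u_nonneg: "0 \<le> x \<Longrightarrow> x \<le> 1 \<Longrightarrow> u k x \<ge> 0"
  by (simp add: u_def phi_eq bc_nonneg J_nonneg)

text \<open>Since \<open>phi\<close> divides its integral by the length of \<open>[x, 1]\<close>,
  the sum is the mean over that interval of a function which \<open>sum_bc_le\<close> bounds by
  \<open>1 / a\<close>.\<close>

lemma sum_u_le:
  assumes "0 \<le> x" "x \<le> 1"
  shows "(\<Sum>k<n. u k x) \<le> 1 / a"
proof (cases "x = 1")
  case False
  with assms have x: "0 \<le> x" "x < 1" by auto
  have "(\<Sum>k<n. bc (Suc k) * J (Suc k) x)
      = integral {x..1} (\<lambda>w. \<Sum>k<n. bc (Suc k) * ((1 - w) powr beta * w ^ k))"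
    unfolding J_def by (subst integral_sum) (auto intro!: integrable_on_mult_right integrand_integrable)
  also have "\<dots> = integral {x..1} (\<lambda>w. (1 - w) powr beta * (\<Sum>k<n. bc (Suc k) * w ^ k))"
    by (simp add: sum_distrib_left mult_ac)
  also have "\<dots> \<le> integral {x..1} (\<lambda>w. 1 / a)"
  proof (rule integral_le)
    show "(\<lambda>w. (1 - w) powr beta * (\<Sum>k<n. bc (Suc k) * w ^ k)) integrable_on {x..1}"
      using beta_pos by (intro integrable_continuous_interval continuous_intros continuous_on_powr') auto
    show "(\<lambda>w. 1 / a) integrable_on {x..1}" by (intro integrable_continuous_interval) auto
  qed (use x sum_bc_le in auto)
  also have "\<dots> = (1 - x) / a" using x by simp
  finally have "inverse (1 - x) * (\<Sum>k<n. bc (Suc k) * J (Suc k) x) \<le> inverse (1 - x) * ((1 - x) / a)"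
    using x by (intro mult_left_mono) auto
  then show ?thesis using x by (simp add: u_def phi_eq sum_distrib_left mult_ac)
qed (use a_pos in \<open>simp add: u_def phi_eq\<close>)

lemma continuous_on_u: "continuous_on {0<..<1} (u k)"
proof -
  have "continuous_on {0..1} (J (Suc k))"
    unfolding J_def by (intro indefinite_integral_continuous_1' integrand_integrable)
  then have "continuous_on {0<..<1} (J (Suc k))" by (rule continuous_on_subset) auto
  then show ?thesis unfolding u_def phi_eq by (intro continuous_intros) auto
qed

lemma abs_sum_u_le:
  assumes "0 \<le> x" "x \<le> 1" "\<And>k. \<bar>c (Suc k)\<bar> \<le> C"
  shows "\<bar>\<Sum>k<n. c (Suc k) * u k x\<bar> \<le> C / a"
proof -
  have C: "C \<ge> 0" using assms(3)[of 0] by linarith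
  have "\<bar>\<Sum>k<n. c (Suc k) * u k x\<bar> \<le> (\<Sum>k<n. C * u k x)"
    using assms u_nonneg by (intro order_trans[OF sum_abs] sum_mono) (auto simp: abs_mult intro!: mult_right_mono)
  also have "\<dots> = C * (\<Sum>k<n. u k x)" by (simp add: sum_distrib_left)
  also have "\<dots> \<le> C * (1 / a)" using C sum_u_le[OF assms(1,2)] by (intro mult_left_mono) auto
  finally show ?thesis by simp
qed

lemma summable_u:
  assumes "0 \<le> x" "x \<le> 1" "\<And>k. \<bar>c (Suc k)\<bar> \<le> C"
  shows "summable (\<lambda>k. c (Suc k) * u k x)"
proof (rule summable_rabs_cancel, rule summableI_nonneg_bounded)
  fix n
  show "(\<Sum>k<n. \<bar>c (Suc k) * u k x\<bar>) \<le> C / a"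
    using abs_sum_u_le[OF assms(1,2), of "\<lambda>k. \<bar>c k\<bar>" C n] assms u_nonneg
    by (simp add: abs_mult sum_nonneg)
qed simp

lemma u_prod_integrable: "(\<lambda>x. u k x * u l x) integrable_on {0..1}"
proof (rule integrable_continuous_bounded[where C = "1 / a * (1 / a)"])
  show "continuous_on {0<..<1} (\<lambda>x. u k x * u l x)" by (intro continuous_intros continuous_on_u)
  fix x :: real assume x: "x \<in> {0<..<1}"
  have le: "u k x \<le> 1 / a" for k
    using sum_u_le[of x "Suc k"] x u_nonneg[of x] sum_nonneg[of "{..<k}" "\<lambda>k. u k x"] by simp
  show "\<bar>u k x * u l x\<bar> \<le> 1 / a * (1 / a)"
    unfolding abs_mult using x u_nonneg[of x] le a_pos by (intro mult_mono) auto
qed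

text \<open>The Gram matrix of the functions \<open>u k\<close>. Its quadratic forms are integrals
  of squares, so the double sum in the theorem becomes the integral of one squared series.\<close>

definition G :: "nat \<Rightarrow> nat \<Rightarrow> real" where "G k l = integral {0..1} (\<lambda>x. u k x * u l x)"

lemma G_nonneg: "G k l \<ge> 0"
  unfolding G_def using u_nonneg by (intro integral_nonneg u_prod_integrable) auto

lemma sum_G_eq: "(\<Sum>k<n. \<Sum>l<n. c k * c l * G k l) = integral {0..1} (\<lambda>x. (\<Sum>k<n. c k * u k x)\<^sup>2)"
proof -
  have "integral {0..1} (\<lambda>x. (\<Sum>k<n. c k * u k x)\<^sup>2)
      = integral {0..1} (\<lambda>x. \<Sum>k<n. \<Sum>l<n. c k * c l * (u k x * u l x))"
    by (simp add: power2_eq_square sum_product mult_ac)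
  also have "\<dots> = (\<Sum>k<n. \<Sum>l<n. c k * c l * G k l)"
    unfolding G_def
    by (subst integral_sum, auto intro!: integrable_sum integrable_on_mult_right u_prod_integrable)
       (subst integral_sum, auto intro!: integrable_on_mult_right u_prod_integrable)
  finally show ?thesis by simp
qed

lemma sum_G_tendsto:
  assumes c: "\<And>k. \<bar>c (Suc k)\<bar> \<le> C"
  shows "(\<lambda>n. \<Sum>k<n. \<Sum>l<n. c (Suc k) * c (Suc l) * G k l) \<longlonglongrightarrow>
      integral {0..1} (\<lambda>x. (\<Sum>k. c (Suc k) * u k x)\<^sup>2)"
proof -
  have h: "(\<lambda>_. (C / a)\<^sup>2) integrable_on {0..(1::real)}" by (intro integrable_continuous_interval) auto
  have "(\<lambda>n. integral {0..1} (\<lambda>x. (\<Sum>k<n. c (Suc k) * u k x)\<^sup>2)) \<longlonglongrightarrow>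
      integral {0..1} (\<lambda>x. (\<Sum>k. c (Suc k) * u k x)\<^sup>2)"
  proof (rule dominated_convergence(2)[OF _ h])
    fix n
    have "(\<lambda>x. \<Sum>k<n. \<Sum>l<n. c (Suc k) * c (Suc l) * (u k x * u l x)) integrable_on {0..1}"
      by (intro integrable_sum integrable_on_mult_right u_prod_integrable) auto
    then show "(\<lambda>x. (\<Sum>k<n. c (Suc k) * u k x)\<^sup>2) integrable_on {0..1}"
      by (simp add: power2_eq_square sum_product mult_ac)
  next
    fix n and x :: real assume x: "x \<in> {0..1}"
    have "\<bar>\<Sum>k<n. c (Suc k) * u k x\<bar> \<le> C / a" using abs_sum_u_le[of x c C n] x c by auto
    then show "norm ((\<Sum>k<n. c (Suc k) * u k x)\<^sup>2) \<le> (C / a)\<^sup>2"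
      using power_mono[OF _ abs_ge_zero, of _ "C / a" 2] by simp
  next
    fix x :: real assume x: "x \<in> {0..1}"
    show "(\<lambda>n. (\<Sum>k<n. c (Suc k) * u k x)\<^sup>2) \<longlonglongrightarrow> (\<Sum>k. c (Suc k) * u k x)\<^sup>2"
      using x c by (intro tendsto_power summable_LIMSEQ summable_u) auto
  qed
  then show ?thesis unfolding sum_G_eq[of "\<lambda>k. c (Suc k)"] .
qed

lemma sum_G_le: "(\<Sum>k<n. \<Sum>l<n. G k l) \<le> 1 / a\<^sup>2"
proof -
  have "(\<Sum>k<n. \<Sum>l<n. G k l) = integral {0..1} (\<lambda>x. (\<Sum>k<n. u k x)\<^sup>2)"
    using sum_G_eq[where c = "\<lambda>_. 1"] by simp
  also have "\<dots> \<le> integral {0..1} (\<lambda>x::real. (1 / a)\<^sup>2)"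
  proof (rule integral_le)
    have "(\<lambda>x. \<Sum>k<n. \<Sum>l<n. u k x * u l x) integrable_on {0..1}"
      by (intro integrable_sum u_prod_integrable) auto
    then show "(\<lambda>x. (\<Sum>k<n. u k x)\<^sup>2) integrable_on {0..1}"
      by (simp add: power2_eq_square sum_product)
    show "(\<lambda>x. (1 / a)\<^sup>2) integrable_on {0..1::real}" by (intro integrable_continuous_interval) auto
    fix x :: real assume "x \<in> {0..1}"
    then show "(\<Sum>k<n. u k x)\<^sup>2 \<le> (1 / a)\<^sup>2"
      using sum_u_le[of x n] u_nonneg[of x] by (intro power_mono sum_nonneg) auto
  qed
  finally show ?thesis by (simp add: power_divide)
qed

lemma eval_P_power:
  assumes "0 \<le> x" "x < 1"
  shows "eval_fps (P ^ l) (x / a) = (1 - x) powr (- real l / a)"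
proof -
  have "eval_fps (P ^ l) (x / a) = ((1 - x) powr (- 1 / a)) ^ l"
    using in_conv_radius[OF assms conv_radius_P] by (simp add: eval_fps_power eval_P[OF assms])
  also have "\<dots> = (1 - x) powr (- real l / a)"
    using assms by (simp add: powr_realpow[symmetric] powr_powr)
  finally show ?thesis .
qed

end

section \<open>The differential equation for the generating function of the means\<close>

context toll
begin

definition Mf :: "real \<Rightarrow> real" where "Mf x = eval_fps (tree_egf d Y) (x / a)"

definition Stau :: "real \<Rightarrow> real" where "Stau x = (\<Sum>k. tau (Suc k) * bc (Suc k) * x ^ k)"

definition Phi :: "real \<Rightarrow> real" where "Phi x = (\<Sum>k. tau (Suc k) * u k x)"

lemma egf_Y: "tree_egf d Y = Abs_fps (\<lambda>k. m k * p k)"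
  unfolding fps_eq_iff tree_egf_nth_avg m_def by simp

lemma conv_radius_egf_Y: "fps_conv_radius (tree_egf d Y) \<ge> ereal (1 / a)"
  unfolding egf_Y using abs_m_le
  by (intro conv_radius_bounded[where C = Cm]) (simp add: abs_mult abs_of_pos[OF p_pos] mult_right_mono less_imp_le)

definition R :: "real fps" where "R = Abs_fps (\<lambda>k. tau k * p k)"

lemma conv_radius_R: "fps_conv_radius R \<ge> ereal (1 / a)"
  unfolding R_def
\<comment> \<open>\<open>tau 0\<close> is the value of the toll at \<open>Empty\<close>, which
  \<open>B\<close> does not bound.\<close>
proof (rule conv_radius_bounded[where C = "B + \<bar>tau 0\<bar>"])
  fix k
  have "\<bar>tau k\<bar> \<le> B + \<bar>tau 0\<bar>" using abs_tau_le_B[of k] B_nonneg by (cases "k = 0") auto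
  then show "\<bar>tau k * p k\<bar> \<le> (B + \<bar>tau 0\<bar>) * p k"
    by (simp add: abs_mult abs_of_pos[OF p_pos] mult_right_mono less_imp_le)
qed

text \<open>This is \<open>m_recurrence\<close> multiplied by the denominator of \<open>w\<close>
  and read coefficientwise.\<close>

lemma egf_Y_ode:
  "fps_deriv (tree_egf d Y) = fps_const (real d) * (tree_egf d Y * P ^ (d - 1)) + fps_deriv R"
proof (rule fps_ext)
  fix n
  define N where "N = real (Suc n) * p (Suc n)"
  have N: "N \<noteq> 0" by (simp add: N_def del: of_nat_Suc)
  have "m (Suc n) = (\<Sum>k\<le>n. real d * (m k * p k * a ^ (n - k)) / N) + tau (Suc n)"
    using m_recurrence[of "Suc n"] by (simp add: w_def N_def lessThan_Suc_atMost mult_ac del: of_nat_Suc)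
  also have "\<dots> = real d * (\<Sum>k\<le>n. m k * p k * a ^ (n - k)) / N + tau (Suc n)"
    by (simp add: sum_distrib_left sum_divide_distrib)
  finally have "N * m (Suc n) = real d * (\<Sum>k\<le>n. m k * p k * a ^ (n - k)) + N * tau (Suc n)"
    using N by (simp add: field_simps)
  moreover have "fps_nth (tree_egf d Y * P ^ (d - 1)) n = (\<Sum>k\<le>n. m k * p k * a ^ (n - k))"
    unfolding fps_mult_nth P_power_nth by (simp add: egf_Y atMost_atLeast0)
  ultimately show "fps_nth (fps_deriv (tree_egf d Y)) n
      = fps_nth (fps_const (real d) * (tree_egf d Y * P ^ (d - 1)) + fps_deriv R) n"
    by (simp add: egf_Y R_def N_def mult_ac del: of_nat_Suc)
qed

lemma eval_deriv_R:
  assumes "0 \<le> x" "x < 1"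
  shows "eval_fps (fps_deriv R) (x / a) = a * Stau x"
proof -
  have "(\<lambda>k. fps_nth (fps_deriv R) k * (x / a) ^ k / a) sums (eval_fps (fps_deriv R) (x / a) / a)"
    by (intro sums_divide sums_eval_fps
        less_le_trans[OF in_conv_radius[OF assms conv_radius_R] fps_conv_radius_deriv])
  moreover have "fps_nth (fps_deriv R) k * (x / a) ^ k / a = tau (Suc k) * bc (Suc k) * x ^ k" for k
    unfolding mult.assoc[of _ "bc (Suc k)"] bc_Suc_power by (simp add: R_def mult_ac del: of_nat_Suc)
  ultimately show ?thesis using a_pos by (simp add: Stau_def sums_iff field_simps)
qed

lemma deriv_Mf:
  assumes "0 \<le> x" "x < 1"
  shows "(Mf has_real_derivative (beta * Mf x / (1 - x) + Stau x)) (at x within S)"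
proof -
  note r = in_conv_radius[OF assms conv_radius_egf_Y] and rP = in_conv_radius[OF assms conv_radius_P]
    and rR = in_conv_radius[OF assms conv_radius_R]
  have rPp: "ereal (norm (x / a)) < fps_conv_radius (P ^ (d - 1))"
    by (rule less_le_trans[OF rP fps_conv_radius_power])
  have rm: "ereal (norm (x / a)) < fps_conv_radius (tree_egf d Y * P ^ (d - 1))"
    by (rule less_le_trans[OF _ fps_conv_radius_mult]) (simp only: min_less_iff_conj r rPp)
  have rcm: "ereal (norm (x / a)) < fps_conv_radius (fps_const (real d) * (tree_egf d Y * P ^ (d - 1)))"
    using rm d_ge_2 by (subst fps_conv_radius_cmult_left) auto
  have "eval_fps (fps_deriv (tree_egf d Y)) (x / a)
      = real d * (Mf x * eval_fps (P ^ (d - 1)) (x / a)) + a * Stau x"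
  proof -
    have "eval_fps (fps_const (real d) * (tree_egf d Y * P ^ (d - 1))) (x / a)
        = real d * eval_fps (tree_egf d Y * P ^ (d - 1)) (x / a)"
      using rm by (subst eval_fps_mult) auto
    then show ?thesis
      unfolding egf_Y_ode eval_fps_add[OF rcm less_le_trans[OF rR fps_conv_radius_deriv]]
        eval_deriv_R[OF assms] by (simp only: eval_fps_mult[OF r rPp] Mf_def)
  qed
  also have "eval_fps (P ^ (d - 1)) (x / a) = 1 / (1 - x)"
    using assms a_pos eval_P_power[OF assms, of "d - 1"] by (simp add: a_nat powr_minus inverse_eq_divide)
  finally have eq: "eval_fps (fps_deriv (tree_egf d Y)) (x / a) * (1 / a) = beta * Mf x / (1 - x) + Stau x"
    using a_pos by (simp add: beta_def add_divide_distrib)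
  have "((\<lambda>x. x / a) has_real_derivative 1 / a) (at x within S)"
    using a_pos by (auto intro!: derivative_eq_intros)
  from DERIV_chain2[OF has_field_derivative_eval_fps[OF r] this] show ?thesis
    unfolding eq Mf_def[abs_def] .
qed

text \<open>\<open>(1 - x) powr beta\<close> is the integrating factor of the equation in
  \<open>deriv_Mf\<close>: its derivative cancels the term
  \<open>beta * Mf x / (1 - x)\<close>.\<close>

definition Hf :: "real \<Rightarrow> real" where "Hf x = (1 - x) powr beta * Mf x"

lemma deriv_Hf:
  assumes "0 \<le> x" "x < 1"
  shows "(Hf has_real_derivative ((1 - x) powr beta * Stau x)) (at x within S)"
proof -
  have "((\<lambda>x. 1 - x) has_real_derivative - 1) (at x within S)"
    by (auto intro!: derivative_eq_intros)
  from DERIV_chain2[OF has_real_derivative_powr this, of beta] assms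
  have d: "((\<lambda>x. (1 - x) powr beta) has_real_derivative beta * (1 - x) powr (beta - 1) * - 1) (at x within S)"
    by simp
  have pw: "(1 - x) powr (beta - 1) = (1 - x) powr beta / (1 - x)"
    using assms by (simp add: powr_diff)
  have "beta * (1 - x) powr (beta - 1) * - 1 * Mf x + (beta * Mf x / (1 - x) + Stau x) * (1 - x) powr beta
      = (1 - x) powr beta * Stau x"
    unfolding pw by (simp add: algebra_simps)
  with DERIV_mult[OF d deriv_Mf[OF assms]] show ?thesis
    unfolding Hf_def[abs_def] by simp
qed

lemma Hf_0: "Hf 0 = - mu / a"
  by (simp add: Hf_def Mf_def eval_fps_at_0 egf_Y m_0)

text \<open>The choice of \<open>mu\<close> makes the integral of the derivative of
  \<open>Hf\<close> over the whole unit interval equal to \<open>- Hf 0\<close>, so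
  \<open>- Hf x\<close> is the integral from \<open>x\<close> to 1 with no boundary term. This is
  the origin of the range of integration in \<open>phi\<close>.\<close>

lemma Hf_eq:
  assumes "0 \<le> x" "x < 1"
  shows "(\<lambda>k. tau (Suc k) * bc (Suc k) * J (Suc k) x) sums (- Hf x)"
proof -
  let ?g = "\<lambda>w. (1 - w) powr beta * Stau w"
  have tauB: "\<bar>tau (Suc k)\<bar> \<le> B" for k by (simp add: abs_tau_le_B)
  have int: "?g integrable_on {0..1}"
    using swap_integral(1)[of 0 tau B] tauB by (simp add: Stau_def)
  have "(\<lambda>k. wt (Suc k) * tau (Suc k)) sums integral {0..1} ?g"
    using wt_sums_integral[of tau B] tauB by (simp add: Stau_def)
  then have 1: "integral {0..1} ?g = mu / a"
    using a_pos by (simp add: sums_iff mu_def)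
  have "(?g has_integral (Hf x - Hf 0)) {0..x}"
  proof (rule fundamental_theorem_of_calculus)
    fix y assume "y \<in> {0..x}"
    then show "(Hf has_vector_derivative ?g y) (at y within {0..x})"
      using assms unfolding has_real_derivative_iff_has_vector_derivative[symmetric]
      by (intro deriv_Hf) auto
  qed (use assms in auto)
  then have 2: "integral {0..x} ?g = Hf x + mu / a"
    by (simp add: integral_unique Hf_0)
  have "integral {0..x} ?g + integral {x..1} ?g = integral {0..1} ?g"
    using assms int by (intro Henstock_Kurzweil_Integration.integral_combine) auto
  then have "integral {x..1} ?g = - Hf x" using 1 2 by simp
  then show ?thesis
    using swap_integral(2)[of x tau B] tauB assms by (simp add: Stau_def)
qed

lemma Phi_eq:
  assumes "0 \<le> x" "x < 1"
  shows "Phi x = - ((1 - x) powr (1 / a) * Mf x)"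
proof -
  have "(\<lambda>k. inverse (1 - x) * (tau (Suc k) * bc (Suc k) * J (Suc k) x)) sums (inverse (1 - x) * - Hf x)"
    by (rule sums_mult[OF Hf_eq[OF assms]])
  moreover have "inverse (1 - x) * (tau (Suc k) * bc (Suc k) * J (Suc k) x) = tau (Suc k) * u k x" for k
    by (simp add: u_def phi_eq mult_ac)
  ultimately have "Phi x = inverse (1 - x) * - Hf x" by (simp add: Phi_def sums_iff)
  also have "\<dots> = - ((1 - x) powr (1 / a) * Mf x)"
    using assms by (simp add: Hf_def beta_eq powr_add)
  finally show ?thesis .
qed

lemma Phi_1: "Phi 1 = 0"
  by (simp add: Phi_def u_def phi_eq)

text \<open>Pairs of distinct branches have the generating function \<open>Mf\<close> squared times
  \<open>P ^ (d - 2)\<close>. The exponents of \<open>1 - x\<close> combine to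
  \<open>beta - (d - 2) / a = 2 / a\<close>, which is what the square of \<open>Phi\<close> requires
  by \<open>Phi_eq\<close>.\<close>

lemma q_series:
  assumes "0 \<le> x" "x < 1"
  shows "(1 - x) powr beta * (\<Sum>k. q (Suc k) * bc (Suc k) * x ^ k) = real d * (Phi x)\<^sup>2"
proof -
  note r = in_conv_radius[OF assms conv_radius_egf_Y] and rP = in_conv_radius[OF assms conv_radius_P]
  let ?E = "tree_egf d Y ^ 2 * P ^ (d - 2)"
  have rp: "ereal (norm (x / a)) < fps_conv_radius (tree_egf d Y ^ 2)"
    "ereal (norm (x / a)) < fps_conv_radius (P ^ (d - 2))"
    by (rule less_le_trans[OF r fps_conv_radius_power], rule less_le_trans[OF rP fps_conv_radius_power])
  have "ereal (norm (x / a)) < fps_conv_radius ?E"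
    by (rule less_le_trans[OF _ fps_conv_radius_mult]) (simp only: min_less_iff_conj rp)
  from sums_mult[OF sums_eval_fps[OF this], of "real d"]
  have "(\<lambda>k. real d * (fps_nth ?E k * (x / a) ^ k)) sums (real d * eval_fps ?E (x / a))" .
  moreover have "real d * (fps_nth ?E k * (x / a) ^ k) = q (Suc k) * bc (Suc k) * x ^ k" for k
    unfolding mult.assoc[of _ "bc (Suc k)"] bc_Suc_power q_def using a_pos
    by (simp add: mult_ac del: of_nat_Suc)
  ultimately have "(\<Sum>k. q (Suc k) * bc (Suc k) * x ^ k) = real d * eval_fps ?E (x / a)"
    by (simp add: sums_iff)
  also have "eval_fps ?E (x / a) = (Mf x)\<^sup>2 * (1 - x) powr (- real (d - 2) / a)"
    by (simp only: eval_fps_mult[OF rp] eval_fps_power[OF r] eval_P_power[OF assms] Mf_def)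
  finally have "(1 - x) powr beta * (\<Sum>k. q (Suc k) * bc (Suc k) * x ^ k)
      = real d * ((Mf x)\<^sup>2 * ((1 - x) powr beta * (1 - x) powr (- real (d - 2) / a)))"
    by (simp only: mult_ac)
  also have "(1 - x) powr beta * (1 - x) powr (- real (d - 2) / a) = ((1 - x) powr (1 / a))\<^sup>2"
  proof -
    have "beta + - real (d - 2) / a = 1 / a + 1 / a"
    proof -
      have eq: "real (d - 2) = a - 1" using d_ge_2 by (simp add: a_def of_nat_diff)
      show ?thesis unfolding eq beta_eq using a_pos by (simp add: field_simps)
    qed
    then show ?thesis by (simp only: power2_eq_square powr_add[symmetric])
  qed
  also have "real d * ((Mf x)\<^sup>2 * ((1 - x) powr (1 / a))\<^sup>2) = real d * (Phi x)\<^sup>2"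
    unfolding Phi_eq[OF assms] by (simp add: power_mult_distrib)
  finally show ?thesis .
qed

lemma q_sums: "(\<lambda>k. wt (Suc k) * q (Suc k)) sums (real d * integral {0..1} (\<lambda>x. (Phi x)\<^sup>2))"
proof -
  have "(\<lambda>k. wt (Suc k) * q (Suc k)) sums
      integral {0..1} (\<lambda>w. (1 - w) powr beta * (\<Sum>k. q (Suc k) * bc (Suc k) * w ^ k))"
    by (rule wt_sums_integral[where C = "real d * a * Cm\<^sup>2"]) (simp add: abs_q_le)
  also have "integral {0..1} (\<lambda>w. (1 - w) powr beta * (\<Sum>k. q (Suc k) * bc (Suc k) * w ^ k))
      = integral {0..1} (\<lambda>w. real d * (Phi w)\<^sup>2)"
  proof (rule integral_cong)
    fix x :: real assume "x \<in> {0..1}"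
    then show "(1 - x) powr beta * (\<Sum>k. q (Suc k) * bc (Suc k) * x ^ k) = real d * (Phi x)\<^sup>2"
      using q_series[of x] by (cases "x = 1") (auto simp: Phi_1)
  qed
  finally show ?thesis by simp
qed

end

text \<open>\<open>infsum\<close> is unconditional, so a limit along one exhaustion does not
  determine it. The bound on the absolute sums yields summability, after which any exhaustion
  computes the value.\<close>

lemma infsum_exhaustion:
  fixes h :: "'a \<Rightarrow> real"
  assumes A: "incseq A" "\<And>n. finite (A n)" "(\<Union>n. A n) = U"
    and bdd: "\<And>n. (\<Sum>x\<in>A n. \<bar>h x\<bar>) \<le> C"
    and lim: "(\<lambda>n. \<Sum>x\<in>A n. h x) \<longlonglongrightarrow> S"
  shows "h summable_on U" "infsum h U = S"
proof -
  have sub: "\<exists>n. F \<subseteq> A n" if "finite F" "F \<subseteq> U" for F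
    using that
  proof (induction F rule: finite_induct)
    case (insert x F)
    then obtain k l where "F \<subseteq> A k" "x \<in> A l" using A(3) by blast
    moreover have "A k \<subseteq> A (max k l)" "A l \<subseteq> A (max k l)" by (intro incseqD[OF A(1)]; simp)+
    ultimately show ?case by (intro exI[of _ "max k l"]) auto
  qed simp
  have "(\<Sum>x\<in>F. \<bar>h x\<bar>) \<le> C" if F: "finite F" "F \<subseteq> U" for F
  proof -
    obtain n where "F \<subseteq> A n" using sub[OF F] by blast
    then have "(\<Sum>x\<in>F. \<bar>h x\<bar>) \<le> (\<Sum>x\<in>A n. \<bar>h x\<bar>)" by (intro sum_mono2 A) auto
    then show ?thesis using bdd[of n] by simp
  qed
  then have "(\<lambda>x. norm (h x)) summable_on U"
    unfolding abs_summable_iff_bdd_above by (intro bdd_aboveI2[where M = C]) auto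
  then show summ: "h summable_on U" by (rule abs_summable_summable)
  have "filterlim A (finite_subsets_at_top U) sequentially"
    unfolding filterlim_iff eventually_finite_subsets_at_top
  proof safe
    fix Q X assume X: "finite X" "X \<subseteq> U" "\<forall>Y. finite Y \<and> X \<subseteq> Y \<and> Y \<subseteq> U \<longrightarrow> Q Y"
    obtain n where n: "X \<subseteq> A n" using sub[OF X(1,2)] by blast
    show "\<forall>\<^sub>F n in sequentially. Q (A n)"
      using eventually_ge_at_top[of n]
    proof eventually_elim
      case (elim k)
      then have "X \<subseteq> A k" using n incseqD[OF A(1)] by blast
      then show ?case using X(3) A(2,3) by blast
    qed
  qed
  then have "(\<lambda>n. sum h (A n)) \<longlonglongrightarrow> infsum h U"
    using has_sum_infsum[OF summ] unfolding has_sum_def by (rule filterlim_compose[rotated])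
  with lim show "infsum h U = S" using LIMSEQ_unique by blast
qed

section \<open>Sums over all trees and over pairs of trees\<close>

context dary_trees
begin

definition small_trees :: "nat \<Rightarrow> nat dary_tree set" where
  "small_trees n = (\<Union>k<n. trees_on d {1..Suc k})"

lemma finite_small_trees: "finite (small_trees n)"
  by (simp add: small_trees_def finite_trees_on)

lemma incseq_small_trees: "incseq small_trees"
  unfolding incseq_def small_trees_def by (intro allI impI UN_mono) auto

lemma UN_small_trees: "(\<Union>n. small_trees n) = inc_trees d"
proof
  show "(\<Union>n. small_trees n) \<subseteq> inc_trees d"
    using trees_on_inc_trees by (fastforce simp: small_trees_def)
  show "inc_trees d \<subseteq> (\<Union>n. small_trees n)"
  proof
    fix T assume T: "T \<in> inc_trees d"
    then have "nverts T \<noteq> 0" by (cases T) (auto simp: inc_trees_def)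
    then obtain k where k: "nverts T = Suc k" by (cases "nverts T") auto
    have "T \<in> trees_on d {1..Suc k}"
      using T k inc_trees_of_size_eq[of "Suc k" d] by (auto simp: inc_trees_of_size_def)
    then show "T \<in> (\<Union>n. small_trees n)" unfolding small_trees_def by blast
  qed
qed

lemma sum_small_trees: "(\<Sum>T\<in>small_trees n. h T) = (\<Sum>k<n. \<Sum>T\<in>trees_on d {1..Suc k}. h T)"
  unfolding small_trees_def
proof (rule sum.UNION_disjoint)
  show "\<forall>i\<in>{..<n}. \<forall>j\<in>{..<n}. i \<noteq> j \<longrightarrow> trees_on d {1..Suc i} \<inter> trees_on d {1..Suc j} = {}"
  proof (intro ballI impI)
    fix i j :: nat assume "i \<noteq> j"
    then show "trees_on d {1..Suc i} \<inter> trees_on d {1..Suc j} = {}"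
      using nverts_trees_on[of _ d "{1..Suc i}"] nverts_trees_on[of _ d "{1..Suc j}"] by fastforce
  qed
qed (auto simp: finite_trees_on)

lemma num_trees_Suc: "real (num_trees (Suc k)) = X k * real (num_trees k)"
  using p_Suc[of k] by (simp add: p_def field_simps del: of_nat_Suc)

text \<open>The denominators are \<open>X 2\<close> up to \<open>X (k + 1)\<close>, and there are
  \<open>X 0 * ... * X (k - 1)\<close> trees of size \<open>k\<close>. Each tree thus carries an
  equal share of \<open>wt k\<close>, and sums over trees become series over sizes.\<close>

lemma num_trees_weight:
  "(\<Prod>j=1..k. 1 / ((real d - 1) * real j + real d)) = wt k / real (num_trees k)"
proof (induction k)
  case 0
  have "num_trees 0 = 1" by (simp add: num_trees_def)
  then show ?case using d_ge_2 by (simp add: wt_def X_1)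
next
  case (Suc k)
  have "(real d - 1) * real (Suc k) + real d = X (Suc (Suc k))"
    by (simp add: X_def a_def algebra_simps)
  then have "(\<Prod>j=1..Suc k. 1 / ((real d - 1) * real j + real d))
      = wt k / real (num_trees k) * (1 / X (Suc (Suc k)))"
    using Suc by (simp del: of_nat_Suc)
  also have "\<dots> = wt (Suc k) / real (num_trees (Suc k))"
    unfolding num_trees_Suc by (simp add: wt_def)
  finally show ?case .
qed

lemma infsum_trees:
  assumes summ: "summable (\<lambda>k. wt (Suc k) * avg (\<lambda>T. \<bar>g T\<bar>) (Suc k))"
  defines "h \<equiv> \<lambda>T. g T * (\<Prod>j=1..nverts T. 1 / ((real d - 1) * real j + real d))"
  shows "h summable_on inc_trees d"
    and "infsum h (inc_trees d) = (\<Sum>k. wt (Suc k) * avg g (Suc k))"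
proof -
  have h: "h T = wt (Suc k) / real (num_trees (Suc k)) * g T" if "T \<in> trees_on d {1..Suc k}" for T k
  proof -
    have n: "nverts T = Suc k" using trees_onD(3)[OF _ that] by simp
    show ?thesis unfolding h_def n num_trees_weight by simp
  qed
  have sum1: "(\<Sum>T\<in>small_trees n. h T) = (\<Sum>k<n. wt (Suc k) * avg g (Suc k))" for n
    unfolding sum_small_trees
    by (intro sum.cong refl) (simp add: h avg_def tree_sum_def sum_distrib_left sum_divide_distrib cong: sum.cong)
  have sum2: "(\<Sum>T\<in>small_trees n. \<bar>h T\<bar>) = (\<Sum>k<n. wt (Suc k) * avg (\<lambda>T. \<bar>g T\<bar>) (Suc k))" for n
    unfolding sum_small_trees
    by (intro sum.cong refl)
       (simp add: h abs_mult wt_nonneg avg_def tree_sum_def sum_distrib_left sum_divide_distrib cong: sum.cong)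
  have nonneg: "avg (\<lambda>T. \<bar>g T\<bar>) k \<ge> 0" for k
    using order_trans[OF norm_ge_zero norm_avg_le[of g k]] by simp
  have le: "(\<Sum>T\<in>small_trees n. \<bar>h T\<bar>) \<le> (\<Sum>k. wt (Suc k) * avg (\<lambda>T. \<bar>g T\<bar>) (Suc k))" for n
    unfolding sum2 using summ nonneg wt_nonneg by (intro sum_le_suminf) auto
  have "summable (\<lambda>k. wt (Suc k) * avg g (Suc k))"
  proof (rule summable_comparison_test[OF _ summ], intro exI[of _ 0] allI impI)
    fix k
    show "norm (wt (Suc k) * avg g (Suc k)) \<le> wt (Suc k) * avg (\<lambda>T. \<bar>g T\<bar>) (Suc k)"
      using norm_avg_le[of g "Suc k"] wt_nonneg by (auto simp: abs_mult intro!: mult_left_mono)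
  qed
  then have lim: "(\<lambda>n. \<Sum>T\<in>small_trees n. h T) \<longlonglongrightarrow> (\<Sum>k. wt (Suc k) * avg g (Suc k))"
    unfolding sum1 by (rule summable_LIMSEQ)
  note ex = infsum_exhaustion[OF incseq_small_trees finite_small_trees UN_small_trees le lim]
  show "h summable_on inc_trees d" "infsum h (inc_trees d) = (\<Sum>k. wt (Suc k) * avg g (Suc k))"
    by (fact ex)+
qed

text \<open>The factorials and the power of \<open>d - 1\<close> in the theorem are the factors
  \<open>bc\<close> hidden in \<open>u\<close>, up to the numbers of trees and one factor
  \<open>a\<close>.\<close>

lemma phi_integral_eq:
  "(real d - 1) powi (1 - int (Suc k) - int (Suc l)) / (fact k * fact l)
     * integral {0..1} (\<lambda>x. phi d (Suc k) x * phi d (Suc l) x)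
   = a * G k l / (real (num_trees (Suc k)) * real (num_trees (Suc l)))"
proof -
  have bc: "bc (Suc k) = real (num_trees (Suc k)) / (fact k * a ^ Suc k)" for k
    by (simp add: bc_def p_def field_simps del: of_nat_Suc)
  have "G k l = bc (Suc k) * bc (Suc l) * integral {0..1} (\<lambda>x. phi d (Suc k) x * phi d (Suc l) x)"
    unfolding G_def u_def by (simp add: mult_ac flip: integral_mult_right)
  then have "a * G k l / (real (num_trees (Suc k)) * real (num_trees (Suc l)))
      = a / (a ^ Suc k * a ^ Suc l) / (fact k * fact l) * integral {0..1} (\<lambda>x. phi d (Suc k) x * phi d (Suc l) x)"
    unfolding bc by (simp add: field_simps)
  also have "a / (a ^ Suc k * a ^ Suc l) = (real d - 1) powi (1 - int (Suc k) - int (Suc l))"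
  proof -
    have "1 - int (Suc k) - int (Suc l) = - int (Suc (k + l))" by simp
    then show ?thesis using a_pos
      by (simp only: power_int_minus power_int_of_nat a_def[symmetric]) (simp add: power_add divide_inverse)
  qed
  finally show ?thesis by simp
qed

lemma infsum_tree_pairs:
  fixes g :: "nat dary_tree \<Rightarrow> real"
  assumes bound: "\<And>T. T \<in> inc_trees d \<Longrightarrow> \<bar>g T\<bar> \<le> C"
  defines "h \<equiv> \<lambda>(T\<^sub>1, T\<^sub>2). (real d - 1) powi (1 - int (nverts T\<^sub>1) - int (nverts T\<^sub>2)) * g T\<^sub>1 * g T\<^sub>2
          / (fact (nverts T\<^sub>1 - 1) * fact (nverts T\<^sub>2 - 1))
          * integral {0..1} (\<lambda>x. phi d (nverts T\<^sub>1) x * phi d (nverts T\<^sub>2) x)"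
  shows "h summable_on (inc_trees d \<times> inc_trees d)"
    and "infsum h (inc_trees d \<times> inc_trees d)
       = a * integral {0..1} (\<lambda>x. (\<Sum>k. avg g (Suc k) * u k x)\<^sup>2)"
proof -
  define N where "N k = real (num_trees (Suc k))" for k
  have h: "h (T, T') = a * (g T / N k) * (g T' / N l) * G k l"
    if T: "T \<in> trees_on d {1..Suc k}" "T' \<in> trees_on d {1..Suc l}" for T T' k l
  proof -
    have n: "nverts T = Suc k" "nverts T' = Suc l" using T trees_onD(3) by force+
    have "h (T, T') = g T * g T' * ((real d - 1) powi (1 - int (Suc k) - int (Suc l)) / (fact k * fact l)
     * integral {0..1} (\<lambda>x. phi d (Suc k) x * phi d (Suc l) x))"
      unfolding h_def by (simp add: n)
    then show ?thesis unfolding phi_integral_eq by (simp add: N_def)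
  qed
  \<comment> \<open>Applied twice: to \<open>h\<close> with the weights \<open>g\<close> for the
    limit, and to \<open>|h|\<close> with the weights \<open>|g|\<close> for summability.\<close>
  have pairs: "(\<Sum>z\<in>small_trees n \<times> small_trees n. h' z)
      = a * (\<Sum>k<n. \<Sum>l<n. avg g' (Suc k) * avg g' (Suc l) * G k l)"
    if h': "\<And>T T' k l. T \<in> trees_on d {1..Suc k} \<Longrightarrow> T' \<in> trees_on d {1..Suc l} \<Longrightarrow>
      h' (T, T') = a * (g' T / N k) * (g' T' / N l) * G k l" for h' and g' :: "nat dary_tree \<Rightarrow> real" and n
  proof -
    have "(\<Sum>z\<in>small_trees n \<times> small_trees n. h' z)
        = (\<Sum>k<n. \<Sum>T\<in>trees_on d {1..Suc k}. \<Sum>l<n. \<Sum>T'\<in>trees_on d {1..Suc l}. h' (T, T'))"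
      by (simp add: sum.cartesian_product' sum_small_trees case_prod_unfold)
    also have "\<dots> = (\<Sum>k<n. \<Sum>T\<in>trees_on d {1..Suc k}. \<Sum>l<n. \<Sum>T'\<in>trees_on d {1..Suc l}.
        a * (g' T / N k) * (g' T' / N l) * G k l)"
      by (intro sum.cong refl h')
    also have "\<dots> = (\<Sum>k<n. \<Sum>l<n. \<Sum>T\<in>trees_on d {1..Suc k}. \<Sum>T'\<in>trees_on d {1..Suc l}.
        a * (g' T / N k) * (g' T' / N l) * G k l)"
      by (intro sum.cong refl sum.swap)
    also have "\<dots> = (\<Sum>k<n. \<Sum>l<n. a * (avg g' (Suc k) * avg g' (Suc l) * G k l))"
    proof (intro sum.cong refl)
      fix k l
      have av: "avg g' (Suc k) = (\<Sum>T\<in>trees_on d {1..Suc k}. g' T / N k)" for k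
        by (simp add: avg_def tree_sum_def N_def sum_divide_distrib)
      show "(\<Sum>T\<in>trees_on d {1..Suc k}. \<Sum>T'\<in>trees_on d {1..Suc l}. a * (g' T / N k) * (g' T' / N l) * G k l)
          = a * (avg g' (Suc k) * avg g' (Suc l) * G k l)"
        unfolding av sum_product unfolding sum_distrib_left sum_distrib_right by (intro sum.cong refl) (simp only: mult_ac)
    qed
    finally show ?thesis by (simp only: sum_distrib_left)
  qed
  have avgC: "\<bar>avg g (Suc k)\<bar> \<le> C" "avg (\<lambda>T. \<bar>g T\<bar>) (Suc k) \<le> C" "avg (\<lambda>T. \<bar>g T\<bar>) (Suc k) \<ge> 0" for k
  proof -
    show 1: "avg (\<lambda>T. \<bar>g T\<bar>) (Suc k) \<le> C"
      using avg_mono[of "Suc k" "\<lambda>T. \<bar>g T\<bar>" "\<lambda>_. C"] bound trees_on_inc_trees[of "Suc k"] by simp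
    show "\<bar>avg g (Suc k)\<bar> \<le> C" "avg (\<lambda>T. \<bar>g T\<bar>) (Suc k) \<ge> 0"
      using 1 norm_avg_le[of g "Suc k"] by simp_all
  qed
  have C: "C \<ge> 0" using avgC(2,3)[of 0] by linarith
  have lim: "(\<lambda>n. \<Sum>z\<in>small_trees n \<times> small_trees n. h z) \<longlonglongrightarrow>
      a * integral {0..1} (\<lambda>x. (\<Sum>k. avg g (Suc k) * u k x)\<^sup>2)"
  proof -
    have eq: "(\<Sum>z\<in>small_trees n \<times> small_trees n. h z)
        = a * (\<Sum>k<n. \<Sum>l<n. avg g (Suc k) * avg g (Suc l) * G k l)" for n
      by (rule pairs) (rule h)
    show ?thesis unfolding eq by (intro tendsto_mult tendsto_const sum_G_tendsto[where c = "avg g" and C = C] avgC)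
  qed
  have "(\<Sum>z\<in>small_trees n \<times> small_trees n. \<bar>h z\<bar>) \<le> a * (C * C * (1 / a\<^sup>2))" for n
  proof -
    have "(\<Sum>z\<in>small_trees n \<times> small_trees n. \<bar>h z\<bar>)
        = a * (\<Sum>k<n. \<Sum>l<n. avg (\<lambda>T. \<bar>g T\<bar>) (Suc k) * avg (\<lambda>T. \<bar>g T\<bar>) (Suc l) * G k l)"
      by (rule pairs) (use a_pos G_nonneg in \<open>simp add: h abs_mult N_def\<close>)
    also have "\<dots> \<le> a * (\<Sum>k<n. \<Sum>l<n. C * C * G k l)"
      using a_pos avgC C G_nonneg by (intro mult_left_mono sum_mono mult_mono) auto
    also have "\<dots> = a * (C * C * (\<Sum>k<n. \<Sum>l<n. G k l))" by (simp add: sum_distrib_left)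
    also have "\<dots> \<le> a * (C * C * (1 / a\<^sup>2))"
      using a_pos C sum_G_le by (intro mult_left_mono) auto
    finally show ?thesis .
  qed
  note bdd = this
  have inc: "incseq (\<lambda>n. small_trees n \<times> small_trees n)"
    using incseq_small_trees by (fastforce simp: incseq_def)
  have un: "(\<Union>n. small_trees n \<times> small_trees n) = inc_trees d \<times> inc_trees d"
  proof -
    have "\<exists>n. x \<in> small_trees n \<and> y \<in> small_trees n" if "x \<in> small_trees k" "y \<in> small_trees l" for x y k l
      using that incseqD[OF incseq_small_trees, of k "max k l"] incseqD[OF incseq_small_trees, of l "max k l"]
      by (intro exI[of _ "max k l"]) auto
    then show ?thesis unfolding UN_small_trees[symmetric] by auto
  qed
  have fin: "finite (small_trees n \<times> small_trees n)" for n by (simp add: finite_small_trees)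
  show "h summable_on (inc_trees d \<times> inc_trees d)"
    "infsum h (inc_trees d \<times> inc_trees d) = a * integral {0..1} (\<lambda>x. (\<Sum>k. avg g (Suc k) * u k x)\<^sup>2)"
    by (rule infsum_exhaustion[OF inc fin un bdd lim])+
qed

end

subsection \<open>Proof of the theorem\<close>

context toll
begin

lemma mean_asymptotics:
  "(\<lambda>n. measure_pmf.expectation (random_inc_tree d n) (additive_functional f)
      - (mu * real n + mu / (real d - 1))) \<in> o(\<lambda>_. 1)"
proof -
  have "measure_pmf.expectation (random_inc_tree d n) (additive_functional f)
      - (mu * real n + mu / (real d - 1)) = m n" if n: "n \<ge> 1" for n
  proof -
    have "m n = avg (\<lambda>T. additive_functional f T - (mu * real n + mu / a)) n"
      unfolding m_def using trees_onD(3)[OF n] by (intro avg_cong) (simp add: Y_def)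
    then show ?thesis by (simp add: expectation_random_inc_tree[OF n] avg_diff a_def)
  qed
  then have "\<forall>\<^sub>F n in sequentially. m n = (measure_pmf.expectation (random_inc_tree d n)
      (additive_functional f) - (mu * real n + mu / (real d - 1))) / 1"
    by (intro eventually_sequentiallyI[of 1]) simp
  from Lim_transform_eventually[OF m_tendsto_0 this] show ?thesis
    by (intro smalloI_tendsto) auto
qed

lemma variance_eq:
  assumes n: "n \<ge> 1"
  shows "measure_pmf.variance (random_inc_tree d n) (additive_functional f) = V n - (m n)\<^sup>2"
proof -
  define e where "e = avg (additive_functional f) n"
  have Y: "Y T = additive_functional f T - (mu * real n + mu / a)" if "T \<in> trees_on d {1..n}" for T
    using trees_onD(3)[OF n that] by (simp add: Y_def)
  have "m n = avg (\<lambda>T. additive_functional f T - (mu * real n + mu / a)) n"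
    unfolding m_def by (intro avg_cong Y)
  then have e: "m n = e - (mu * real n + mu / a)" by (simp add: avg_diff e_def)
  have "measure_pmf.variance (random_inc_tree d n) (additive_functional f)
      = avg (\<lambda>T. (additive_functional f T - e)\<^sup>2) n"
    by (simp add: expectation_random_inc_tree[OF n] e_def)
  also have "\<dots> = avg (\<lambda>T. ((Y T)\<^sup>2 + (m n)\<^sup>2) - 2 * m n * Y T) n"
    by (rule avg_cong) (simp add: Y e power2_eq_square algebra_simps)
  also have "\<dots> = V n + (m n)\<^sup>2 - 2 * m n * m n"
    by (simp only: avg_diff avg_add avg_cmult avg_const V_def m_def)
  finally show ?thesis by (simp add: power2_eq_square)
qed

lemma variance_asymptotics:
  "(\<lambda>n. measure_pmf.variance (random_inc_tree d n) (additive_functional f) - (a * sig) * real n)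
     \<in> o(\<lambda>n. real n)"
proof (rule smalloI_tendsto)
  have inv: "(\<lambda>n. 1 / real n) \<longlonglongrightarrow> 0" using lim_const_over_n[of "1::real"] by simp
  have "(\<lambda>n. V n / X n * (a + 1 / real n) - (m n)\<^sup>2 * (1 / real n) - a * sig)
      \<longlonglongrightarrow> sig * (a + 0) - 0\<^sup>2 * 0 - a * sig"
    by (intro tendsto_intros V_div_tendsto inv m_tendsto_0)
  then have lim: "(\<lambda>n. V n / X n * (a + 1 / real n) - (m n)\<^sup>2 * (1 / real n) - a * sig) \<longlonglongrightarrow> 0"
    by (simp add: mult.commute)
  have "\<forall>\<^sub>F n in sequentially. V n / X n * (a + 1 / real n) - (m n)\<^sup>2 * (1 / real n) - a * sig
     = (measure_pmf.variance (random_inc_tree d n) (additive_functional f) - (a * sig) * real n) / real n"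
    using eventually_ge_at_top[of 1]
  proof eventually_elim
    case (elim n)
    have "a + 1 / real n = X n / real n" using elim by (simp add: X_def field_simps)
    then show ?case
      unfolding variance_eq[OF elim] using elim by (simp add: diff_divide_distrib)
  qed
  from Lim_transform_eventually[OF lim this]
  show "(\<lambda>n. (measure_pmf.variance (random_inc_tree d n) (additive_functional f) - (a * sig) * real n)
      / real n) \<longlonglongrightarrow> 0" .
qed (auto intro: eventually_sequentiallyI[of 1])

lemma mu_series:
  shows "(\<lambda>T. f T * (\<Prod>j=1..nverts T. 1 / ((real d - 1) * real j + real d))) summable_on inc_trees d"
    and "mu = (real d - 1) * (\<Sum>\<^sub>\<infinity>T\<in>inc_trees d.
          f T * (\<Prod>j=1..nverts T. 1 / ((real d - 1) * real j + real d)))"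
proof -
  have summ: "summable (\<lambda>k. wt (Suc k) * avg (\<lambda>T. \<bar>f T\<bar>) (Suc k))"
    unfolding atau_def[symmetric] using atau_nonneg atau_le_B
    by (intro summable_wt_bounded[where C = B]) auto
  show "(\<lambda>T. f T * (\<Prod>j=1..nverts T. 1 / ((real d - 1) * real j + real d))) summable_on inc_trees d"
    by (rule infsum_trees(1)[OF summ])
  show "mu = (real d - 1) * (\<Sum>\<^sub>\<infinity>T\<in>inc_trees d.
          f T * (\<Prod>j=1..nverts T. 1 / ((real d - 1) * real j + real d)))"
    unfolding infsum_trees(2)[OF summ] mu_def tau_def a_def ..
qed

lemma variance_series:
  defines "g \<equiv> \<lambda>T. (f T)\<^sup>2 - 2 * f T * (additive_functional f T - mu * real (nverts T))"
  shows "(\<lambda>T. g T / (\<Prod>j=1..nverts T. (real d - 1) * real j + real d)) summable_on inc_trees d"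
    and "(\<Sum>\<^sub>\<infinity>T\<in>inc_trees d. g T / (\<Prod>j=1..nverts T. (real d - 1) * real j + real d))
      = real d * integral {0..1} (\<lambda>x. (Phi x)\<^sup>2) - (sig - mu\<^sup>2 / a\<^sup>2) - 2 * (mu / a) * (mu / a)"
proof -
  \<comment> \<open>The theorem centres by \<open>mu * n\<close> alone, \<open>Y\<close> also by
    \<open>mu / a\<close>. The last term corrects for this and produces the extra multiple of
    \<open>mu^2\<close> in the value of the sum.\<close>
  have g: "g T = (- 1) * (2 * f T * Y T - (f T)\<^sup>2) - 2 * (mu / a) * f T" for T
    by (simp add: g_def Y_def algebra_simps)
  have prod: "g T / (\<Prod>j=1..nverts T. (real d - 1) * real j + real d)
      = g T * (\<Prod>j=1..nverts T. 1 / ((real d - 1) * real j + real d))" for T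
    by (simp add: prod_dividef)
  have summ: "summable (\<lambda>k. wt (Suc k) * avg (\<lambda>T. \<bar>g T\<bar>) (Suc k))"
  proof (rule summable_comparison_test)
    show "summable (\<lambda>k. (2 * K + B + 2 * \<bar>mu / a\<bar>) * (wt (Suc k) * (X (Suc k) * atau (Suc k))))"
      by (intro summable_mult summable_wt_X_atau)
    show "\<exists>N. \<forall>k\<ge>N. norm (wt (Suc k) * avg (\<lambda>T. \<bar>g T\<bar>) (Suc k))
        \<le> (2 * K + B + 2 * \<bar>mu / a\<bar>) * (wt (Suc k) * (X (Suc k) * atau (Suc k)))"
    proof (intro exI[of _ 0] allI impI)
      fix k
      let ?n = "Suc k"
      have "avg (\<lambda>T. \<bar>g T\<bar>) ?n \<le> avg (\<lambda>T. 2 * \<bar>f T * Y T\<bar> + (f T)\<^sup>2 + 2 * \<bar>mu / a\<bar> * \<bar>f T\<bar>) ?n"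
      proof (rule avg_mono)
        fix T
        have "\<bar>g T\<bar> \<le> \<bar>2 * f T * Y T\<bar> + \<bar>(f T)\<^sup>2\<bar> + \<bar>2 * (mu / a) * f T\<bar>"
        proof -
          have "\<bar>(- 1) * (x - y) - z\<bar> \<le> \<bar>x\<bar> + \<bar>y\<bar> + \<bar>z\<bar>" for x y z :: real
            using abs_triangle_ineq4[of "y - x" z] abs_triangle_ineq4[of y x] by simp
          then show ?thesis unfolding g .
        qed
        then show "\<bar>g T\<bar> \<le> 2 * \<bar>f T * Y T\<bar> + (f T)\<^sup>2 + 2 * \<bar>mu / a\<bar> * \<bar>f T\<bar>"
          by (simp add: abs_mult)
      qed
      also have "\<dots> = 2 * avg (\<lambda>T. \<bar>f T * Y T\<bar>) ?n + avg (\<lambda>T. (f T)\<^sup>2) ?n + 2 * \<bar>mu / a\<bar> * atau ?n"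
        by (simp only: avg_add avg_cmult atau_def)
      also have "\<dots> \<le> 2 * (K * X ?n * atau ?n) + B * (X ?n * atau ?n) + 2 * \<bar>mu / a\<bar> * (X ?n * atau ?n)"
      proof -
        have le: "atau ?n \<le> X ?n * atau ?n"
          using X_ge_1[of ?n] atau_nonneg[of ?n] mult_right_mono[of 1 "X ?n" "atau ?n"] by simp
        have "avg (\<lambda>T. (f T)\<^sup>2) ?n \<le> B * (X ?n * atau ?n)"
          using avg_f_squared_le[of ?n] mult_left_mono[OF le B_nonneg] by simp
        moreover have "2 * \<bar>mu / a\<bar> * atau ?n \<le> 2 * \<bar>mu / a\<bar> * (X ?n * atau ?n)"
          by (intro mult_left_mono le) auto
        ultimately show ?thesis using abs_fY_le[of ?n] by simp
      qed
      also have "\<dots> = (2 * K + B + 2 * \<bar>mu / a\<bar>) * (X ?n * atau ?n)" by (simp add: algebra_simps)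
      finally have "wt ?n * avg (\<lambda>T. \<bar>g T\<bar>) ?n \<le> wt ?n * ((2 * K + B + 2 * \<bar>mu / a\<bar>) * (X ?n * atau ?n))"
        by (intro mult_left_mono wt_nonneg)
      moreover have "avg (\<lambda>T. \<bar>g T\<bar>) ?n \<ge> 0"
        using order_trans[OF norm_ge_zero norm_avg_le[of g ?n]] by simp
      ultimately show "norm (wt ?n * avg (\<lambda>T. \<bar>g T\<bar>) ?n)
          \<le> (2 * K + B + 2 * \<bar>mu / a\<bar>) * (wt ?n * (X ?n * atau ?n))"
        by (simp only: real_norm_def abs_mult abs_of_nonneg wt_nonneg mult.left_commute)
    qed
  qed
  show "(\<lambda>T. g T / (\<Prod>j=1..nverts T. (real d - 1) * real j + real d)) summable_on inc_trees d"
    unfolding prod by (rule infsum_trees(1)[OF summ])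
  have avg_g: "avg g n = q n - toll2 n - 2 * (mu / a) * tau n" for n
    unfolding g toll2_def tau_def by (simp only: avg_diff avg_cmult) simp
  have "(\<lambda>k. wt (Suc k) * toll2 (Suc k)) sums (sig - mu\<^sup>2 / a\<^sup>2)"
    using summable_sums[OF summable_wt_toll2] by (simp add: sig_def)
  moreover have "(\<lambda>k. wt (Suc k) * tau (Suc k)) sums (mu / a)"
    using summable_sums[OF summable_wt_tau] a_pos by (simp add: mu_def)
  ultimately have "(\<lambda>k. wt (Suc k) * q (Suc k) - wt (Suc k) * toll2 (Suc k)
      - 2 * (mu / a) * (wt (Suc k) * tau (Suc k))) sums
      (real d * integral {0..1} (\<lambda>x. (Phi x)\<^sup>2) - (sig - mu\<^sup>2 / a\<^sup>2) - 2 * (mu / a) * (mu / a))"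
    by (intro sums_diff sums_mult q_sums)
  moreover have "wt (Suc k) * q (Suc k) - wt (Suc k) * toll2 (Suc k)
      - 2 * (mu / a) * (wt (Suc k) * tau (Suc k)) = wt (Suc k) * avg g (Suc k)" for k
    unfolding avg_g by (simp add: algebra_simps)
  ultimately have "(\<Sum>k. wt (Suc k) * avg g (Suc k))
      = real d * integral {0..1} (\<lambda>x. (Phi x)\<^sup>2) - (sig - mu\<^sup>2 / a\<^sup>2) - 2 * (mu / a) * (mu / a)"
    by (simp add: sums_iff)
  then show "(\<Sum>\<^sub>\<infinity>T\<in>inc_trees d. g T / (\<Prod>j=1..nverts T. (real d - 1) * real j + real d))
      = real d * integral {0..1} (\<lambda>x. (Phi x)\<^sup>2) - (sig - mu\<^sup>2 / a\<^sup>2) - 2 * (mu / a) * (mu / a)"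
    unfolding prod infsum_trees(2)[OF summ] .
qed

lemma pair_series:
  defines "h \<equiv> \<lambda>T\<^sub>1 T\<^sub>2. (real d - 1) powi (1 - int (nverts T\<^sub>1) - int (nverts T\<^sub>2)) * f T\<^sub>1 * f T\<^sub>2
          / (fact (nverts T\<^sub>1 - 1) * fact (nverts T\<^sub>2 - 1))
          * integral {0..1} (\<lambda>x. phi d (nverts T\<^sub>1) x * phi d (nverts T\<^sub>2) x)"
  shows "(\<lambda>(T\<^sub>1, T\<^sub>2). h T\<^sub>1 T\<^sub>2) summable_on (inc_trees d \<times> inc_trees d)"
    and "(\<Sum>\<^sub>\<infinity>T\<^sub>1\<in>inc_trees d. \<Sum>\<^sub>\<infinity>T\<^sub>2\<in>inc_trees d. h T\<^sub>1 T\<^sub>2)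
      = a * integral {0..1} (\<lambda>x. (Phi x)\<^sup>2)"
proof -
  show summ: "(\<lambda>(T\<^sub>1, T\<^sub>2). h T\<^sub>1 T\<^sub>2) summable_on (inc_trees d \<times> inc_trees d)"
    unfolding h_def by (rule infsum_tree_pairs(1)[OF abs_toll_le])
  have "(\<Sum>\<^sub>\<infinity>T\<^sub>1\<in>inc_trees d. \<Sum>\<^sub>\<infinity>T\<^sub>2\<in>inc_trees d. h T\<^sub>1 T\<^sub>2)
      = infsum (\<lambda>(T\<^sub>1, T\<^sub>2). h T\<^sub>1 T\<^sub>2) (inc_trees d \<times> inc_trees d)"
    by (rule infsum_Sigma'_banach[OF summ])
  also have "\<dots> = a * integral {0..1} (\<lambda>x. (Phi x)\<^sup>2)"
    unfolding h_def Phi_def tau_def by (rule infsum_tree_pairs(2)[OF abs_toll_le])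
  finally show "(\<Sum>\<^sub>\<infinity>T\<^sub>1\<in>inc_trees d. \<Sum>\<^sub>\<infinity>T\<^sub>2\<in>inc_trees d. h T\<^sub>1 T\<^sub>2)
      = a * integral {0..1} (\<lambda>x. (Phi x)\<^sup>2)" .
qed

end

theorem theorem1:
  fixes d :: nat and f :: "nat dary_tree \<Rightarrow> real"
  assumes d: "d \<ge> 2"
    and C1: "bounded (f ` inc_trees d)"
    and C2_summable: "summable (\<lambda>k. measure_pmf.expectation (random_inc_tree d (Suc k)) (\<lambda>T. \<bar>f T\<bar>) / real (Suc k))"
    and C2_limit: "(\<lambda>n. measure_pmf.expectation (random_inc_tree d n) (\<lambda>T. \<bar>f T\<bar>)) \<longlonglongrightarrow> 0"
  shows "\<exists>\<mu> \<sigma> :: real.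
    (\<lambda>n. measure_pmf.expectation (random_inc_tree d n) (additive_functional f)
          - (\<mu> * real n + \<mu> / (real d - 1))) \<in> o(\<lambda>_. 1)
  \<and> (\<lambda>n. measure_pmf.variance (random_inc_tree d n) (additive_functional f) - \<sigma>\<^sup>2 * real n) \<in> o(\<lambda>n. real n)
  \<and> (\<lambda>T. f T * (\<Prod>j=1..nverts T. 1 / ((real d - 1) * real j + real d))) summable_on inc_trees d
  \<and> \<mu> = (real d - 1) * (\<Sum>\<^sub>\<infinity>T\<in>inc_trees d.
          f T * (\<Prod>j=1..nverts T. 1 / ((real d - 1) * real j + real d)))
  \<and> (\<lambda>T. ((f T)\<^sup>2 - 2 * f T * (additive_functional f T - \<mu> * real (nverts T)))
          / (\<Prod>j=1..nverts T. (real d - 1) * real j + real d)) summable_on inc_trees d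
  \<and> (\<lambda>(T\<^sub>1, T\<^sub>2). (real d - 1) powi (1 - int (nverts T\<^sub>1) - int (nverts T\<^sub>2)) * f T\<^sub>1 * f T\<^sub>2
          / (fact (nverts T\<^sub>1 - 1) * fact (nverts T\<^sub>2 - 1))
          * integral {0..1} (\<lambda>x. phi d (nverts T\<^sub>1) x * phi d (nverts T\<^sub>2) x))
        summable_on (inc_trees d \<times> inc_trees d)
  \<and> \<sigma>\<^sup>2 = - \<mu>\<^sup>2 / (real d - 1)
        - (real d - 1) * (\<Sum>\<^sub>\<infinity>T\<in>inc_trees d.
            ((f T)\<^sup>2 - 2 * f T * (additive_functional f T - \<mu> * real (nverts T)))
            / (\<Prod>j=1..nverts T. (real d - 1) * real j + real d))
        + real d * (\<Sum>\<^sub>\<infinity>T\<^sub>1\<in>inc_trees d. \<Sum>\<^sub>\<infinity>T\<^sub>2\<in>inc_trees d.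
            (real d - 1) powi (1 - int (nverts T\<^sub>1) - int (nverts T\<^sub>2)) * f T\<^sub>1 * f T\<^sub>2
            / (fact (nverts T\<^sub>1 - 1) * fact (nverts T\<^sub>2 - 1))
            * integral {0..1} (\<lambda>x. phi d (nverts T\<^sub>1) x * phi d (nverts T\<^sub>2) x))
  \<and> (\<sigma> \<noteq> 0 \<longrightarrow>
        weak_conv_m
          (\<lambda>n. distr (measure_pmf (random_inc_tree d n)) borel
                 (\<lambda>T. (additive_functional f T - \<mu> * real n) / sqrt (\<sigma>\<^sup>2 * real n)))
          std_normal_distribution)"
proof -
  interpret dary_trees d by unfold_locales (rule d)
  \<comment> \<open>There is no increasing tree of size 0, so the expectation is identified with
    \<open>avg\<close> only from size 1 on.\<close>
  have eq: "measure_pmf.expectation (random_inc_tree d n) (\<lambda>T. \<bar>f T\<bar>) = avg (\<lambda>T. \<bar>f T\<bar>) n" if "n \<ge> 1" for n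
    by (rule expectation_random_inc_tree[OF that])
  interpret toll d f
  proof
    show "bounded (f ` inc_trees d)" by (rule C1)
    show "summable (\<lambda>k. avg (\<lambda>T. \<bar>f T\<bar>) (Suc k) / real (Suc k))"
      using C2_summable by (simp add: eq)
    have "\<forall>\<^sub>F n in sequentially. measure_pmf.expectation (random_inc_tree d n) (\<lambda>T. \<bar>f T\<bar>)
        = avg (\<lambda>T. \<bar>f T\<bar>) n"
      by (intro eventually_sequentiallyI[of 1] eq)
    from Lim_transform_eventually[OF C2_limit this] show "avg (\<lambda>T. \<bar>f T\<bar>) \<longlonglongrightarrow> 0" .
  qed
  define \<sigma> where "\<sigma> = sqrt (a * sig)"
  have \<sigma>: "\<sigma>\<^sup>2 = a * sig" using a_pos sig_nonneg by (simp add: \<sigma>_def)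
  \<comment> \<open>The integrals cancel. The multiples of \<open>mu^2 / a\<close> are -1 from the
    explicit term, -1 from the initial value \<open>V 0\<close> contained in \<open>sig\<close>, and
    +2 from the shift by \<open>mu / a\<close>; what is left is \<open>a * sig\<close>.\<close>
  have "\<sigma>\<^sup>2 = - mu\<^sup>2 / (real d - 1)
        - (real d - 1) * (real d * integral {0..1} (\<lambda>x. (Phi x)\<^sup>2) - (sig - mu\<^sup>2 / a\<^sup>2)
            - 2 * (mu / a) * (mu / a))
        + real d * (a * integral {0..1} (\<lambda>x. (Phi x)\<^sup>2))"
    unfolding \<sigma> a_def[symmetric] using a_pos by (simp add: field_simps power2_eq_square)
  then have formula: "\<sigma>\<^sup>2 = - mu\<^sup>2 / (real d - 1)
        - (real d - 1) * (\<Sum>\<^sub>\<infinity>T\<in>inc_trees d.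
            ((f T)\<^sup>2 - 2 * f T * (additive_functional f T - mu * real (nverts T)))
            / (\<Prod>j=1..nverts T. (real d - 1) * real j + real d))
        + real d * (\<Sum>\<^sub>\<infinity>T\<^sub>1\<in>inc_trees d. \<Sum>\<^sub>\<infinity>T\<^sub>2\<in>inc_trees d.
            (real d - 1) powi (1 - int (nverts T\<^sub>1) - int (nverts T\<^sub>2)) * f T\<^sub>1 * f T\<^sub>2
            / (fact (nverts T\<^sub>1 - 1) * fact (nverts T\<^sub>2 - 1))
            * integral {0..1} (\<lambda>x. phi d (nverts T\<^sub>1) x * phi d (nverts T\<^sub>2) x))"
    unfolding variance_series(2) pair_series(2) .
  show ?thesis
  proof (rule exI[of _ mu], rule exI[of _ \<sigma>], intro conjI impI)
    show "(\<lambda>n. measure_pmf.variance (random_inc_tree d n) (additive_functional f) - \<sigma>\<^sup>2 * real n) \<in> o(\<lambda>n. real n)"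
      unfolding \<sigma> by (rule variance_asymptotics)
    show "weak_conv_m
          (\<lambda>n. distr (measure_pmf (random_inc_tree d n)) borel
                 (\<lambda>T. (additive_functional f T - mu * real n) / sqrt (\<sigma>\<^sup>2 * real n)))
          std_normal_distribution" if "\<sigma> \<noteq> 0"
      by (rule clt[OF that \<sigma>])
  qed (fact mean_asymptotics mu_series variance_series(1) pair_series(1) formula)+
qed

end
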